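(* Let $r\ge 2$ be an integer, let $p,p'$ be coprime positive integers, and let $j$ be an integer with $0\le j\le r-1$. Let $J_{T(p,p')}(L_r(m\Lambda_1))$ be the framing-dependent, un-normalized $\mathfrak{sl}_r$ invariant of the torus knot $T(p,p')$ coloured by $L_r(m\Lambda_1)$. Then $$\lim_{n\to\infty}J_{T(p,p')}\bigl(L_r((j+nr)\Lambda_1)\bigr)=\frac{(q;q)_\infty^{r-1}}{\prod_{\alpha\in\Phi_r^+}\bigl(1-q^{(\alpha,\delta)}\bigr)}\cdot\overline{\chi}^{\,r,p,p';\,j\Lambda_1}_{0,0},$$ where $$\overline{\chi}^{\,r,p,p';\,\mu}_{0,0}=\frac{1}{(q;q)_\infty^{r-1}}\sum_{\alpha\in Q_r+\mu}\ \sum_{\sigma\in\mathfrak{S}_r}(-1)^{\ell(\sigma)}q^{\frac12 pp'\|\alpha\|^2-p'(\alpha,\delta)+p(\alpha,\sigma\delta)-(\delta,\sigma\delta-\delta)}\qquad(\mu\in P_r).$$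
   Context: Lie algebra notation. Consider $\mathfrak{sl}_r$ over $\mathbb{C}$; its weights are realized in the space spanned by orthonormal symbols $\epsilon_1,\dots,\epsilon_r$ with form $(\cdot,\cdot)$, $(\epsilon_i,\epsilon_j)=\delta_{ij}$, $\|v\|^2=(v,v)$. Simple roots: $\alpha_i=\epsilon_i-\epsilon_{i+1}$, $1\le i\le r-1$. Fundamental weights: $\Lambda_i=\frac{r-i}{r}(\epsilon_1+\cdots+\epsilon_i)-\frac{i}{r}(\epsilon_{i+1}+\cdots+\epsilon_r)$. $Q_r=\bigoplus_i\mathbb{Z}\alpha_i\subseteq P_r=\bigoplus_i\mathbb{Z}\Lambda_i$ are the root and weight lattices and $P_r^+$ is the set of dominant integral weights. $\Phi_r^+=\{\epsilon_i-\epsilon_j: i<j\}$ is the set of positive roots. The Weyl vector is $\delta=\sum_{i=1}^r\frac{r+1-2i}{2}\epsilon_i$. The Weyl group $\mathfrak{S}_r$ permutes the subscripts of the $\epsilon_i$, and $\ell(w)$ is Coxeter length with respect to the simple transpositions $(i,i+1)$. $L_r(\lambda)$ is the finite-dimensional irreducible $\mathfrak{sl}_r$-module of highest weight $\lambda\in P_r^+$. $(q;q)_\infty=\prod_{k\ge1}(1-q^k)$. Characters. Characters live in the group algebra of $P_r$ with basis $\mathbf{x}^\lambda$, $\lambda\in P_r$, $\mathbf{x}^\lambda\mathbf{x}^\mu=\mathbf{x}^{\lambda+\mu}$. The quantum dimension is the algebra homomorphism $\operatorname{qdim}(\mathbf{x}^\lambda)=q^{(\lambda,\delta)}$, and $\operatorname{qdim}(L_r(\lambda))$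 means $\operatorname{qdim}$ of the character of $L_r(\lambda)$. The $p$th Adams operation is $\psi_p(\mathbf{x}^\lambda)=\mathbf{x}^{p\lambda}$; for $\lambda\in P_r^+$ define integers $m^\mu_{\lambda,p}$ (finitely many nonzero) by $\psi_p(\operatorname{ch}L_r(\lambda))=\sum_{\mu\in P_r^+}m^\mu_{\lambda,p}\operatorname{ch}L_r(\mu)$. The invariant. $J_{T(p,p')}(L_r(\lambda))$ is the Reshetikhin–Turaev invariant of $T(p,p')$ coloured by $L_r(\lambda)$, with the framing of writhe $pp'$ inherited from the $(p,p')$ cabling of the zero-framed unknot, not normalized by the value on the unknot. By the Rosso–Jones formula (a known theorem, which may be taken as the definition) it equals $$J_{T(p,p')}(L_r(\lambda))=\sum_{\mu\in P_r^+}m^\mu_{\lambda,p}\cdot\operatorname{qdim}(L_r(\mu))\cdot\theta_{L_r(\mu)}^{p'/p},\qquad \theta_{L_r(\mu)}=q^{\frac12(\mu,\mu+2\delta)} .$$ Here $q$ is a formal variable and fractional powers are allowed (exponents in $\frac1N\mathbb{Z}$ for a fixed positive integer $N$ depending only on $r,p$). The limit is taken coefficientwise in formal Laurent series in $q^{1/N}$, with fractions expanded in nonnegative powers of $q$. *)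

theory Defs
  imports
    "HOL-Analysis.Infinite_Sum"
    "HOL-Analysis.Infinite_Products"
    "HOL-Computational_Algebra.Formal_Laurent_Series"
    "HOL-Combinatorics.Permutations"
    "HOL-Library.Function_Algebras"
    "HOL-Library.Poly_Mapping"
    "Jordan_Normal_Form.Matrix"
begin

no_notation fls_nth (infixl "$$" 75)

section \<open>Weights of \<open>sl_r\<close>\<close>

text \<open>A weight \<open>v\<^sub>1 \<epsilon>\<^sub>1 + \<dots> + v\<^sub>r \<epsilon>\<^sub>r\<close> is the function \<open>i \<mapsto> v\<^sub>i\<close>, which is zero outside \<open>{1..r}\<close>;
  addition is the pointwise one of \<^theory>\<open>HOL-Library.Function_Algebras\<close>. All coordinates that
  occur are rational.\<close>

type_synonym weight = "nat \<Rightarrow> rat"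

definition wscale :: "rat \<Rightarrow> weight \<Rightarrow> weight" where
  "wscale c v = (\<lambda>k. c * v k)"

definition ip :: "nat \<Rightarrow> weight \<Rightarrow> weight \<Rightarrow> rat" where
  "ip r v w = (\<Sum>i=1..r. v i * w i)"

definition eps :: "nat \<Rightarrow> weight" where
  "eps i = (\<lambda>k. if k = i then 1 else 0)"

definition simple_root :: "nat \<Rightarrow> weight" where
  "simple_root i = eps i - eps (i + 1)"

definition fund_weight :: "nat \<Rightarrow> nat \<Rightarrow> weight" where
  "fund_weight r i =
     wscale (of_nat (r - i) / of_nat r) (\<Sum>k=1..i. eps k)
     - wscale (of_nat i / of_nat r) (\<Sum>k=i+1..r. eps k)"

definition root_lattice :: "nat \<Rightarrow> weight set" where
  "root_lattice r = {\<Sum>i=1..r-1. wscale (of_int (c i)) (simple_root i) | c :: nat \<Rightarrow> int. True}"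

definition weight_lattice :: "nat \<Rightarrow> weight set" where
  "weight_lattice r = {\<Sum>i=1..r-1. wscale (of_int (c i)) (fund_weight r i) | c :: nat \<Rightarrow> int. True}"

definition dominant_weights :: "nat \<Rightarrow> weight set" where
  "dominant_weights r =
     {v \<in> weight_lattice r. \<forall>i\<in>{1..r-1}. 0 \<le> ip r v (simple_root i)}"

definition positive_roots :: "nat \<Rightarrow> weight set" where
  "positive_roots r = {eps i - eps j | i j. 1 \<le> i \<and> i < j \<and> j \<le> r}"

definition weyl_vector :: "nat \<Rightarrow> weight" where
  "weyl_vector r = (\<Sum>i=1..r. wscale ((of_nat r + 1 - 2 * of_nat i) / 2) (eps i))"

text \<open>The action sends \<open>\<epsilon>\<^sub>i\<close> to \<open>\<epsilon>\<^bsub>\<sigma> i\<^esub>\<close>, hence the inverse on coordinates.\<close>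

definition weyl_act :: "(nat \<Rightarrow> nat) \<Rightarrow> weight \<Rightarrow> weight" where
  "weyl_act \<sigma> v = (\<lambda>k. v (inv_into UNIV \<sigma> k))"

definition coxeter_length :: "nat \<Rightarrow> (nat \<Rightarrow> nat) \<Rightarrow> nat" where
  "coxeter_length r \<sigma> =
     (LEAST l. \<exists>is. length is = l \<and> set is \<subseteq> {1..r-1} \<and>
        \<sigma> = foldr (\<lambda>i \<tau>. Transposition.transpose i (i + 1) \<circ> \<tau>) is id)"

section \<open>Finite-dimensional \<open>sl_r\<close>-modules\<close>

definition sl :: "nat \<Rightarrow> complex mat set" where
  "sl r = {X \<in> carrier_mat r r. (\<Sum>i<r. X $$ (i, i)) = 0}"

text \<open>The space of a module is a subspace of an ambient complex vector space on the
  type \<open>'v\<close>, so that modules of different dimensions live on one type.\<close>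

record 'v sl_rep =
  scale :: "complex \<Rightarrow> 'v \<Rightarrow> 'v"
  vspace :: "'v set"
  action :: "complex mat \<Rightarrow> 'v \<Rightarrow> 'v"

definition sl_module :: "nat \<Rightarrow> 'v::ab_group_add sl_rep \<Rightarrow> bool" where
  "sl_module r M \<longleftrightarrow>
     vector_space (scale M) \<and>
     module.subspace (scale M) (vspace M) \<and>
     (\<exists>B. finite B \<and> vspace M = module.span (scale M) B) \<and>
     (\<forall>X\<in>sl r. \<forall>v\<in>vspace M. action M X v \<in> vspace M) \<and>
     (\<forall>X\<in>sl r. \<forall>v\<in>vspace M. \<forall>w\<in>vspace M.
        action M X (v + w) = action M X v + action M X w) \<and>
     (\<forall>X\<in>sl r. \<forall>c. \<forall>v\<in>vspace M. action M X (scale M c v) = scale M c (action M X v)) \<and>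
     (\<forall>X\<in>sl r. \<forall>Y\<in>sl r. \<forall>v\<in>vspace M. action M (X + Y) v = action M X v + action M Y v) \<and>
     (\<forall>X\<in>sl r. \<forall>c. \<forall>v\<in>vspace M. action M (c \<cdot>\<^sub>m X) v = scale M c (action M X v)) \<and>
     (\<forall>X\<in>sl r. \<forall>Y\<in>sl r. \<forall>v\<in>vspace M.
        action M (X * Y - Y * X) v = action M X (action M Y v) - action M Y (action M X v))"

definition sl_irreducible :: "nat \<Rightarrow> 'v::ab_group_add sl_rep \<Rightarrow> bool" where
  "sl_irreducible r M \<longleftrightarrow>
     vspace M \<noteq> {0} \<and>
     (\<forall>W \<subseteq> vspace M.
        module.subspace (scale M) W \<and> (\<forall>X\<in>sl r. \<forall>v\<in>W. action M X v \<in> W) \<longrightarrow>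
        W = {0} \<or> W = vspace M)"

text \<open>The weight \<open>\<epsilon>\<^sub>i\<close> evaluates on a diagonal matrix to its \<open>i\<close>-th diagonal entry; matrix indices
  start at 0.\<close>

definition weight_space :: "nat \<Rightarrow> 'v::ab_group_add sl_rep \<Rightarrow> weight \<Rightarrow> 'v set" where
  "weight_space r M \<nu> =
     {v \<in> vspace M. \<forall>H\<in>sl r. diagonal_mat H \<longrightarrow>
        action M H v = scale M (\<Sum>i=1..r. of_rat (\<nu> i) * H $$ (i - 1, i - 1)) v}"

definition has_highest_weight :: "nat \<Rightarrow> 'v::ab_group_add sl_rep \<Rightarrow> weight \<Rightarrow> bool" where
  "has_highest_weight r M \<nu> \<longleftrightarrow>
     (\<exists>v\<in>weight_space r M \<nu>. v \<noteq> 0 \<and>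
        (\<forall>i j. i < j \<and> j < r \<longrightarrow>
           action M (mat r r (\<lambda>(a, b). if a = i \<and> b = j then 1 else 0)) v = 0))"

text \<open>\<open>is_L r \<nu> M\<close> says that \<open>M\<close> is (a copy of) the finite-dimensional irreducible module
  \<open>L\<^sub>r(\<nu>)\<close>.\<close>

definition is_L :: "nat \<Rightarrow> weight \<Rightarrow> 'v::ab_group_add sl_rep \<Rightarrow> bool" where
  "is_L r \<nu> M \<longleftrightarrow> sl_module r M \<and> sl_irreducible r M \<and> has_highest_weight r M \<nu>"

section \<open>Characters\<close>

text \<open>The group algebra of the weight lattice sits inside the group ring \<open>weight \<Rightarrow>\<^sub>0 int\<close>, with
  \<open>Poly_Mapping.single \<nu> 1\<close> as the basis element \<open>x\<^sup>\<nu>\<close>.\<close>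

definition ch :: "nat \<Rightarrow> 'v::ab_group_add sl_rep \<Rightarrow> weight \<Rightarrow>\<^sub>0 int" where
  "ch r M =
     (\<Sum>\<nu> | \<nu> \<in> weight_lattice r \<and> weight_space r M \<nu> \<noteq> {0}.
        Poly_Mapping.single \<nu> (int (vector_space.dim (scale M) (weight_space r M \<nu>))))"

definition adams :: "nat \<Rightarrow> (weight \<Rightarrow>\<^sub>0 int) \<Rightarrow> weight \<Rightarrow>\<^sub>0 int" where
  "adams p f =
     (\<Sum>\<nu>\<in>Poly_Mapping.keys f.
        Poly_Mapping.single (wscale (of_nat p) \<nu>) (Poly_Mapping.lookup f \<nu>))"

text \<open>The coefficients \<open>m\<^sup>\<mu>\<^bsub>\<nu>,p\<^esub>\<close>; multiplication by \<open>Poly_Mapping.single 0 c\<close> is scaling by \<open>c\<close>.\<close>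

definition adams_coeffs ::
  "(weight \<Rightarrow> 'v::ab_group_add sl_rep) \<Rightarrow> nat \<Rightarrow> nat \<Rightarrow> weight \<Rightarrow> weight \<Rightarrow>\<^sub>0 int" where
  "adams_coeffs L r p \<nu> =
     (THE m. Poly_Mapping.keys m \<subseteq> dominant_weights r \<and>
        adams p (ch r (L \<nu>)) =
          (\<Sum>\<mu>\<in>Poly_Mapping.keys m.
             Poly_Mapping.single 0 (Poly_Mapping.lookup m \<mu>) * ch r (L \<mu>)))"

section \<open>The torus knot invariant\<close>

text \<open>Series in \<open>q\<^bsup>1/N\<^esup>\<close> are formal Laurent series whose variable is \<open>q\<^bsup>1/N\<^esup>\<close>. The rounding in
  \<open>qpow\<close> is never effective: for \<open>N = 2 r p\<close> every exponent \<open>e\<close> occurring below satisfies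
  \<open>N e \<in> \<int>\<close>.\<close>

definition q_denom :: "nat \<Rightarrow> nat \<Rightarrow> nat" where
  "q_denom r p = 2 * r * p"

definition qpow :: "nat \<Rightarrow> rat \<Rightarrow> complex fls" where
  "qpow N e = fls_X_intpow \<lfloor>of_nat N * e\<rfloor>"

definition qdim :: "nat \<Rightarrow> nat \<Rightarrow> (weight \<Rightarrow>\<^sub>0 int) \<Rightarrow> complex fls" where
  "qdim N r f =
     (\<Sum>\<nu>\<in>Poly_Mapping.keys f.
        of_int (Poly_Mapping.lookup f \<nu>) * qpow N (ip r \<nu> (weyl_vector r)))"

text \<open>Rosso--Jones formula for the framed, un-normalized invariant of \<open>T(p,p')\<close> coloured by \<open>L \<nu>\<close>.
  The power \<open>\<theta>\<^bsup>p'/p\<^esup>\<close> is taken on the exponent of \<open>q\<close>.\<close>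

definition torus_knot_inv ::
  "(weight \<Rightarrow> 'v::ab_group_add sl_rep) \<Rightarrow> nat \<Rightarrow> nat \<Rightarrow> nat \<Rightarrow> weight \<Rightarrow> complex fls" where
  "torus_knot_inv L r p p' \<nu> =
     (let N = q_denom r p; m = adams_coeffs L r p \<nu> in
      \<Sum>\<mu>\<in>Poly_Mapping.keys m.
        of_int (Poly_Mapping.lookup m \<mu>) * qdim N r (ch r (L \<mu>)) *
        qpow N ((of_nat p' / of_nat p) * (1/2 * ip r \<mu> (\<mu> + wscale 2 (weyl_vector r)))))"

section \<open>The limit\<close>

text \<open>Infinite products and sums refer to the \<open>X\<close>-adic metric of the library on Laurent series.\<close>

definition q_poch_inf :: "nat \<Rightarrow> complex fls" where
  "q_poch_inf N = prodinf (\<lambda>k. 1 - qpow N (of_nat (k + 1)))"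

definition chi_bar :: "nat \<Rightarrow> nat \<Rightarrow> nat \<Rightarrow> nat \<Rightarrow> weight \<Rightarrow> complex fls" where
  "chi_bar N r p p' \<mu> =
     1 / q_poch_inf N ^ (r - 1) *
     (\<Sum>\<^sub>\<infinity>\<alpha>\<in>{\<beta> + \<mu> | \<beta>. \<beta> \<in> root_lattice r}.
        \<Sum>\<sigma> | \<sigma> permutes {1..r}.
          (-1) ^ coxeter_length r \<sigma> *
          (let \<delta> = weyl_vector r in
           qpow N (1/2 * of_nat p * of_nat p' * ip r \<alpha> \<alpha>
                   - of_nat p' * ip r \<alpha> \<delta>
                   + of_nat p * ip r \<alpha> (weyl_act \<sigma> \<delta>)
                   - ip r \<delta> (weyl_act \<sigma> \<delta> - \<delta>))))"

end

theory Submission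
  imports Defs
begin

text \<open>Let \<open>D\<close> be the Weyl denominator and \<open>A\<^sub>v = \<Sum>\<sigma>. (-1)\<^bsup>\<ell>(\<sigma>)\<^esup> x\<^bsup>\<sigma> v\<^esup>\<close>. Taking traces of the Casimir operator on
  weight spaces gives Freudenthal's recursion for the character of an irreducible module; hence
  \<open>D ch L(\<mu>)\<close> is an eigenvector of the Laplacian, so that all its exponents have the norm of
  \<open>\<mu> + \<delta>\<close>. Being alternating with leading exponent \<open>\<mu> + \<delta>\<close>, it equals \<open>A\<^bsub>\<mu>+\<delta>\<^esub>\<close>. The complete
  homogeneous symmetric function \<open>h\<^sub>m\<close> satisfies the same recursion, so it is the character of
  \<open>L(m \<Lambda>\<^sub>1)\<close>.

  The twist factor depends on \<open>\<mu>\<close> only through the norm of \<open>\<mu> + \<delta>\<close>, which is constant on the exponents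
  of \<open>A\<^bsub>\<mu>+\<delta>\<^esub>\<close>. The invariant times the principal specialisation of \<open>D\<close> is therefore a linear
  functional evaluated at \<open>D \<psi>\<^sub>p(h\<^sub>m)\<close>, that is, a sum over \<open>\<sigma>\<close> and over the weights of \<open>h\<^sub>m\<close>. After a
  reindexing by the Weyl group the summands are those of the limit and do not depend on \<open>m\<close>, while
  the weights of \<open>h\<^bsub>j+nr\<^esub>\<close> exhaust \<open>Q + j \<Lambda>\<^sub>1\<close> as \<open>n\<close> grows. The exponents form a positive definite
  quadratic function, so every coefficient stabilises.\<close>

section \<open>Weights\<close>

text \<open>The modules \<open>L \<nu>\<close> are known only through \<open>is_L\<close>, and the
  Adams coefficients only through a definite description, so the argument has to work for arbitrary
  irreducible modules. This is why Freudenthal's recursion is imposed on group ring elements instead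
  of modules: a character and an explicit polynomial with the same highest weight are then
  identified by cancelling the denominator, and symmetric powers never have to be built as modules.
  The operators are indexed like those of gl_r, since projecting matrix units to trace zero keeps
  their commutation relations.

  In the evaluation the exponent is \<sigma>\<delta> + p\<alpha>, and
  (p'/2p)(2p(\<alpha>,\<sigma>\<delta>) + p^2(\<alpha>,\<alpha>)) has no denominator p left; this
  produces the quadratic form of the limit. The summand (\<delta>,\<delta>) of the limiting exponent
  compensates the leading power of the specialised denominator. Although \<open>qpow\<close> rounds,
  it is split only where one of the two exponents is integral after scaling. The Pochhammer factor
  cancels against \<open>chi_bar\<close>, so what has to be known about it is that it is
  nonzero.\<close>

abbreviation "coef \<equiv> Poly_Mapping.lookup"
abbreviation "supp \<equiv> Poly_Mapping.keys"
abbreviation xpow :: "weight \<Rightarrow> weight \<Rightarrow>\<^sub>0 'a::zero_neq_one" where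
  "xpow v \<equiv> Poly_Mapping.single v 1"

lemma sum_fun_apply: "(\<Sum>i\<in>A. f i) k = (\<Sum>i\<in>A. f i k)"
  for f :: "'a \<Rightarrow> 'b \<Rightarrow> 'c::comm_monoid_add"
  by (induction A rule: infinite_finite_induct) auto

definition supported :: "nat \<Rightarrow> weight \<Rightarrow> bool" where
  "supported r v \<longleftrightarrow> (\<forall>k. k \<notin> {1..r} \<longrightarrow> v k = 0)"

text \<open>On vectors with coordinate sum zero this is the pairing with the fundamental weight
  \<Lambda>_k. Comparing all \<open>psum k\<close> therefore means that the difference is a
  nonnegative rational combination of simple roots.\<close>

definition psum :: "nat \<Rightarrow> weight \<Rightarrow> rat" where
  "psum k v = (\<Sum>i=1..k. v i)"

definition strictly_dominant :: "nat \<Rightarrow> weight \<Rightarrow> bool" where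
  "strictly_dominant r v \<longleftrightarrow> (\<forall>k\<in>{1..<r}. v (k + 1) < v k)"

lemma supported_add: "supported r v \<Longrightarrow> supported r w \<Longrightarrow> supported r (v + w)"
  by (simp add: supported_def)

lemma supported_diff: "supported r v \<Longrightarrow> supported r w \<Longrightarrow> supported r (v - w)"
  by (simp add: supported_def)

lemma supported_wscale: "supported r v \<Longrightarrow> supported r (wscale c v)"
  by (simp add: supported_def wscale_def)

lemma supported_eqI:
  "supported r v \<Longrightarrow> supported r w \<Longrightarrow> (\<And>k. k \<in> {1..r} \<Longrightarrow> v k = w k) \<Longrightarrow> v = w"
  unfolding supported_def by (metis ext)

lemma psum_add: "psum k (v + w) = psum k v + psum k w"
  by (simp add: psum_def sum.distrib)

lemma psum_diff: "psum k (v - w) = psum k v - psum k w"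
  by (simp add: psum_def sum_subtractf)

lemma psum_wscale: "psum k (wscale c v) = c * psum k v"
  by (simp add: psum_def wscale_def sum_distrib_left)

lemma psum_0 [simp]: "psum 0 v = 0"
  by (simp add: psum_def)

lemma psum_Suc: "psum (Suc k) v = psum k v + v (Suc k)"
  by (simp add: psum_def)

lemma psum_zero_imp_zero:
  assumes "supported r v" "\<And>k. k \<in> {1..r} \<Longrightarrow> psum k v = 0"
  shows "v = 0"
proof (rule supported_eqI[OF assms(1)])
  show "supported r 0" by (simp add: supported_def)
  fix k assume k: "k \<in> {1..r}"
  then obtain l where l: "k = Suc l" by (cases k) auto
  have "psum l v = 0" using assms(2)[of l] k l by (cases "l = 0") auto
  with assms(2)[OF k] show "v k = 0 k" by (simp add: l psum_Suc)
qed

lemma ip_abel_summation: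
  "ip (Suc r) v w = (\<Sum>k=1..r. psum k v * (w k - w (k + 1))) + psum (Suc r) v * w (Suc r)"
proof (induction r)
  case 0
  then show ?case by (simp add: ip_def psum_def)
next
  case (Suc r)
  have "ip (Suc (Suc r)) v w = ip (Suc r) v w + v (Suc (Suc r)) * w (Suc (Suc r))"
    by (simp add: ip_def)
  then show ?case unfolding Suc by (simp add: psum_Suc algebra_simps)
qed

text \<open>The coefficients of v in the simple roots are paired with the values of w on the simple
  roots. The positivity arguments below read off the signs of these two factors separately.\<close>

lemma ip_abel_summation_traceless:
  assumes "psum r v = 0"
  shows "ip r v w = (\<Sum>k\<in>{1..<r}. psum k v * (w k - w (k + 1)))"
proof (cases r)
  case (Suc n)
  then show ?thesis using ip_abel_summation[of n v w] assms
    by (simp add: atLeastLessThanSuc_atLeastAtMost)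
qed (simp add: ip_def)

lemma ip_add_left: "ip r (u + v) w = ip r u w + ip r v w"
  by (simp add: ip_def sum.distrib algebra_simps)

lemma ip_add_right: "ip r w (u + v) = ip r w u + ip r w v"
  by (simp add: ip_def sum.distrib algebra_simps)

lemma ip_diff_left: "ip r (u - v) w = ip r u w - ip r v w"
  by (simp add: ip_def sum_subtractf algebra_simps)

lemma ip_diff_right: "ip r w (u - v) = ip r w u - ip r w v"
  by (simp add: ip_def sum_subtractf algebra_simps)

lemma ip_minus_left: "ip r (- u) w = - ip r u w"
  by (simp add: ip_def sum_negf)

lemma ip_minus_right: "ip r w (- u) = - ip r w u"
  by (simp add: ip_def sum_negf)

lemma ip_wscale_left: "ip r (wscale c v) w = c * ip r v w"
  by (simp add: ip_def wscale_def sum_distrib_left mult.assoc)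

lemma ip_wscale_right: "ip r v (wscale c w) = c * ip r v w"
  by (simp add: ip_def wscale_def sum_distrib_left mult_ac)

lemma ip_zero_left [simp]: "ip r 0 w = 0"
  by (simp add: ip_def)

lemma ip_commute: "ip r v w = ip r w v"
  by (simp add: ip_def mult.commute)

lemmas ip_linear = ip_add_left ip_add_right ip_diff_left ip_diff_right ip_minus_left ip_minus_right
  ip_wscale_left ip_wscale_right

lemma ip_eps_right: "k \<in> {1..r} \<Longrightarrow> ip r v (eps k) = v k"
  by (simp add: ip_def eps_def if_distrib cong: if_cong)

lemma ip_self_nonneg: "0 \<le> ip r v v"
  by (simp add: ip_def sum_nonneg)

lemma ip_self_eq_0:
  assumes "supported r v" "ip r v v = 0"
  shows "v = 0"
proof (rule supported_eqI[OF assms(1)])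
  show "supported r 0" by (simp add: supported_def)
  fix k assume "k \<in> {1..r}"
  then show "v k = 0 k" using assms(2) by (simp add: ip_def sum_nonneg_eq_0_iff)
qed

lemma weyl_vector_apply:
  "weyl_vector r k = (if k \<in> {1..r} then (of_nat r + 1 - 2 * of_nat k) / 2 else 0)"
  by (simp add: weyl_vector_def sum_fun_apply wscale_def eps_def if_distrib cong: if_cong)

lemma weyl_vector_step:
  "k \<in> {1..<r} \<Longrightarrow> weyl_vector r k - weyl_vector r (k + 1) = 1"
  by (simp add: weyl_vector_apply field_simps)

lemma strictly_dominant_weyl_vector: "strictly_dominant r (weyl_vector r)"
  unfolding strictly_dominant_def using weyl_vector_step[of _ r] by force

lemma psum_weyl_vector: "k \<le> r \<Longrightarrow> psum k (weyl_vector r) = of_nat k * (of_nat r - of_nat k) / 2"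
proof (induction k)
  case (Suc k)
  then show ?case by (simp add: psum_Suc weyl_vector_apply field_simps)
qed simp

lemma supported_weyl_vector: "supported r (weyl_vector r)"
  by (simp add: supported_def weyl_vector_apply)

lemma supported_eps: "k \<in> {1..r} \<Longrightarrow> supported r (eps k)"
  by (auto simp: supported_def eps_def)

lemma strictly_dominant_less:
  assumes "strictly_dominant r v" "1 \<le> a" "a < b" "b \<le> r"
  shows "v b < v a"
  using assms(3,4)
proof (induction b rule: less_induct)
  case (less b)
  obtain c where c: "b = Suc c" using less.prems by (cases b) auto
  have "v b < v c" using assms(1,2) less.prems c unfolding strictly_dominant_def by auto
  then show ?case using less.IH[of c] less.prems c by (cases "a = c") auto
qed

subsection \<open>Lattices\<close>

lemma fund_weight_apply:
  assumes "i \<in> {1..r}"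
  shows "fund_weight r i k =
    (if k \<in> {1..r} then (if k \<le> i then 1 else 0) - of_nat i / of_nat r else 0)"
proof -
  have "(\<Sum>k=1..i. eps k) k = (if 1 \<le> k \<and> k \<le> i then 1 else 0)"
    "(\<Sum>k=i+1..r. eps k) k = (if i + 1 \<le> k \<and> k \<le> r then 1 else 0)"
    by (simp_all add: sum_fun_apply eps_def if_distrib cong: if_cong)
  then show ?thesis
    using assms by (auto simp: fund_weight_def wscale_def of_nat_diff field_simps)
qed

lemma sum_step_differences:
  fixes v :: weight
  shows "(\<Sum>i=1..n. of_nat i * (v i - v (i + 1))) = psum n v - of_nat n * v (Suc n)"
  by (induction n) (auto simp: psum_Suc algebra_simps)

lemma sum_telescope_from:
  fixes v :: weight
  assumes "1 \<le> k" "k \<le> Suc n"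
  shows "(\<Sum>i=1..n. (v i - v (i + 1)) * (if k \<le> i then 1 else 0)) = v k - v (Suc n)"
  using assms(2)
proof (induction n)
  case 0
  then show ?case using assms(1) by (simp add: le_antisym)
next
  case (Suc n)
  show ?case
  proof (cases "k = Suc (Suc n)")
    case True
    then show ?thesis by (intro trans[OF sum.neutral]) auto
  next
    case False
    then show ?thesis using Suc by (simp add: algebra_simps)
  qed
qed

lemma weight_lattice_iff:
  assumes r: "1 \<le> r"
  shows "v \<in> weight_lattice r \<longleftrightarrow>
    supported r v \<and> psum r v = 0 \<and> (\<forall>i\<in>{1..r}. \<forall>j\<in>{1..r}. v i - v j \<in> \<int>)"
proof
  assume "v \<in> weight_lattice r"
  then obtain c where v: "v = (\<Sum>i=1..r-1. wscale (of_int (c i)) (fund_weight r i))"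
    unfolding weight_lattice_def by blast
  have ap: "v k = (\<Sum>i=1..r-1. of_int (c i) * (if k \<in> {1..r} then (if k \<le> i then 1 else 0) - of_nat i / of_nat r else 0))" for k
    unfolding v sum_fun_apply wscale_def by (intro sum.cong) (auto simp: fund_weight_apply)
  have "supported r v" unfolding supported_def ap by auto
  moreover have "psum r v = 0"
  proof -
    have "psum r v = (\<Sum>i=1..r-1. \<Sum>k=1..r. of_int (c i) * ((if k \<le> i then 1 else 0) - of_nat i / of_nat r))"
      unfolding psum_def by (subst sum.swap, intro sum.cong) (auto simp: ap)
    also have "\<dots> = (\<Sum>i=1..r-1. 0)"
    proof (intro sum.cong refl)
      fix i assume i: "i \<in> {1..r-1}"
      have "(\<Sum>k=1..r. (if k \<le> i then 1 else 0)::rat) = of_nat (card ({1..r} \<inter> {k. k \<le> i}))"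
        by (simp add: sum.If_cases)
      also have "{1..r} \<inter> {k. k \<le> i} = {1..i}" using i by auto
      finally have "(\<Sum>k=1..r. (if k \<le> i then 1 else 0)::rat) = of_nat i" by simp
      then show "(\<Sum>k=1..r. of_int (c i) * ((if k \<le> i then 1 else 0) - of_nat i / of_nat r)) = (0::rat)"
        using r by (simp add: sum_distrib_left[symmetric] sum_subtractf)
    qed
    finally show ?thesis by simp
  qed
  moreover have "v k - v l \<in> \<int>" if "k \<in> {1..r}" "l \<in> {1..r}" for k l
  proof -
    have "v k - v l = (\<Sum>i=1..r-1. of_int (c i) * ((if k \<le> i then 1 else 0) - (if l \<le> i then 1 else 0)))"
      unfolding ap sum_subtractf[symmetric] using that by (intro sum.cong) (auto simp: algebra_simps)
    also have "\<dots> \<in> \<int>" by (intro Ints_sum Ints_mult) auto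
    finally show ?thesis .
  qed
  ultimately show "supported r v \<and> psum r v = 0 \<and> (\<forall>i\<in>{1..r}. \<forall>j\<in>{1..r}. v i - v j \<in> \<int>)"
    by blast
next
  assume *: "supported r v \<and> psum r v = 0 \<and> (\<forall>i\<in>{1..r}. \<forall>j\<in>{1..r}. v i - v j \<in> \<int>)"
  \<comment> \<open>The coefficient of \<Lambda>_i is the pairing with the i-th simple root, that
    is, the drop between neighbouring coordinates.\<close>
  define c where "c i = \<lfloor>v i - v (i + 1)\<rfloor>" for i
  have c: "of_int (c i) = v i - v (i + 1)" if "i \<in> {1..r-1}" for i
  proof -
    have "v i - v (i + 1) \<in> \<int>" using * that by auto
    then show ?thesis unfolding c_def by (auto elim: Ints_cases)
  qed
  obtain n where n: "r = Suc n" using r by (cases r) auto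
  have "v = (\<Sum>i=1..r-1. wscale (of_int (c i)) (fund_weight r i))" (is "_ = ?R")
  proof (rule supported_eqI[of r])
    show "supported r v" using * by blast
    have *: "?R k = (\<Sum>i=1..r-1. (v i - v (i + 1)) * (if k \<in> {1..r} then (if k \<le> i then 1 else 0) - of_nat i / of_nat r else 0))" for k
      unfolding sum_fun_apply wscale_def by (intro sum.cong) (use c in \<open>auto simp: fund_weight_apply\<close>)
    then show "supported r ?R" by (auto simp: supported_def)
    fix k assume k: "k \<in> {1..r}"
    have "?R k = (\<Sum>i=1..n. (v i - v (i + 1)) * (if k \<le> i then 1 else 0)) -
        (\<Sum>i=1..n. of_nat i * (v i - v (i + 1))) / of_nat r"
      unfolding * sum_divide_distrib sum_subtractf[symmetric]
      using k n by (intro sum.cong) (auto simp: algebra_simps diff_divide_distrib)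
    also have "\<dots> = v k - v r - (psum n v - of_nat n * v r) / of_nat r"
      using k n by (subst sum_telescope_from, simp, simp, subst sum_step_differences) simp
    also have "psum n v = - v r" using \<open>supported r v \<and> psum r v = 0 \<and> _\<close> n by (simp add: psum_Suc)
    also have "v k - v r - (- v r - of_nat n * v r) / of_nat r = v k"
      using n by (simp add: field_simps del: of_nat_Suc) (simp add: algebra_simps)
    finally show "v k = ?R k" by simp
  qed
  then show "v \<in> weight_lattice r" unfolding weight_lattice_def by blast
qed

lemma root_lattice_iff:
  assumes r: "1 \<le> r"
  shows "v \<in> root_lattice r \<longleftrightarrow> supported r v \<and> psum r v = 0 \<and> (\<forall>i\<in>{1..r}. v i \<in> \<int>)"
proof
  assume "v \<in> root_lattice r"
  then obtain c where v: "v = (\<Sum>i=1..r-1. wscale (of_int (c i)) (simple_root i))"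
    unfolding root_lattice_def by blast
  have ap: "v k = (\<Sum>i=1..r-1. of_int (c i) * ((if k = i then 1 else 0) - (if k = i + 1 then 1 else 0)))" for k
    unfolding v sum_fun_apply wscale_def simple_root_def eps_def by simp
  have "supported r v" unfolding supported_def ap by (intro allI impI sum.neutral) auto
  moreover have "psum r v = 0"
  proof -
    have "psum r v = (\<Sum>i=1..r-1. \<Sum>k=1..r. of_int (c i) * ((if k = i then 1 else 0) - (if k = i + 1 then 1 else 0)))"
      unfolding psum_def by (subst sum.swap, intro sum.cong) (auto simp: ap)
    also have "\<dots> = 0"
      by (intro sum.neutral) (auto simp: sum_distrib_left[symmetric] sum_subtractf)
    finally show ?thesis .
  qed
  moreover have "v k \<in> \<int>" for k
    unfolding ap by (intro Ints_sum Ints_mult) auto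
  ultimately show "supported r v \<and> psum r v = 0 \<and> (\<forall>i\<in>{1..r}. v i \<in> \<int>)" by blast
next
  assume *: "supported r v \<and> psum r v = 0 \<and> (\<forall>i\<in>{1..r}. v i \<in> \<int>)"
  \<comment> \<open>The coefficient of the k-th simple root is the k-th partial sum, because the
    basis consists of consecutive differences.\<close>
  define c where "c k = \<lfloor>psum k v\<rfloor>" for k
  have c: "of_int (c k) = psum k v" if "k \<le> r" for k
  proof -
    have "psum k v \<in> \<int>" unfolding psum_def using * that by (intro Ints_sum) auto
    then show ?thesis unfolding c_def by (auto elim: Ints_cases)
  qed
  have "v = (\<Sum>i=1..r-1. wscale (of_int (c i)) (simple_root i))" (is "_ = ?R")
  proof (rule supported_eqI[of r])
    show "supported r v" using * by blast
    have ap: "?R k = (\<Sum>i=1..r-1. of_int (c i) * ((if k = i then 1 else 0) - (if k = i + 1 then 1 else 0)))" for k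
      unfolding sum_fun_apply wscale_def simple_root_def eps_def by simp
    show "supported r ?R" unfolding supported_def ap by (intro allI impI sum.neutral) auto
    fix k assume k: "k \<in> {1..r}"
    then obtain l where l: "k = Suc l" by (cases k) auto
    have "?R k = (\<Sum>i\<in>{1..r-1}. (if i = k then of_int (c k) else 0)) - (\<Sum>i\<in>{1..r-1}. if i = l then of_int (c l) else 0)"
      unfolding ap sum_subtractf[symmetric] using l by (intro sum.cong) auto
    also have "\<dots> = (if k \<le> r - 1 then of_int (c k) else 0) - (if 1 \<le> l \<and> l \<le> r - 1 then of_int (c l) else 0)"
      using k by simp
    also have "\<dots> = psum k v - psum l v"
    proof -
      have "l \<le> r - 1" using k l by auto
      moreover have "k \<le> r - 1 \<or> k = r" using k by auto
      ultimately show ?thesis using c[of k] c[of l] k * by (cases "l = 0") auto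
    qed
    also have "\<dots> = v k" by (simp add: l psum_Suc)
    finally show "v k = ?R k" by simp
  qed
  then show "v \<in> root_lattice r" unfolding root_lattice_def by blast
qed

lemma weight_lattice_add:
  assumes "1 \<le> r" "v \<in> weight_lattice r" "w \<in> weight_lattice r"
  shows "v + w \<in> weight_lattice r"
proof -
  have "(v + w) i - (v + w) j = (v i - v j) + (w i - w j)" for i j by simp
  then show ?thesis
    using assms by (auto simp: weight_lattice_iff supported_add psum_add simp del: plus_fun_apply)
qed

lemma weight_lattice_diff:
  assumes "1 \<le> r" "v \<in> weight_lattice r" "w \<in> weight_lattice r"
  shows "v - w \<in> weight_lattice r"
proof -
  have "(v - w) i - (v - w) j = (v i - v j) - (w i - w j)" for i j by simp
  then show ?thesis
    using assms by (auto simp: weight_lattice_iff supported_diff psum_diff simp del: minus_apply)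
qed

lemma weight_lattice_wscale:
  assumes "1 \<le> r" "v \<in> weight_lattice r" "c \<in> \<int>"
  shows "wscale c v \<in> weight_lattice r"
proof -
  have "wscale c v i - wscale c v j = c * (v i - v j)" for i j
    by (simp add: wscale_def algebra_simps)
  then show ?thesis
    using assms by (auto simp: weight_lattice_iff supported_wscale psum_wscale)
qed

lemma weyl_vector_in_weight_lattice: "1 \<le> r \<Longrightarrow> weyl_vector r \<in> weight_lattice r"
proof -
  assume r: "1 \<le> r"
  have "weyl_vector r i - weyl_vector r j = of_int (int j - int i)" if "i \<in> {1..r}" "j \<in> {1..r}" for i j
    using that by (simp add: weyl_vector_apply field_simps)
  then show ?thesis
    using r psum_weyl_vector[of r r] by (simp add: weight_lattice_iff supported_weyl_vector)
qed

text \<open>The coordinates of \<delta> sum to zero, so the last coordinate of v may be subtracted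
  from all of them. What remains is integral, as are the coordinates of 2\<delta>. This is the
  reason for the factor 2 in \<open>q_denom\<close>.\<close>

lemma ip_weyl_vector_half_Ints:
  assumes r: "1 \<le> r" and v: "v \<in> weight_lattice r"
  shows "2 * ip r v (weyl_vector r) \<in> \<int>"
proof -
  have s: "(\<Sum>i=1..r. v i) = 0" using v r by (auto simp: weight_lattice_iff psum_def)
  have "2 * ip r v (weyl_vector r) = (\<Sum>i=1..r. v i * (of_nat r + 1 - 2 * of_nat i))"
    unfolding ip_def sum_distrib_left by (intro sum.cong) (auto simp: weyl_vector_apply)
  also have "\<dots> = (\<Sum>i=1..r. (v i - v r) * (of_nat r + 1 - 2 * of_nat i)) + v r * (\<Sum>i=1..r. of_nat r + 1 - 2 * of_nat i)"
    by (simp add: algebra_simps sum.distrib sum_subtractf sum_distrib_left)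
  also have "(\<Sum>i=1..r. of_nat r + 1 - 2 * of_nat i) = (2 :: rat) * psum r (weyl_vector r)"
    unfolding psum_def sum_distrib_left by (intro sum.cong) (auto simp: weyl_vector_apply)
  also have "psum r (weyl_vector r) = 0" using psum_weyl_vector[of r r] by simp
  finally have "2 * ip r v (weyl_vector r) = (\<Sum>i=1..r. (v i - v r) * (of_nat r + 1 - 2 * of_nat i))"
    by simp
  also have "\<dots> \<in> \<int>"
    using v r by (intro Ints_sum Ints_mult[of "_ - _"])
      (auto simp: weight_lattice_iff intro!: Ints_diff Ints_add Ints_mult)
  finally show ?thesis .
qed

lemma dominant_weights_iff:
  assumes "1 \<le> r"
  shows "v \<in> dominant_weights r \<longleftrightarrow> v \<in> weight_lattice r \<and> (\<forall>k\<in>{1..<r}. v (k + 1) \<le> v k)"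
proof -
  have "ip r v (simple_root k) = v k - v (k + 1)" if "k \<in> {1..<r}" for k
    using that by (simp add: simple_root_def ip_diff_right ip_eps_right)
  moreover have "{1..r-1} = {1..<r}" using assms by auto
  ultimately show ?thesis by (auto simp: dominant_weights_def)
qed

text \<open>Drops between coordinates are integers, so being nonnegative is the same as exceeding
  -1, and \<delta> adds 1 to each drop. Dominant weights thereby correspond to the exponents in the
  open chamber that index alternating sums.\<close>

lemma dominant_add_weyl_vector_iff:
  assumes r: "1 \<le> r"
  shows "v \<in> dominant_weights r \<longleftrightarrow>
    v + weyl_vector r \<in> weight_lattice r \<and> strictly_dominant r (v + weyl_vector r)"
proof -
  have L: "v + weyl_vector r \<in> weight_lattice r \<longleftrightarrow> v \<in> weight_lattice r"
    using weight_lattice_add[OF r, of v "weyl_vector r"]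
      weight_lattice_diff[OF r, of "v + weyl_vector r" "weyl_vector r"]
      weyl_vector_in_weight_lattice[OF r] by auto
  have "v (k + 1) \<le> v k \<longleftrightarrow> (v + weyl_vector r) (k + 1) < (v + weyl_vector r) k"
    if "v \<in> weight_lattice r" "k \<in> {1..<r}" for k
  proof -
    have "v k - v (k + 1) \<in> \<int>" using that r by (auto simp: weight_lattice_iff)
    then obtain z where "v k - v (k + 1) = of_int z" by (auto elim: Ints_cases)
    then have "v k = v (k + 1) + of_int z" by (simp add: algebra_simps)
    moreover have "weyl_vector r k = weyl_vector r (k + 1) + 1"
      using weyl_vector_step[OF that(2)] by (simp add: algebra_simps)
    moreover have "0 \<le> z \<longleftrightarrow> (-1::rat) < of_int z" by linarith
    ultimately show ?thesis by auto
  qed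
  then show ?thesis
    unfolding dominant_weights_iff[OF r] L strictly_dominant_def by blast
qed

unbundle no m_inv_syntax

section \<open>The Weyl group\<close>

definition word_perm :: "nat list \<Rightarrow> nat \<Rightarrow> nat" where
  "word_perm is = foldr (\<lambda>i \<tau>. Transposition.transpose i (i + 1) \<circ> \<tau>) is id"

lemma word_perm_simps [simp]:
  "word_perm [] = id"
  "word_perm (i # is) = Transposition.transpose i (i + 1) \<circ> word_perm is"
  by (simp_all add: word_perm_def)

lemma word_perm_append: "word_perm (is @ js) = word_perm is \<circ> word_perm js"
  by (induction "is") (auto simp: comp_assoc)

lemma permutation_word_perm: "permutation (word_perm is)"
  by (induction "is") (simp_all only: word_perm_simps permutation_id permutation_compose permutation_swap_id)

lemma sign_word_perm: "sign (word_perm is) = (-1) ^ length is"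
proof (induction "is")
  case (Cons i "is")
  then show ?case
    unfolding word_perm_simps(2)
    by (subst sign_compose) (simp_all add: permutation_word_perm permutation_swap_id sign_swap_id)
qed simp

lemma transpose_is_word:
  assumes "a < b" "1 \<le> a" "b \<le> r"
  shows "\<exists>is. set is \<subseteq> {1..r-1} \<and> Transposition.transpose a b = word_perm is"
  using assms(1,3)
proof (induction b rule: less_induct)
  case (less b)
  obtain c where c: "b = Suc c" using less.prems by (cases b) auto
  show ?case
  proof (cases "a = c")
    case True
    then show ?thesis using assms(2) less.prems c by (intro exI[of _ "[a]"]) auto
  next
    case False
    then obtain "is" where i: "set is \<subseteq> {1..r-1}" "Transposition.transpose a c = word_perm is"
      using less.IH[of c] less.prems c by auto
    \<comment> \<open>Conjugating the transposition of a and c by the simple transposition of c and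
      b = c + 1 moves its upper end to b.\<close>
    have "Transposition.transpose a b = Transposition.transpose c (c + 1) \<circ> Transposition.transpose a c \<circ> Transposition.transpose c (c + 1)"
      using False less.prems c by (auto simp: fun_eq_iff Transposition.transpose_def)
    also have "\<dots> = word_perm (c # is @ [c])"
      by (simp add: word_perm_append i(2) comp_assoc)
    finally show ?thesis using i(1) assms(2) less.prems c by (intro exI[of _ "c # is @ [c]"]) auto
  qed
qed

lemma permutes_is_word:
  assumes "\<sigma> permutes {1..r}"
  shows "\<exists>is. set is \<subseteq> {1..r-1} \<and> \<sigma> = word_perm is"
  using assms finite_atLeastAtMost
proof (induction rule: permutes_induct)
  case id
  show ?case by (intro exI[of _ "[]"]) auto
next
  case (swap a b p)
  from swap obtain js where js: "set js \<subseteq> {1..r-1}" "p = word_perm js" by blast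
  have "\<exists>is. set is \<subseteq> {1..r-1} \<and> Transposition.transpose a b = word_perm is"
    using swap(1-3) transpose_is_word[of a b r] transpose_is_word[of b a r]
    by (cases "a < b") (auto simp: transpose_commute)
  then obtain "is" where "set is \<subseteq> {1..r-1}" "Transposition.transpose a b = word_perm is" by blast
  then show ?case using js by (intro exI[of _ "is @ js"]) (auto simp: word_perm_append)
qed

text \<open>Every word in simple transpositions representing the permutation has its sign as parity.
  Since such words exist, the least length is attained by one of them.\<close>

lemma coxeter_length_parity:
  assumes "\<sigma> permutes {1..r}"
  shows "(-1) ^ coxeter_length r \<sigma> = (of_int (sign \<sigma>) :: 'a::ring_1)"
proof -
  let ?P = "\<lambda>l. \<exists>is. length is = l \<and> set is \<subseteq> {1..r-1} \<and> \<sigma> = word_perm is"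
  have "\<exists>l. ?P l" using permutes_is_word[OF assms] by blast
  then have "?P (LEAST l. ?P l)" by (rule LeastI_ex)
  then obtain "is" where "length is = coxeter_length r \<sigma>" "\<sigma> = word_perm is"
    unfolding coxeter_length_def word_perm_def by blast
  then show ?thesis using sign_word_perm[of "is"] by simp
qed

section \<open>Permutations acting on weights\<close>

lemma weyl_act_id [simp]: "weyl_act id v = v"
  by (simp add: weyl_act_def)

lemma weyl_act_comp: "bij \<sigma> \<Longrightarrow> bij \<tau> \<Longrightarrow> weyl_act (\<sigma> \<circ> \<tau>) v = weyl_act \<sigma> (weyl_act \<tau> v)"
  by (simp add: weyl_act_def o_inv_distrib)

lemma weyl_act_inv_cancel:
  assumes "bij \<sigma>"
  shows "weyl_act \<sigma> (weyl_act (inv \<sigma>) v) = v" "weyl_act (inv \<sigma>) (weyl_act \<sigma> v) = v"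
  using assms weyl_act_comp[of \<sigma> "inv \<sigma>" v] weyl_act_comp[of "inv \<sigma>" \<sigma> v]
  using bij_is_surj[OF assms] bij_is_inj[OF assms]
  by (simp_all add: bij_imp_bij_inv surj_iff)

lemma inj_weyl_act: "bij \<sigma> \<Longrightarrow> inj (weyl_act \<sigma>)"
  by (metis injI weyl_act_inv_cancel(2))

lemma weyl_act_diff: "weyl_act \<sigma> (v - w) = weyl_act \<sigma> v - weyl_act \<sigma> w"
  by (auto simp: weyl_act_def)

lemma weyl_act_wscale: "weyl_act \<sigma> (wscale c v) = wscale c (weyl_act \<sigma> v)"
  by (auto simp: weyl_act_def wscale_def)

lemma weyl_act_eps: "bij \<sigma> \<Longrightarrow> weyl_act \<sigma> (eps i) = eps (\<sigma> i)"
proof -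
  assume "bij \<sigma>"
  then have "inv \<sigma> k = i \<longleftrightarrow> k = \<sigma> i" for k by (metis bij_inv_eq_iff)
  then show ?thesis by (simp add: weyl_act_def eps_def fun_eq_iff)
qed

lemma weyl_act_transpose: "weyl_act (Transposition.transpose a b) v = v \<circ> Transposition.transpose a b"
  by (simp add: weyl_act_def fun_eq_iff)

lemma supported_weyl_act: "\<sigma> permutes {1..r} \<Longrightarrow> supported r v \<Longrightarrow> supported r (weyl_act \<sigma> v)"
  by (auto simp: supported_def weyl_act_def permutes_not_in[OF permutes_inv])

lemma sum_weyl_act:
  assumes "\<sigma> permutes {1..r}"
  shows "(\<Sum>i=1..r. f (weyl_act \<sigma> v i)) = (\<Sum>i=1..r. f (v i))"
  unfolding weyl_act_def using sum.permute[OF permutes_inv[OF assms], of "\<lambda>i. f (v i)"]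
  by (simp add: o_def)

lemma psum_weyl_act: "\<sigma> permutes {1..r} \<Longrightarrow> psum r (weyl_act \<sigma> v) = psum r v"
  unfolding psum_def using sum_weyl_act[of \<sigma> r "\<lambda>x. x"] by simp

lemma ip_weyl_act:
  assumes "\<sigma> permutes {1..r}"
  shows "ip r (weyl_act \<sigma> v) (weyl_act \<sigma> w) = ip r v w"
  unfolding ip_def weyl_act_def
  using sum.permute[OF permutes_inv[OF assms], of "\<lambda>i. v i * w i"] by (simp add: o_def)

lemma weight_lattice_weyl_act:
  assumes "1 \<le> r" "\<sigma> permutes {1..r}" "v \<in> weight_lattice r"
  shows "weyl_act \<sigma> v \<in> weight_lattice r"
proof -
  have "inv \<sigma> i \<in> {1..r}" if "i \<in> {1..r}" for i
    using that assms(2) by (meson permutes_in_image permutes_inv)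
  then show ?thesis
    using assms supported_weyl_act[OF assms(2)] psum_weyl_act[OF assms(2)]
    by (auto simp: weight_lattice_iff) (auto simp: weyl_act_def)
qed

text \<open>Monotonicity gives k \<le> \<tau> k throughout; a permutation preserves the sum of all
  indices, so none of these inequalities is strict.\<close>

lemma strict_mono_permutation_eq_id:
  fixes \<tau> :: "nat \<Rightarrow> nat"
  assumes "\<tau> permutes {1..r}" "\<And>k. k \<in> {1..<r} \<Longrightarrow> \<tau> k < \<tau> (k + 1)"
  shows "\<tau> = id"
proof -
  have ge: "k \<le> \<tau> k" if "k \<in> {1..r}" for k
    using that
  proof (induction k)
    case (Suc k)
    show ?case
    proof (cases "k = 0")
      case True
      then show ?thesis using Suc.prems permutes_in_image[OF assms(1), of 1] by auto
    next
      case False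
      then show ?thesis using Suc assms(2)[of k] by auto
    qed
  qed simp
  have "(\<Sum>k=1..r. \<tau> k) = (\<Sum>k=1..r. k)"
    using sum.permute[OF assms(1), of "\<lambda>k. k"] by (simp add: o_def)
  then have "\<forall>k\<in>{1..r}. k = \<tau> k"
    using ge sum_strict_mono_ex1[of "{1..r}" "\<lambda>k. k" \<tau>] by (fastforce simp: order_less_le)
  then show ?thesis
    using assms(1) by (metis eq_id_iff permutes_not_in)
qed

text \<open>An orbit meets the open chamber at most once, and there with trivial stabiliser:
  strictly decreasing coordinates before and after force the inverse permutation to be
  increasing.\<close>

lemma strictly_dominant_weyl_act_eq_id:
  assumes "\<sigma> permutes {1..r}" "strictly_dominant r v" "strictly_dominant r (weyl_act \<sigma> v)"
  shows "\<sigma> = id"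
proof -
  have p: "inv \<sigma> permutes {1..r}" using assms(1) by (rule permutes_inv)
  have "inv \<sigma> = id"
  proof (rule strict_mono_permutation_eq_id[OF p])
    fix k assume k: "k \<in> {1..<r}"
    then have "v (inv \<sigma> (k + 1)) < v (inv \<sigma> k)"
      using assms(3) by (auto simp: strictly_dominant_def weyl_act_def)
    moreover have "inv \<sigma> k \<in> {1..r}" "inv \<sigma> (k + 1) \<in> {1..r}"
      using k permutes_in_image[OF p] by auto
    ultimately show "inv \<sigma> k < inv \<sigma> (k + 1)"
      using strictly_dominant_less[OF assms(2), of "inv \<sigma> (k + 1)" "inv \<sigma> k"]
      by (cases "inv \<sigma> k" "inv \<sigma> (k + 1)" rule: linorder_cases) auto
  qed
  then show ?thesis using assms(1) by (metis inv_id inv_inv_eq permutes_bij)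
qed

lemma transpose_permutes: "(k::nat) \<in> {1..<r} \<Longrightarrow> Transposition.transpose k (k + 1) permutes {1..r}"
  by (intro permutes_swap_id) auto

text \<open>The permutation maximising the inner product with the Weyl vector sorts the coordinates.\<close>

lemma ex_sorting_permutation:
  "\<exists>\<sigma>. \<sigma> permutes {1..r} \<and> (\<forall>k\<in>{1..<r}. weyl_act \<sigma> v (k + 1) \<le> weyl_act \<sigma> v k)"
proof -
  let ?S = "{\<sigma>. \<sigma> permutes {1..r}}"
  let ?f = "\<lambda>\<sigma>. ip r (weyl_act \<sigma> v) (weyl_vector r)"
  have fin: "finite ?S" by (rule finite_permutations) simp
  moreover have "?S \<noteq> {}" using permutes_id by blast
  ultimately have "Max (?f ` ?S) \<in> ?f ` ?S" by (intro Max_in finite_imageI) auto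
  then obtain \<sigma> where \<sigma>: "\<sigma> permutes {1..r}" "?f \<sigma> = Max (?f ` ?S)" by auto
  have max: "?f \<tau> \<le> ?f \<sigma>" if "\<tau> permutes {1..r}" for \<tau>
    unfolding \<sigma>(2) using fin that by (intro Max_ge) auto
  define w where "w = weyl_act \<sigma> v"
  have "w (k + 1) \<le> w k" if k: "k \<in> {1..<r}" for k
  proof -
    let ?s = "Transposition.transpose k (k + 1)"
    have s: "?s permutes {1..r}" by (rule transpose_permutes[OF k])
    have e: "weyl_act ?s w = w - wscale (w k - w (k + 1)) (eps k - eps (k + 1))"
      by (auto simp: weyl_act_transpose fun_eq_iff Transposition.transpose_def wscale_def eps_def)
    have "ip r (eps k - eps (k + 1)) (weyl_vector r) = weyl_vector r k - weyl_vector r (k + 1)"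
      using k by (simp add: ip_diff_left ip_commute[of r "eps _"] ip_eps_right)
    also have "\<dots> = 1" using weyl_vector_step[OF k] .
    finally have "ip r (weyl_act ?s w) (weyl_vector r) = ip r w (weyl_vector r) - (w k - w (k + 1))"
      unfolding e by (simp add: ip_diff_left ip_wscale_left)
    moreover have "weyl_act ?s w = weyl_act (?s \<circ> \<sigma>) v"
      unfolding w_def by (rule weyl_act_comp[symmetric]) (use s \<sigma>(1) permutes_bij in auto)
    ultimately show ?thesis
      using max[OF permutes_compose[OF \<sigma>(1) s]] by (simp add: w_def)
  qed
  then show ?thesis using \<sigma>(1) unfolding w_def by blast
qed

section \<open>The group ring\<close>

text \<open>Exponents form a group, so the convolution collapses to a single sum. The set
  \<open>A\<close> may exceed the support; in this way a derivative of f can be expanded over the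
  same index set as f itself.\<close>

lemma coef_times:
  fixes f g :: "'k::ab_group_add \<Rightarrow>\<^sub>0 'a::comm_semiring_0"
  assumes "finite A" "supp f \<subseteq> A"
  shows "coef (f * g) k = (\<Sum>a\<in>A. coef f a * coef g (k - a))"
proof -
  have "coef (f * g) k = (\<Sum>l. coef f l * coef g (k - l))"
    unfolding lookup_mult
  proof (intro Sum_any.cong arg_cong2[where f = "(*)"] refl)
    fix l
    have *: "(\<lambda>q. coef g q when k = l + q) = (\<lambda>q. coef g q when q = k - l)"
      by (auto simp: fun_eq_iff when_def algebra_simps)
    show "(\<Sum>q. coef g q when k = l + q) = coef g (k - l)" unfolding * by simp
  qed
  also have "\<dots> = (\<Sum>a\<in>A. coef f a * coef g (k - a))"
  proof (rule Sum_any.expand_superset[OF assms(1)])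
    show "{a. coef f a * coef g (k - a) \<noteq> 0} \<subseteq> A"
      using assms(2) by (metis (mono_tags, lifting) in_keys_iff mem_Collect_eq mult_zero_left subset_iff)
  qed
  finally show ?thesis .
qed

lemma coef_single_times:
  fixes g :: "'k::ab_group_add \<Rightarrow>\<^sub>0 'a::comm_semiring_0"
  shows "coef (Poly_Mapping.single a c * g) k = c * coef g (k - a)"
  by (subst coef_times[of "{a}"]) (auto simp: in_keys_iff lookup_single when_def)

lemma coef_single_0_times:
  fixes g :: "'k::ab_group_add \<Rightarrow>\<^sub>0 'a::comm_semiring_0"
  shows "coef (Poly_Mapping.single 0 c * g) k = c * coef g k"
  by (simp add: coef_single_times)

lemma coef_of_int_times:
  fixes g :: "'k::ab_group_add \<Rightarrow>\<^sub>0 'a::comm_ring_1"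
  shows "coef (of_int c * g) k = of_int c * coef g k"
  by (metis coef_single_0_times single_of_int)

lemma group_ring_eq_sum_single:
  fixes f :: "'k \<Rightarrow>\<^sub>0 'a::comm_monoid_add"
  assumes "finite A" "supp f \<subseteq> A"
  shows "f = (\<Sum>a\<in>A. Poly_Mapping.single a (coef f a))"
proof (rule poly_mapping_eqI)
  fix k
  have "coef (\<Sum>a\<in>A. Poly_Mapping.single a (coef f a)) k = (\<Sum>a\<in>A. if a = k then coef f k else 0)"
    unfolding lookup_sum by (intro sum.cong) (auto simp: lookup_single when_def)
  also have "\<dots> = coef f k"
    using assms by (auto simp: in_keys_iff)
  finally show "coef f k = coef (\<Sum>a\<in>A. Poly_Mapping.single a (coef f a)) k" by simp
qed

text \<open>Coefficients are pulled back along the inverse, so that monomials move forward: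
  \<open>xpow v\<close> goes to \<open>xpow (weyl_act \<sigma> v)\<close>.\<close>

definition wact :: "(nat \<Rightarrow> nat) \<Rightarrow> (weight \<Rightarrow>\<^sub>0 'a) \<Rightarrow> weight \<Rightarrow>\<^sub>0 'a::comm_ring_1" where
  "wact \<sigma> f = Poly_Mapping.map_key (weyl_act (inv \<sigma>)) f"

lemma coef_wact: "bij \<sigma> \<Longrightarrow> coef (wact \<sigma> f) v = coef f (weyl_act (inv \<sigma>) v)"
  unfolding wact_def by (simp add: map_key.rep_eq inj_weyl_act bij_imp_bij_inv)

lemma supp_wact: "bij \<sigma> \<Longrightarrow> supp (wact \<sigma> f) = weyl_act \<sigma> ` supp f"
proof -
  assume b: "bij \<sigma>"
  have *: "v \<in> weyl_act \<sigma> ` supp f \<longleftrightarrow> weyl_act (inv \<sigma>) v \<in> supp f" for v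
    using weyl_act_inv_cancel[OF b] by (metis image_iff)
  show ?thesis
    by (rule Set.set_eqI) (simp only: * in_keys_iff coef_wact[OF b])
qed

lemma wact_id [simp]: "wact id f = f"
  by (rule poly_mapping_eqI) (simp add: coef_wact)

lemma wact_comp: "bij \<sigma> \<Longrightarrow> bij \<tau> \<Longrightarrow> wact (\<sigma> \<circ> \<tau>) f = wact \<sigma> (wact \<tau> f)"
  by (rule poly_mapping_eqI)
    (simp add: coef_wact bij_comp o_inv_distrib weyl_act_comp bij_imp_bij_inv)

lemma wact_single:
  assumes "bij \<sigma>"
  shows "wact \<sigma> (Poly_Mapping.single v c) = Poly_Mapping.single (weyl_act \<sigma> v) c"
proof (rule poly_mapping_eqI)
  fix w
  have "v = weyl_act (inv \<sigma>) w \<longleftrightarrow> weyl_act \<sigma> v = w"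
    using weyl_act_inv_cancel[OF assms] by metis
  then show "coef (wact \<sigma> (Poly_Mapping.single v c)) w = coef (Poly_Mapping.single (weyl_act \<sigma> v) c) w"
    by (simp add: coef_wact[OF assms] lookup_single)
qed

lemma wact_add: "bij \<sigma> \<Longrightarrow> wact \<sigma> (f + g) = wact \<sigma> f + wact \<sigma> g"
  by (rule poly_mapping_eqI) (simp add: coef_wact lookup_add)

lemma wact_zero: "bij \<sigma> \<Longrightarrow> wact \<sigma> 0 = 0"
  by (rule poly_mapping_eqI) (simp add: coef_wact)

lemma wact_diff: "bij \<sigma> \<Longrightarrow> wact \<sigma> (f - g) = wact \<sigma> f - wact \<sigma> g"
  by (rule poly_mapping_eqI) (simp add: coef_wact lookup_minus)

lemma wact_times:
  assumes b: "bij \<sigma>"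
  shows "wact \<sigma> (f * g) = wact \<sigma> f * wact \<sigma> g"
proof (rule poly_mapping_eqI)
  fix v
  have "coef (wact \<sigma> f * wact \<sigma> g) v =
      (\<Sum>a\<in>weyl_act \<sigma> ` supp f. coef (wact \<sigma> f) a * coef (wact \<sigma> g) (v - a))"
    by (rule coef_times) (simp_all add: supp_wact[OF b])
  also have "\<dots> = (\<Sum>a\<in>supp f. coef f a * coef g (weyl_act (inv \<sigma>) v - a))"
    by (subst sum.reindex)
      (auto simp: coef_wact[OF b] weyl_act_diff weyl_act_inv_cancel[OF b]
        intro: inj_on_subset[OF inj_weyl_act[OF b]])
  also have "\<dots> = coef (wact \<sigma> (f * g)) v"
    by (subst coef_wact[OF b], rule coef_times[symmetric]) auto
  finally show "coef (wact \<sigma> (f * g)) v = coef (wact \<sigma> f * wact \<sigma> g) v" by simp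
qed

lemma wact_one: "bij \<sigma> \<Longrightarrow> wact \<sigma> 1 = 1"
  using wact_single[of \<sigma> 0 1] weyl_act_diff[of \<sigma> 0 0] by (simp add: single_one del: zero_fun_apply)

lemma wact_prod: "bij \<sigma> \<Longrightarrow> wact \<sigma> (\<Prod>i\<in>A. f i) = (\<Prod>i\<in>A. wact \<sigma> (f i))"
  by (induction A rule: infinite_finite_induct) (simp_all add: wact_one wact_times)

lemma wact_sum: "bij \<sigma> \<Longrightarrow> wact \<sigma> (\<Sum>i\<in>A. f i) = (\<Sum>i\<in>A. wact \<sigma> (f i))"
  by (induction A rule: infinite_finite_induct) (simp_all add: wact_zero wact_add)

definition invariant :: "nat \<Rightarrow> (weight \<Rightarrow>\<^sub>0 'a::comm_ring_1) \<Rightarrow> bool" where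
  "invariant r f \<longleftrightarrow> (\<forall>\<sigma>. \<sigma> permutes {1..r} \<longrightarrow> wact \<sigma> f = f)"

definition alternating :: "nat \<Rightarrow> (weight \<Rightarrow>\<^sub>0 'a::comm_ring_1) \<Rightarrow> bool" where
  "alternating r f \<longleftrightarrow> (\<forall>\<sigma>. \<sigma> permutes {1..r} \<longrightarrow> wact \<sigma> f = of_int (sign \<sigma>) * f)"

lemma alternating_times_invariant:
  "alternating r f \<Longrightarrow> invariant r g \<Longrightarrow> alternating r (f * g)"
  by (auto simp: alternating_def invariant_def wact_times permutes_bij mult.assoc)

lemma wact_of_int_times: "bij \<sigma> \<Longrightarrow> wact \<sigma> (of_int c * f) = of_int c * wact \<sigma> f"
  by (rule poly_mapping_eqI) (simp add: coef_wact coef_of_int_times)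

lemma bij_transpose: "bij (Transposition.transpose a b)"
  by simp

lemma invariant_if_adjacent:
  assumes "\<And>k. k \<in> {1..<r} \<Longrightarrow> wact (Transposition.transpose k (k + 1)) f = f"
  shows "invariant r f"
proof -
  have "wact (word_perm is) f = f \<and> bij (word_perm is)" if "set is \<subseteq> {1..r-1}" for "is"
    using that
  proof (induction "is")
    case (Cons i "is")
    then have "i \<in> {1..<r}" by auto
    then show ?case
      using Cons assms[of i] unfolding word_perm_simps
      by (subst wact_comp) (auto simp: bij_transpose intro: bij_comp)
  qed simp
  then show ?thesis unfolding invariant_def using permutes_is_word by metis
qed

lemma alternating_if_adjacent:
  assumes "\<And>k. k \<in> {1..<r} \<Longrightarrow> wact (Transposition.transpose k (k + 1)) f = - f"
  shows "alternating r f"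
proof -
  have "wact (word_perm is) f = (-1) ^ length is * f \<and> bij (word_perm is)" if "set is \<subseteq> {1..r-1}" for "is"
    using that
  proof (induction "is")
    case (Cons i "is")
    then have "i \<in> {1..<r}" by auto
    moreover have "wact (Transposition.transpose i (Suc i)) ((-1) ^ length is * f) =
        (-1) ^ length is * wact (Transposition.transpose i (Suc i)) f"
      using wact_of_int_times[of "Transposition.transpose i (Suc i)" "(-1) ^ length is" f] by simp
    ultimately show ?case
      using Cons assms[of i] unfolding word_perm_simps
      by (subst wact_comp) (auto simp: bij_transpose intro: bij_comp)
  qed simp
  then show ?thesis
    unfolding alternating_def using permutes_is_word sign_word_perm
    by (metis of_int_1 of_int_minus of_int_power)
qed

section \<open>Alternating elements\<close>

definition alt_sum :: "nat \<Rightarrow> weight \<Rightarrow> weight \<Rightarrow>\<^sub>0 'a::comm_ring_1" where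
  "alt_sum r v = (\<Sum>\<sigma> | \<sigma> permutes {1..r}. Poly_Mapping.single (weyl_act \<sigma> v) (of_int (sign \<sigma>)))"

lemma alternating_coef:
  "alternating r f \<Longrightarrow> \<sigma> permutes {1..r} \<Longrightarrow> coef f (weyl_act \<sigma> v) = of_int (sign \<sigma>) * coef f v"
  using coef_wact[of "inv \<sigma>" f v] coef_of_int_times[of "sign (inv \<sigma>)" f v]
  by (simp add: alternating_def permutes_inv permutes_bij bij_imp_bij_inv inv_inv_eq
      sign_inverse permutes_imp_permutation[OF finite_atLeastAtMost])

lemma invariant_coef:
  "invariant r f \<Longrightarrow> \<sigma> permutes {1..r} \<Longrightarrow> coef f (weyl_act \<sigma> v) = coef f v"
  using coef_wact[of "inv \<sigma>" f v]
  by (simp add: invariant_def permutes_inv permutes_bij bij_imp_bij_inv inv_inv_eq)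

text \<open>Sorting moves any exponent into the closed chamber. On a wall of the chamber some simple
  transposition fixes the exponent, so the coefficient equals its own negative and vanishes in
  characteristic zero.\<close>

lemma alternating_eqI:
  fixes f g :: "weight \<Rightarrow>\<^sub>0 'a::{idom, ring_char_0}"
  assumes f: "alternating r f" and g: "alternating r g"
    and eq: "\<And>v. strictly_dominant r v \<Longrightarrow> coef f v = coef g v"
  shows "f = g"
proof (rule poly_mapping_eqI)
  fix v
  obtain \<sigma> where \<sigma>: "\<sigma> permutes {1..r}" "\<forall>k\<in>{1..<r}. weyl_act \<sigma> v (k + 1) \<le> weyl_act \<sigma> v k"
    using ex_sorting_permutation by blast
  define w where "w = weyl_act \<sigma> v"
  have "coef f w = coef g w"
  proof (cases "strictly_dominant r w")
    case False
    then obtain k where k: "k \<in> {1..<r}" "\<not> w (k + 1) < w k"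
      by (auto simp: strictly_dominant_def)
    then have eqk: "w (k + 1) = w k" using \<sigma>(2) by (force simp: w_def)
    have "weyl_act (Transposition.transpose k (k + 1)) w = w"
      unfolding weyl_act_transpose using eqk by (auto simp: fun_eq_iff Transposition.transpose_def)
    then have "coef h w = 0" if "alternating r h" for h :: "weight \<Rightarrow>\<^sub>0 'a"
      using alternating_coef[OF that transpose_permutes[OF k(1)], of w]
      by (simp add: sign_swap_id)
    then show ?thesis using f g by simp
  qed (rule eq)
  then show "coef f v = coef g v"
    using alternating_coef[OF f \<sigma>(1), of v] alternating_coef[OF g \<sigma>(1), of v] by (simp add: w_def)
qed

lemma coef_alt_sum:
  "coef (alt_sum r v) w = (\<Sum>\<sigma> | \<sigma> permutes {1..r}. of_int (sign \<sigma>) * (if weyl_act \<sigma> v = w then 1 else 0))"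
  unfolding alt_sum_def lookup_sum by (intro sum.cong) (auto simp: lookup_single when_def)

lemma alternating_alt_sum: "alternating r (alt_sum r v :: weight \<Rightarrow>\<^sub>0 'a::comm_ring_1)"
  unfolding alternating_def
proof (intro allI impI)
  fix \<sigma> assume \<sigma>: "\<sigma> permutes {1..r}"
  have perm: "permutation \<tau>" if "\<tau> permutes {1..r}" for \<tau>
    using that permutes_imp_permutation by blast
  have "wact \<sigma> (alt_sum r v :: weight \<Rightarrow>\<^sub>0 'a) =
      (\<Sum>\<tau> | \<tau> permutes {1..r}. Poly_Mapping.single (weyl_act (\<sigma> \<circ> \<tau>) v) (of_int (sign \<tau>)))"
    unfolding alt_sum_def wact_sum[OF permutes_bij[OF \<sigma>]]
    by (intro sum.cong) (use \<sigma> in \<open>auto simp: wact_single weyl_act_comp permutes_bij\<close>)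
  also have "\<dots> = (\<Sum>\<tau> | \<tau> permutes {1..r}. of_int (sign \<sigma>) * Poly_Mapping.single (weyl_act (\<sigma> \<circ> \<tau>) v) (of_int (sign (\<sigma> \<circ> \<tau>))))"
  proof (intro sum.cong refl)
    fix \<tau> assume "\<tau> \<in> {\<tau>. \<tau> permutes {1..r}}"
    then have "sign (\<sigma> \<circ> \<tau>) = sign \<sigma> * sign \<tau>"
      by (intro sign_compose perm) (use \<sigma> in auto)
    then show "Poly_Mapping.single (weyl_act (\<sigma> \<circ> \<tau>) v) (of_int (sign \<tau>) :: 'a) =
        of_int (sign \<sigma>) * Poly_Mapping.single (weyl_act (\<sigma> \<circ> \<tau>) v) (of_int (sign (\<sigma> \<circ> \<tau>)) :: 'a)"
      by (intro poly_mapping_eqI)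
        (auto simp: coef_of_int_times lookup_single when_def simp flip: of_int_mult)
  qed
  also have "\<dots> = of_int (sign \<sigma>) * alt_sum r v"
    unfolding alt_sum_def sum_distrib_left
    by (rule setum_permutations_compose_left[OF \<sigma>, symmetric])
  finally show "wact \<sigma> (alt_sum r v :: weight \<Rightarrow>\<^sub>0 'a) = of_int (sign \<sigma>) * alt_sum r v" .
qed

lemma coef_alt_sum_strictly_dominant:
  assumes "strictly_dominant r v" "strictly_dominant r w"
  shows "coef (alt_sum r v) w = (if v = w then 1 else 0 :: 'a::comm_ring_1)"
proof -
  have "coef (alt_sum r v :: weight \<Rightarrow>\<^sub>0 'a) w = (\<Sum>\<sigma> | \<sigma> permutes {1..r}. if \<sigma> = id then (if v = w then 1 else 0) else 0)"
    unfolding coef_alt_sum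
  proof (intro sum.cong refl)
    fix \<sigma> assume "\<sigma> \<in> {\<sigma>. \<sigma> permutes {1..r}}"
    then show "of_int (sign \<sigma>) * (if weyl_act \<sigma> v = w then 1 else 0) =
        (if \<sigma> = id then if v = w then 1 else 0 else (0::'a))"
      using strictly_dominant_weyl_act_eq_id[of \<sigma> r v] assms by auto
  qed
  also have "\<dots> = (if v = w then 1 else 0)"
    by (subst sum.delta) (auto simp: finite_permutations permutes_id)
  finally show ?thesis .
qed

lemma alternating_sum: "(\<And>i. i \<in> A \<Longrightarrow> alternating r (f i)) \<Longrightarrow> alternating r (\<Sum>i\<in>A. f i)"
  by (auto simp: alternating_def wact_sum permutes_bij sum_distrib_left intro: sum.cong)

lemma wact_single_0_times:
  "bij \<sigma> \<Longrightarrow> wact \<sigma> (Poly_Mapping.single 0 c * f) = Poly_Mapping.single 0 c * wact \<sigma> f"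
  by (rule poly_mapping_eqI) (simp add: coef_wact coef_single_0_times)

lemma alternating_scale: "alternating r f \<Longrightarrow> alternating r (Poly_Mapping.single 0 c * f)"
  by (auto simp: alternating_def wact_single_0_times permutes_bij mult.left_commute)

text \<open>By \<open>coef_alt_sum_strictly_dominant\<close>, the alternating sums of strictly
  dominant weights are dual to the coefficients at strictly dominant exponents. The set
  \<open>A\<close> is a parameter because it is a single point in the character formula and a part
  of the support in the decomposition of Adams operations.\<close>

lemma alternating_expansion:
  fixes f :: "weight \<Rightarrow>\<^sub>0 'a::{idom, ring_char_0}"
  assumes f: "alternating r f" and A: "finite A"
    "\<And>v. v \<in> supp f \<Longrightarrow> strictly_dominant r v \<Longrightarrow> v \<in> A" "\<And>v. v \<in> A \<Longrightarrow> strictly_dominant r v"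
  shows "f = (\<Sum>v\<in>A. Poly_Mapping.single 0 (coef f v) * alt_sum r v)"
proof (rule alternating_eqI[OF f])
  show "alternating r (\<Sum>v\<in>A. Poly_Mapping.single 0 (coef f v) * alt_sum r v)"
    by (intro alternating_sum alternating_scale alternating_alt_sum)
  fix w assume w: "strictly_dominant r w"
  have "coef (\<Sum>v\<in>A. Poly_Mapping.single 0 (coef f v) * alt_sum r v) w =
      (\<Sum>v\<in>A. coef f v * (if v = w then 1 else 0))"
    unfolding lookup_sum
    by (intro sum.cong refl) (simp add: coef_single_0_times coef_alt_sum_strictly_dominant w A(3))
  also have "\<dots> = (if w \<in> A then coef f w else 0)"
    using A(1) by (simp add: if_distrib cong: if_cong)
  also have "\<dots> = coef f w" using A(2)[of w] w by (auto simp: in_keys_iff)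
  finally show "coef f w = coef (\<Sum>v\<in>A. Poly_Mapping.single 0 (coef f v) * alt_sum r v) w" by simp
qed

subsection \<open>Leading terms\<close>

text \<open>The bound \<open>a\<close> need not lie in the support; its coefficient is tracked
  separately, so that leading terms multiply.\<close>

definition dominated :: "nat \<Rightarrow> weight \<Rightarrow> (weight \<Rightarrow>\<^sub>0 'a::zero) \<Rightarrow> bool" where
  "dominated r a f \<longleftrightarrow> supported r a \<and>
     (\<forall>v\<in>supp f. supported r v \<and> (\<forall>k\<in>{1..r}. psum k v \<le> psum k a))"

text \<open>If exponents c and a + b - c occur in the factors, then the partial sums of c are at
  most those of a and the partial sums of a - c are at most zero. Hence c = a, and the extremal
  coefficient receives a single contribution.\<close>

lemma dominated_times:
  fixes f g :: "weight \<Rightarrow>\<^sub>0 'a::comm_ring_1"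
  assumes f: "dominated r a f" and g: "dominated r b g"
  shows "dominated r (a + b) (f * g)" "coef (f * g) (a + b) = coef f a * coef g b"
proof -
  show "dominated r (a + b) (f * g)"
    unfolding dominated_def
  proof (intro conjI ballI)
    show "supported r (a + b)" using f g by (simp add: dominated_def supported_add)
    fix v assume "v \<in> supp (f * g)"
    then obtain x y where "v = x + y" "x \<in> supp f" "y \<in> supp g" using keys_mult[of f g] by blast
    then show "supported r v" "\<And>k. k \<in> {1..r} \<Longrightarrow> psum k v \<le> psum k (a + b)"
      using f g by (auto simp: dominated_def supported_add psum_add intro!: add_mono)
  qed
  have "coef (f * g) (a + b) = (\<Sum>c\<in>insert a (supp f). coef f c * coef g (a + b - c))"
    by (rule coef_times) auto
  also have "\<dots> = (\<Sum>c\<in>insert a (supp f). if c = a then coef f a * coef g b else 0)"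
  proof (intro sum.cong refl)
    fix c assume "c \<in> insert a (supp f)"
    then have c: "c = a \<or> c \<in> supp f" by blast
    have "coef g (a + b - c) = 0" if "c \<noteq> a" "c \<in> supp f"
    proof (rule ccontr)
      assume "coef g (a + b - c) \<noteq> 0"
      then have *: "a + b - c \<in> supp g" by (simp add: in_keys_iff)
      have "psum k (a - c) = 0" if k: "k \<in> {1..r}" for k
        using * f g \<open>c \<in> supp f\<close> k by (force simp: dominated_def psum_add psum_diff)
      then have "a - c = 0"
        using f \<open>c \<in> supp f\<close> by (intro psum_zero_imp_zero[of r]) (auto simp: dominated_def supported_diff)
      then show False using that by simp
    qed
    then show "coef f c * coef g (a + b - c) = (if c = a then coef f a * coef g b else 0)"
      using c by auto
  qed
  also have "\<dots> = coef f a * coef g b" by simp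
  finally show "coef (f * g) (a + b) = coef f a * coef g b" .
qed

lemma dominated_prod:
  fixes f :: "'i \<Rightarrow> weight \<Rightarrow>\<^sub>0 'a::comm_ring_1"
  assumes "finite I" "\<And>i. i \<in> I \<Longrightarrow> dominated r (a i) (f i)" "\<And>i. i \<in> I \<Longrightarrow> coef (f i) (a i) = 1"
  shows "dominated r (\<Sum>i\<in>I. a i) (\<Prod>i\<in>I. f i) \<and> coef (\<Prod>i\<in>I. f i) (\<Sum>i\<in>I. a i) = 1"
  using assms
proof (induction I rule: finite_induct)
  case empty
  have "dominated r 0 (1 :: weight \<Rightarrow>\<^sub>0 'a)" by (simp add: dominated_def supported_def)
  then show ?case by (simp only: sum.empty prod.empty lookup_one_zero)
next
  case (insert i I)
  then have "dominated r (\<Sum>i\<in>I. a i) (\<Prod>i\<in>I. f i)" "coef (\<Prod>i\<in>I. f i) (\<Sum>i\<in>I. a i) = 1"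
    "dominated r (a i) (f i)" "coef (f i) (a i) = 1" by blast+
  then show ?case
    using dominated_times[of r "a i" "f i" "\<Sum>i\<in>I. a i" "\<Prod>i\<in>I. f i"] insert(1,2)
    by (simp only: sum.insert prod.insert mult_1 not_False_eq_True simp_thms)
qed

section \<open>The Weyl denominator\<close>

definition root_pairs :: "nat \<Rightarrow> (nat \<times> nat) set" where
  "root_pairs r = {(a, b). 1 \<le> a \<and> a < b \<and> b \<le> r}"

text \<open>With half roots, exchanging the two indices negates a factor of the denominator exactly.
  Half roots need not be weights; only their total \<delta> and differences that are roots survive
  in the product.\<close>

definition half_root :: "nat \<Rightarrow> nat \<Rightarrow> weight" where
  "half_root a b = wscale (1/2) (eps a - eps b)"

definition denom_factor :: "nat \<Rightarrow> nat \<Rightarrow> weight \<Rightarrow>\<^sub>0 'a::comm_ring_1" where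
  "denom_factor a b = xpow (half_root a b) - xpow (- half_root a b)"

definition weyl_denom :: "nat \<Rightarrow> weight \<Rightarrow>\<^sub>0 'a::comm_ring_1" where
  "weyl_denom r = (\<Prod>(a, b)\<in>root_pairs r. denom_factor a b)"

lemma finite_root_pairs [simp]: "finite (root_pairs r)"
  by (rule finite_subset[of _ "{1..r} \<times> {1..r}"]) (auto simp: root_pairs_def)

lemma half_root_swap: "half_root b a = - half_root a b"
  by (simp add: half_root_def wscale_def fun_eq_iff algebra_simps)

lemma denom_factor_swap: "denom_factor b a = - denom_factor a b"
  by (simp add: denom_factor_def half_root_swap[of b a])

lemma wact_denom_factor: "bij \<sigma> \<Longrightarrow> wact \<sigma> (denom_factor a b) = denom_factor (\<sigma> a) (\<sigma> b)"
  by (simp add: denom_factor_def wact_diff wact_single half_root_swap[symmetric])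
    (simp add: half_root_def weyl_act_wscale weyl_act_diff weyl_act_eps)

text \<open>A simple reflection permutes the positive roots other than its own root, and the factor
  of that root changes sign.\<close>

lemma alternating_weyl_denom: "alternating r (weyl_denom r :: weight \<Rightarrow>\<^sub>0 'a::comm_ring_1)"
proof (rule alternating_if_adjacent)
  fix k assume k: "k \<in> {1..<r}"
  let ?s = "Transposition.transpose k (k + 1)"
  let ?P = "root_pairs r - {(k, k + 1)}"
  let ?d = "\<lambda>(a, b). denom_factor a b :: weight \<Rightarrow>\<^sub>0 'a"
  have mem: "(k, k + 1) \<in> root_pairs r" using k by (auto simp: root_pairs_def)
  have bij: "bij_betw (map_prod ?s ?s) ?P ?P"
  proof -
    have "map_prod ?s ?s x \<in> ?P" if x: "x \<in> ?P" for x
    proof -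
      obtain a b where ab: "x = (a, b)" "1 \<le> a" "a < b" "b \<le> r" "(a, b) \<noteq> (k, k + 1)"
        using x by (auto simp: root_pairs_def)
      have "1 \<le> ?s a" "?s b \<le> r" "?s a < ?s b" "?s a \<noteq> k \<or> ?s b \<noteq> k + 1"
        using ab(2-) k by (auto simp: Transposition.transpose_def)
      then show ?thesis by (auto simp: ab(1) root_pairs_def)
    qed
    then have sub: "map_prod ?s ?s ` ?P \<subseteq> ?P" by (rule image_subsetI)
    have inv: "\<forall>x\<in>?P. map_prod ?s ?s (map_prod ?s ?s x) = x" by auto
    show ?thesis by (rule bij_betw_byWitness[OF inv inv sub sub])
  qed
  have "wact ?s (weyl_denom r :: weight \<Rightarrow>\<^sub>0 'a) = (\<Prod>x\<in>root_pairs r. ?d (map_prod ?s ?s x))"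
    unfolding weyl_denom_def by (auto simp: wact_prod wact_denom_factor bij_transpose intro!: prod.cong)
  also have "\<dots> = ?d (k + 1, k) * (\<Prod>x\<in>?P. ?d (map_prod ?s ?s x))"
    by (subst prod.remove[OF _ mem]) auto
  also have "(\<Prod>x\<in>?P. ?d (map_prod ?s ?s x)) = (\<Prod>x\<in>?P. ?d x)"
    by (rule prod.reindex_bij_betw[OF bij])
  also have "?d (k + 1, k) * (\<Prod>x\<in>?P. ?d x) = - (?d (k, k + 1) * (\<Prod>x\<in>?P. ?d x))"
    by (simp add: denom_factor_swap[of "Suc k" k])
  also have "?d (k, k + 1) * (\<Prod>x\<in>?P. ?d x) = weyl_denom r"
    unfolding weyl_denom_def by (rule prod.remove[OF _ mem, symmetric]) simp
  finally show "wact ?s (weyl_denom r) = - (weyl_denom r :: weight \<Rightarrow>\<^sub>0 'a)" .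
qed

lemma psum_eps: "psum k (eps a) = (if 1 \<le> a \<and> a \<le> k then 1 else 0)"
  by (simp add: psum_def eps_def)

lemma psum_half_root:
  assumes "1 \<le> a" "a < b"
  shows "psum k (half_root a b) = (if a \<le> k \<and> k < b then 1/2 else 0)"
  using assms by (auto simp: half_root_def psum_wscale psum_diff psum_eps)

lemma supported_half_root: "a \<in> {1..r} \<Longrightarrow> b \<in> {1..r} \<Longrightarrow> supported r (half_root a b)"
  unfolding half_root_def by (intro supported_wscale supported_diff supported_eps)

text \<open>The index k is the positive end of r - k positive roots and the negative end of k - 1 of
  them; half the difference is (r + 1 - 2k)/2.\<close>

lemma sum_half_roots: "(\<Sum>(a, b)\<in>root_pairs r. half_root a b) = weyl_vector r"
proof (rule supported_eqI[of r])
  have half_root_apply: "half_root a b k = (if k = a then 1/2 else 0) - (if k = b then 1/2 else 0)" for a b k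
    by (simp add: half_root_def wscale_def eps_def)
  show "supported r (\<Sum>(a, b)\<in>root_pairs r. half_root a b)"
    unfolding supported_def sum_fun_apply
    by (intro allI impI sum.neutral) (auto simp: half_root_apply root_pairs_def)
  show "supported r (weyl_vector r)" by (rule supported_weyl_vector)
  fix k assume k: "k \<in> {1..r}"
  have "(\<Sum>x\<in>root_pairs r. case x of (a, b) \<Rightarrow> half_root a b) k =
      (\<Sum>(a, b)\<in>root_pairs r. (if k = a then 1/2 else 0)) - (\<Sum>(a, b)\<in>root_pairs r. (if k = b then 1/2 else 0))"
    unfolding sum_fun_apply sum_subtractf[symmetric]
    by (intro sum.cong) (auto simp: half_root_apply)
  also have "(\<Sum>(a, b)\<in>root_pairs r. (if k = a then 1/2 else 0)) = (\<Sum>x\<in>Pair k ` {k<..r}. 1/2 :: rat)"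
    by (rule sum.mono_neutral_cong_right[OF finite_root_pairs]) (use k in \<open>auto simp: root_pairs_def\<close>)
  also have "\<dots> = of_nat (r - k) / 2"
    by (simp add: card_image inj_on_def)
  also have "(\<Sum>(a, b)\<in>root_pairs r. (if k = b then 1/2 else 0)) = (\<Sum>x\<in>(\<lambda>a. (a, k)) ` {1..<k}. 1/2 :: rat)"
    by (rule sum.mono_neutral_cong_right[OF finite_root_pairs]) (use k in \<open>auto simp: root_pairs_def\<close>)
  also have "\<dots> = of_nat (k - 1) / 2"
    by (simp add: card_image inj_on_def)
  finally show "(\<Sum>x\<in>root_pairs r. case x of (a, b) \<Rightarrow> half_root a b) k = weyl_vector r k"
    using k by (simp add: weyl_vector_apply of_nat_diff field_simps)
qed

lemma half_root_ne: "a \<noteq> b \<Longrightarrow> half_root a b \<noteq> - half_root a b"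
proof
  assume "a \<noteq> b" "half_root a b = - half_root a b"
  then have "half_root a b a = - half_root a b a" by (metis uminus_apply)
  then show False using \<open>a \<noteq> b\<close> by (simp add: half_root_def wscale_def eps_def)
qed

lemma dominated_denom_factor:
  assumes "(a, b) \<in> root_pairs r"
  shows "dominated r (half_root a b) (denom_factor a b :: weight \<Rightarrow>\<^sub>0 'a::comm_ring_1)"
    "coef (denom_factor a b :: weight \<Rightarrow>\<^sub>0 'a) (half_root a b) = 1"
proof -
  have ab: "1 \<le> a" "a < b" "a \<in> {1..r}" "b \<in> {1..r}" using assms by (auto simp: root_pairs_def)
  have k: "supp (denom_factor a b :: weight \<Rightarrow>\<^sub>0 'a) \<subseteq> {half_root a b, half_root b a}"
    unfolding denom_factor_def half_root_swap[of b a] in_keys_iff subset_iff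
    by (auto simp: in_keys_iff lookup_minus lookup_single when_def)
  show "dominated r (half_root a b) (denom_factor a b :: weight \<Rightarrow>\<^sub>0 'a)"
    unfolding dominated_def
  proof (intro conjI ballI)
    show "supported r (half_root a b)" using ab by (simp add: supported_half_root)
    fix v assume "v \<in> supp (denom_factor a b :: weight \<Rightarrow>\<^sub>0 'a)"
    then have v: "v = half_root a b \<or> v = - half_root a b" using k half_root_swap[of b a] by auto
    then show "supported r v"
      using supported_half_root[of a r b] supported_half_root[of b r a] ab half_root_swap[of b a] by auto
    fix k
    have "psum k (- half_root a b) = - psum k (half_root a b)"
      by (simp add: psum_def sum_negf)
    then show "psum k v \<le> psum k (half_root a b)" using v psum_half_root[OF ab(1,2), of k] by auto
  qed
  show "coef (denom_factor a b :: weight \<Rightarrow>\<^sub>0 'a) (half_root a b) = 1"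
    using half_root_ne[of a b] ab by (simp add: denom_factor_def lookup_minus lookup_single when_def)
qed

lemma dominated_weyl_denom:
  "dominated r (weyl_vector r) (weyl_denom r :: weight \<Rightarrow>\<^sub>0 'a::comm_ring_1)"
  "coef (weyl_denom r :: weight \<Rightarrow>\<^sub>0 'a) (weyl_vector r) = 1"
proof -
  have "dominated r (\<Sum>x\<in>root_pairs r. case x of (a, b) \<Rightarrow> half_root a b) (weyl_denom r :: weight \<Rightarrow>\<^sub>0 'a) \<and>
      coef (weyl_denom r :: weight \<Rightarrow>\<^sub>0 'a) (\<Sum>x\<in>root_pairs r. case x of (a, b) \<Rightarrow> half_root a b) = 1"
    unfolding weyl_denom_def
    by (rule dominated_prod) (auto simp: dominated_denom_factor)
  then show "dominated r (weyl_vector r) (weyl_denom r :: weight \<Rightarrow>\<^sub>0 'a)"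
    "coef (weyl_denom r :: weight \<Rightarrow>\<^sub>0 'a) (weyl_vector r) = 1"
    unfolding sum_half_roots by auto
qed

text \<open>In this form all exponents visibly lie in the weight lattice, the factors can be
  cancelled one at a time, and the principal specialisation becomes a product over positive
  roots.\<close>

lemma weyl_denom_factored:
  "weyl_denom r = xpow (weyl_vector r) *
    (\<Prod>(a, b)\<in>root_pairs r. 1 - xpow (eps b - eps a) :: weight \<Rightarrow>\<^sub>0 'a::comm_ring_1)"
proof -
  have f: "denom_factor a b = xpow (half_root a b) * (1 - xpow (eps b - eps a) :: weight \<Rightarrow>\<^sub>0 'a)" for a b
  proof -
    have "half_root a b + (eps b - eps a) = - half_root a b"
      by (simp add: half_root_def wscale_def fun_eq_iff algebra_simps)
    then show ?thesis by (simp only: denom_factor_def right_diff_distrib mult_single mult_1_right)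
  qed
  have "(\<Prod>x\<in>I. case x of (a, b) \<Rightarrow> xpow (half_root a b)) = (xpow (\<Sum>x\<in>I. case x of (a, b) \<Rightarrow> half_root a b) :: weight \<Rightarrow>\<^sub>0 'a)"
    if "finite I" for I
    using that
  proof (induction I rule: finite_induct)
    case (insert x I)
    then show ?case
      by (simp only: prod.insert sum.insert not_False_eq_True simp_thms) (simp only: case_prod_unfold mult_single mult_1)
  qed (simp only: sum.empty prod.empty single_one)
  then have "(\<Prod>x\<in>root_pairs r. case x of (a, b) \<Rightarrow> xpow (half_root a b)) = (xpow (weyl_vector r) :: weight \<Rightarrow>\<^sub>0 'a)"
    by (simp add: sum_half_roots)
  then show ?thesis
    unfolding weyl_denom_def f by (simp add: case_prod_unfold prod.distrib)
qed

text \<open>The relation makes the coefficients of g constant along steps of v. A nonzero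
  coefficient would thus recur at infinitely many exponents, contradicting finite support.\<close>

lemma binomial_cancel:
  fixes g :: "weight \<Rightarrow>\<^sub>0 'a::comm_ring_1"
  assumes "v \<noteq> 0" "(1 - xpow v) * g = 0"
  shows "g = 0"
proof (rule ccontr)
  assume "g \<noteq> 0"
  then obtain w where w: "coef g w \<noteq> 0" by (metis lookup_zero poly_mapping_eqI)
  have step: "coef g k = coef g (k - v)" for k
  proof -
    have "coef ((1 - xpow v) * g) k = coef g k - coef g (k - v)"
      by (simp add: left_diff_distrib lookup_minus coef_single_times)
    then show ?thesis using assms(2) by simp
  qed
  have "coef g (w - wscale (of_nat n) v) \<noteq> 0" for n
  proof (induction n)
    case 0
    then show ?case using w by (simp add: wscale_def fun_diff_def)
  next
    case (Suc n)
    have "w - wscale (of_nat (Suc n)) v = w - wscale (of_nat n) v - v"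
      by (simp add: wscale_def fun_eq_iff algebra_simps)
    then show ?case using Suc step by metis
  qed
  then have "range (\<lambda>n. w - wscale (of_nat n) v) \<subseteq> supp g" by (auto simp: in_keys_iff)
  then have "finite (range (\<lambda>n. w - wscale (of_nat n) v))" by (rule finite_subset) simp
  moreover have "inj (\<lambda>n::nat. w - wscale (of_nat n) v)"
  proof (rule injI)
    fix m n :: nat assume eq: "w - wscale (of_nat m) v = w - wscale (of_nat n) v"
    obtain k where k: "v k \<noteq> 0" using assms(1) by (auto simp: fun_eq_iff)
    from eq have "(w - wscale (of_nat m) v) k = (w - wscale (of_nat n) v) k" by simp
    then show "m = n" using k by (simp add: wscale_def)
  qed
  ultimately show False using finite_imageD infinite_UNIV_nat by blast
qed

lemma prod_binomial_cancel:
  fixes h :: "weight \<Rightarrow>\<^sub>0 'a::comm_ring_1"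
  assumes "finite I" "\<And>i. i \<in> I \<Longrightarrow> v i \<noteq> 0" "(\<Prod>i\<in>I. 1 - xpow (v i)) * h = 0"
  shows "h = 0"
  using assms
proof (induction I arbitrary: h rule: finite_induct)
  case (insert i I)
  have "(\<Prod>i\<in>I. 1 - xpow (v i)) * ((1 - xpow (v i)) * h) = (\<Prod>i\<in>insert i I. 1 - xpow (v i)) * h"
    unfolding prod.insert[OF insert.hyps] by (rule mult.left_commute[THEN trans, OF mult.assoc[symmetric]])
  then have *: "(\<Prod>i\<in>I. 1 - xpow (v i)) * ((1 - xpow (v i)) * h) = 0"
    unfolding insert.prems(2) .
  have "(1 - xpow (v i)) * h = 0"
    by (rule insert.IH[OF insert.prems(1) *]) simp
  then show ?case by (rule binomial_cancel[OF insert.prems(1), rotated]) simp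
qed simp

lemma weyl_denom_cancel:
  fixes f g :: "weight \<Rightarrow>\<^sub>0 'a::comm_ring_1"
  assumes "weyl_denom r * f = weyl_denom r * g"
  shows "f = g"
proof -
  define v :: "nat \<times> nat \<Rightarrow> weight" where "v = (\<lambda>(a, b). eps b - eps a)"
  have D: "weyl_denom r = xpow (weyl_vector r) * (\<Prod>x\<in>root_pairs r. 1 - xpow (v x) :: weight \<Rightarrow>\<^sub>0 'a)"
    unfolding weyl_denom_factored v_def by (simp only: case_prod_unfold)
  have "xpow (- weyl_vector r) * (weyl_denom r * (f - g)) = 0"
    unfolding right_diff_distrib assms by (simp only: diff_self mult_zero_right)
  moreover have "xpow (- weyl_vector r) * (weyl_denom r * (f - g)) =
      xpow (- weyl_vector r) * xpow (weyl_vector r) * ((\<Prod>x\<in>root_pairs r. 1 - xpow (v x)) * (f - g))"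
    unfolding D by (simp only: mult.assoc)
  moreover have "xpow (- weyl_vector r) * xpow (weyl_vector r) = (1 :: weight \<Rightarrow>\<^sub>0 'a)"
    by (simp add: mult_single)
  ultimately have P: "(\<Prod>x\<in>root_pairs r. 1 - xpow (v x)) * (f - g) = 0" by (simp only: mult_1)
  have "v x \<noteq> 0" if x: "x \<in> root_pairs r" for x
  proof
    assume "v x = 0"
    then have "v x (snd x) = 0" by simp
    then show False using x by (auto simp: v_def root_pairs_def eps_def)
  qed
  then have "f - g = 0" by (rule prod_binomial_cancel[OF finite_root_pairs _ P])
  then show ?thesis by simp
qed

section \<open>The character formula from Freudenthal's relations\<close>

text \<open>Equal norms give (w - v, w + v) = 0. By Abel summation this is a sum of nonnegative
  terms: the partial sums of w - v are nonnegative, while w + v has strictly positive drops. So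
  every partial sum of w - v vanishes.\<close>

lemma ip_dominated_eq:
  assumes "supported r v" "supported r w" "psum r v = 0" "psum r w = 0"
    and "\<And>k. k \<in> {1..r} \<Longrightarrow> psum k v \<le> psum k w"
    and "strictly_dominant r v" "strictly_dominant r w" "ip r v v = ip r w w"
  shows "v = w"
proof -
  define y where "y = w + v"
  have "ip r (w - v) y = 0"
    using assms(8) ip_commute[of r v w] by (simp add: y_def ip_linear)
  moreover have "psum r (w - v) = 0" by (simp add: psum_diff assms)
  ultimately have sum0: "(\<Sum>k\<in>{1..<r}. psum k (w - v) * (y k - y (k + 1))) = 0"
    using ip_abel_summation_traceless by metis
  have y: "0 < y k - y (k + 1)" if "k \<in> {1..<r}" for k
    using assms(6,7) that unfolding strictly_dominant_def y_def
    by (metis add_strict_mono diff_gt_0_iff_gt plus_fun_apply)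
  have nn: "0 \<le> psum k (w - v)" if "k \<in> {1..<r}" for k
    using assms(5)[of k] that by (simp add: psum_diff)
  have "psum k (w - v) = 0" if k: "k \<in> {1..<r}" for k
  proof -
    have "0 \<le> psum k (w - v) * (y k - y (k + 1))" if "k \<in> {1..<r}" for k
      by (intro mult_nonneg_nonneg nn less_imp_le[OF y] that)
    then have "\<forall>k\<in>{1..<r}. psum k (w - v) * (y k - y (k + 1)) = 0"
      using sum0 by (subst (asm) sum_nonneg_eq_0_iff) simp_all
    then show ?thesis using y[OF k] k by auto
  qed
  then have "psum k (w - v) = 0" if "k \<in> {1..r}" for k
    using that \<open>psum r (w - v) = 0\<close> by (cases "k = r") auto
  then have "w - v = 0"
    using assms(1,2) by (intro psum_zero_imp_zero[of r] supported_diff) auto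
  then show ?thesis by simp
qed

text \<open>Integrality makes every drop of v at least 1, the value for \<delta>. Then x = \<delta>
  - v has nonpositive drops and nonnegative partial sums, so its norm is at most zero.\<close>

lemma dominated_by_weyl_vector_eq:
  assumes r: "1 \<le> r" and v: "v \<in> weight_lattice r" "strictly_dominant r v"
    and le: "\<And>k. k \<in> {1..r} \<Longrightarrow> psum k v \<le> psum k (weyl_vector r)"
  shows "v = weyl_vector r"
proof -
  define x where "x = weyl_vector r - v"
  have sx: "supported r x" and px: "psum r x = 0"
    using v r supported_weyl_vector[of r] psum_weyl_vector[of r r]
    by (auto simp: x_def weight_lattice_iff psum_diff supported_diff)
  have "x k - x (k + 1) \<le> 0" if k: "k \<in> {1..<r}" for k
  proof -
    have "v k - v (k + 1) \<in> \<int>" "0 < v k - v (k + 1)"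
      using v r k by (auto simp: weight_lattice_iff strictly_dominant_def)
    then have "1 \<le> v k - v (k + 1)" by (auto elim!: Ints_cases)
    moreover have "x k - x (k + 1) = (weyl_vector r k - weyl_vector r (k + 1)) - (v k - v (k + 1))"
      by (simp add: x_def)
    ultimately show ?thesis using weyl_vector_step[OF k] by simp
  qed
  moreover have "0 \<le> psum k x" if "k \<in> {1..<r}" for k
    using le[of k] that by (simp add: x_def psum_diff)
  ultimately have "ip r x x \<le> 0"
    unfolding ip_abel_summation_traceless[OF px] by (intro sum_nonpos mult_nonneg_nonpos)
  then have "x = 0" using ip_self_nonneg[of r x] by (intro ip_self_eq_0[OF sx]) simp
  then show ?thesis by (simp add: x_def)
qed

section \<open>Supports in the weight lattice and the denominator formula\<close>

definition lattice_supp :: "nat \<Rightarrow> (weight \<Rightarrow>\<^sub>0 'a::zero) \<Rightarrow> bool" where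
  "lattice_supp r f \<longleftrightarrow> supp f \<subseteq> weight_lattice r"

lemma lattice_supp_times:
  fixes f g :: "weight \<Rightarrow>\<^sub>0 'a::comm_ring_1"
  shows "1 \<le> r \<Longrightarrow> lattice_supp r f \<Longrightarrow> lattice_supp r g \<Longrightarrow> lattice_supp r (f * g)"
  using keys_mult[of f g] weight_lattice_add[of r] unfolding lattice_supp_def by blast

lemma zero_in_weight_lattice: "1 \<le> r \<Longrightarrow> 0 \<in> weight_lattice r"
  using weight_lattice_diff[OF _ weyl_vector_in_weight_lattice weyl_vector_in_weight_lattice] by simp

lemma lattice_supp_single: "v \<in> weight_lattice r \<Longrightarrow> lattice_supp r (Poly_Mapping.single v c)"
  by (simp add: lattice_supp_def)

lemma lattice_supp_prod:
  fixes f :: "'i \<Rightarrow> weight \<Rightarrow>\<^sub>0 'a::comm_ring_1"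
  assumes "1 \<le> r" "\<And>i. i \<in> I \<Longrightarrow> lattice_supp r (f i)"
  shows "lattice_supp r (\<Prod>i\<in>I. f i)"
proof -
  have "lattice_supp r (1 :: weight \<Rightarrow>\<^sub>0 'a)"
    using zero_in_weight_lattice[OF assms(1)] by (simp add: lattice_supp_def)
  then show ?thesis
    using assms(2) by (induction I rule: infinite_finite_induct) (auto intro: lattice_supp_times[OF assms(1)])
qed

lemma eps_diff_in_weight_lattice:
  assumes "a \<in> {1..r}" "b \<in> {1..r}"
  shows "eps a - eps b \<in> weight_lattice r"
proof -
  have "eps a i \<in> \<int>" for a i by (simp add: eps_def)
  then show ?thesis
    using assms by (subst weight_lattice_iff) (auto simp: supported_diff supported_eps psum_diff psum_eps)
qed

lemma lattice_supp_weyl_denom: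
  assumes r: "1 \<le> r"
  shows "lattice_supp r (weyl_denom r :: weight \<Rightarrow>\<^sub>0 'a::comm_ring_1)"
  unfolding weyl_denom_factored
proof (intro lattice_supp_times[OF r] lattice_supp_prod[OF r] lattice_supp_single weyl_vector_in_weight_lattice r)
  fix x assume "x \<in> root_pairs r"
  then obtain a b where x: "x = (a, b)" "a \<in> {1..r}" "b \<in> {1..r}" by (auto simp: root_pairs_def)
  have "supp (1 - xpow (eps b - eps a) :: weight \<Rightarrow>\<^sub>0 'a) \<subseteq> {0, eps b - eps a}"
    by (auto simp: in_keys_iff lookup_minus lookup_one lookup_single when_def split: if_splits)
  then show "lattice_supp r (case x of (a, b) \<Rightarrow> (1 - xpow (eps b - eps a) :: weight \<Rightarrow>\<^sub>0 'a))"
    using eps_diff_in_weight_lattice[OF x(3,2)] zero_in_weight_lattice[OF r] x(1)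
    by (auto simp: lattice_supp_def)
qed

text \<open>Among the exponents of the product, \<delta> is the only strictly dominant one, and it
  has coefficient 1.\<close>

lemma weyl_denom_eq_alt_sum:
  assumes r: "1 \<le> r"
  shows "weyl_denom r = (alt_sum r (weyl_vector r) :: weight \<Rightarrow>\<^sub>0 'a::{idom, ring_char_0})"
proof -
  have "weyl_denom r = (\<Sum>v\<in>{weyl_vector r}. Poly_Mapping.single 0 (coef (weyl_denom r) v) * alt_sum r v :: weight \<Rightarrow>\<^sub>0 'a)"
  proof (rule alternating_expansion[OF alternating_weyl_denom])
    fix v assume "v \<in> supp (weyl_denom r :: weight \<Rightarrow>\<^sub>0 'a)" "strictly_dominant r v"
    then show "v \<in> {weyl_vector r}"
      using dominated_weyl_denom(1)[of r, where 'a = 'a] lattice_supp_weyl_denom[OF r, where 'a = 'a]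
      by (auto simp: dominated_def lattice_supp_def intro!: dominated_by_weyl_vector_eq[OF r])
  qed (auto simp: strictly_dominant_weyl_vector)
  then show ?thesis by (simp add: dominated_weyl_denom(2))
qed

subsection \<open>Derivations\<close>

text \<open>This is the Euler operator in the i-th variable: monomials are eigenvectors, with the
  i-th coordinate of the exponent as eigenvalue. The sum of the squares of these operators measures
  the norm of an exponent.\<close>

definition pderivation :: "nat \<Rightarrow> (weight \<Rightarrow>\<^sub>0 complex) \<Rightarrow> weight \<Rightarrow>\<^sub>0 complex" where
  "pderivation i f = Poly_Mapping.mapp (\<lambda>v c. of_rat (v i) * c) f"

definition directional :: "nat \<Rightarrow> weight \<Rightarrow> (weight \<Rightarrow>\<^sub>0 complex) \<Rightarrow> weight \<Rightarrow>\<^sub>0 complex" where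
  "directional r w f = Poly_Mapping.mapp (\<lambda>v c. of_rat (ip r w v) * c) f"

definition laplacian :: "nat \<Rightarrow> (weight \<Rightarrow>\<^sub>0 complex) \<Rightarrow> weight \<Rightarrow>\<^sub>0 complex" where
  "laplacian r f = (\<Sum>i=1..r. pderivation i (pderivation i f))"

lemma coef_pderivation: "coef (pderivation i f) v = of_rat (v i) * coef f v"
  by (auto simp: pderivation_def lookup_mapp in_keys_iff when_def)

lemma coef_directional: "coef (directional r w f) v = of_rat (ip r w v) * coef f v"
  by (auto simp: directional_def lookup_mapp in_keys_iff when_def)

lemma coef_laplacian: "coef (laplacian r f) v = of_rat (ip r v v) * coef f v"
  by (simp add: laplacian_def lookup_sum coef_pderivation ip_def of_rat_sum of_rat_mult
      sum_distrib_right mult.assoc)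

lemma pderivation_add: "pderivation i (f + g) = pderivation i f + pderivation i g"
  by (rule poly_mapping_eqI) (simp add: coef_pderivation lookup_add distrib_left)

lemma pderivation_times: "pderivation i (f * g) = pderivation i f * g + f * pderivation i g"
proof (rule poly_mapping_eqI)
  fix k
  have S: "supp (pderivation i f) \<subseteq> supp f" by (auto simp: in_keys_iff coef_pderivation)
  have "coef (pderivation i f * g + f * pderivation i g) k =
      (\<Sum>a\<in>supp f. of_rat (a i) * coef f a * coef g (k - a)) +
      (\<Sum>a\<in>supp f. coef f a * (of_rat ((k - a) i) * coef g (k - a)))"
    unfolding lookup_add
    by (subst coef_times[OF finite_keys S], subst coef_times[OF finite_keys order_refl])
      (simp only: coef_pderivation)
  also have "\<dots> = (\<Sum>a\<in>supp f. of_rat (k i) * (coef f a * coef g (k - a)))"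
    unfolding sum.distrib[symmetric] by (intro sum.cong refl) (simp add: of_rat_diff algebra_simps)
  also have "\<dots> = coef (pderivation i (f * g)) k"
    unfolding coef_pderivation by (subst coef_times[OF finite_keys order_refl]) (simp only: sum_distrib_left)
  finally show "coef (pderivation i (f * g)) k = coef (pderivation i f * g + f * pderivation i g) k" by simp
qed

lemma laplacian_times:
  "laplacian r (f * g) =
    laplacian r f * g + f * laplacian r g + 2 * (\<Sum>i=1..r. pderivation i f * pderivation i g)"
proof -
  have "pderivation i (pderivation i (f * g)) =
      pderivation i (pderivation i f) * g + f * pderivation i (pderivation i g) +
      2 * (pderivation i f * pderivation i g)" for i
    by (simp add: pderivation_times pderivation_add)
  then show ?thesis
    by (simp add: laplacian_def sum.distrib sum_distrib_left sum_distrib_right)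
qed

lemma pderivation_one: "pderivation i 1 = 0"
  by (rule poly_mapping_eqI) (simp add: coef_pderivation lookup_one when_def)

lemma pderivation_prod:
  "finite I \<Longrightarrow> pderivation i (\<Prod>x\<in>I. f x) = (\<Sum>x\<in>I. (\<Prod>y\<in>I-{x}. f y) * pderivation i (f x))"
proof (induction I rule: finite_induct)
  case (insert x I)
  have "(\<Prod>y\<in>insert x I-{z}. f y) = f x * (\<Prod>y\<in>I-{z}. f y)" if "z \<in> I" for z
  proof -
    have "insert x I - {z} = insert x (I - {z})" using insert.hyps that by auto
    then show ?thesis using insert.hyps by simp
  qed
  then have "(\<Sum>z\<in>I. (\<Prod>y\<in>insert x I-{z}. f y) * pderivation i (f z)) =
      f x * (\<Sum>z\<in>I. (\<Prod>y\<in>I-{z}. f y) * pderivation i (f z))"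
    unfolding sum_distrib_left by (intro sum.cong refl) (simp add: mult.assoc)
  moreover have "insert x I - {x} = I" using insert.hyps by auto
  ultimately show ?case
    using insert.hyps insert.IH
    by (simp add: pderivation_times mult.commute[of "pderivation i (f x)"])
qed (simp add: pderivation_one)

lemma pderivation_single:
  "pderivation i (Poly_Mapping.single v c) = Poly_Mapping.single 0 (of_rat (v i)) * Poly_Mapping.single v c"
  by (rule poly_mapping_eqI) (simp add: coef_pderivation coef_single_0_times lookup_single when_def)

lemma pderivation_diff: "pderivation i (f - g) = pderivation i f - pderivation i g"
  by (rule poly_mapping_eqI) (simp add: coef_pderivation lookup_minus right_diff_distrib)

lemma pderivation_denom_factor:
  "pderivation i (denom_factor a b) =
    Poly_Mapping.single 0 (of_rat (half_root a b i)) * (xpow (half_root a b) + xpow (- half_root a b))"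
  unfolding denom_factor_def pderivation_diff pderivation_single
  by (simp add: of_rat_minus single_uminus distrib_left)

lemma coef_two_times: "coef (2 * f) v = 2 * coef f v" for f :: "weight \<Rightarrow>\<^sub>0 complex"
  using coef_of_int_times[of 2 f v] by simp

lemma coef_denom_factor_times:
  "coef (denom_factor a b * g) v = coef g (v - half_root a b) - coef g (v + half_root a b)"
  by (simp add: denom_factor_def left_diff_distrib lookup_minus coef_single_times)

text \<open>\<open>f\<close> satisfies Freudenthal's recursion for the highest weight \<open>\<Lambda>\<close>; the auxiliary \<open>t a b\<close>
  stands for \<open>v \<mapsto> \<Sum>k\<ge>1. (v + k \<alpha>, \<alpha>) f (v + k \<alpha>)\<close> with \<open>\<alpha> = \<epsilon>\<^sub>a - \<epsilon>\<^sub>b\<close>, which for the character of a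
  module is the trace of \<open>E\<^bsub>b a\<^esub> E\<^bsub>a b\<^esub>\<close> on the weight space.\<close>

definition freudenthal :: "nat \<Rightarrow> weight \<Rightarrow> (weight \<Rightarrow>\<^sub>0 int) \<Rightarrow> bool" where
  "freudenthal r \<Lambda> f \<longleftrightarrow>
     dominated r \<Lambda> f \<and> coef f \<Lambda> = 1 \<and> invariant r f \<and> lattice_supp r f \<and>
     (\<exists>t :: nat \<Rightarrow> nat \<Rightarrow> weight \<Rightarrow>\<^sub>0 complex.
       (\<forall>(a, b)\<in>root_pairs r. \<forall>v.
          coef (t a b) v - coef (t a b) (v + (eps a - eps b)) =
            of_rat (ip r (v + (eps a - eps b)) (eps a - eps b)) * of_int (coef f (v + (eps a - eps b)))) \<and>
       (\<forall>v. of_rat (ip r \<Lambda> (\<Lambda> + wscale 2 (weyl_vector r)) - ip r v (v + wscale 2 (weyl_vector r))) *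
              of_int (coef f v) = 2 * (\<Sum>(a, b)\<in>root_pairs r. coef (t a b) v)))"

text \<open>The traces entering the recursion are complex numbers, whereas characters have integer
  coefficients; the eigenvalue computation takes place after this change of coefficients.\<close>

definition complexify :: "(weight \<Rightarrow>\<^sub>0 int) \<Rightarrow> weight \<Rightarrow>\<^sub>0 complex" where
  "complexify f = Poly_Mapping.mapp (\<lambda>v c. of_int c) f"

lemma coef_complexify: "coef (complexify f) v = of_int (coef f v)"
  by (auto simp: complexify_def lookup_mapp in_keys_iff when_def)

lemma complexify_times: "complexify (f * g) = complexify f * complexify g"
proof (rule poly_mapping_eqI)
  fix k
  have S: "supp (complexify f) \<subseteq> supp f" by (auto simp: in_keys_iff coef_complexify)
  show "coef (complexify (f * g)) k = coef (complexify f * complexify g) k"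
    unfolding coef_complexify
    by (subst coef_times[OF finite_keys S], subst coef_times[OF finite_keys order_refl])
      (simp add: coef_complexify)
qed

lemma complexify_weyl_denom:
  assumes "1 \<le> r"
  shows "complexify (weyl_denom r) = weyl_denom r"
  unfolding weyl_denom_eq_alt_sum[OF assms]
  by (rule poly_mapping_eqI) (simp add: coef_complexify coef_alt_sum if_distrib cong: if_cong)

lemma laplacian_weyl_denom:
  assumes "1 \<le> r"
  shows "laplacian r (weyl_denom r) = Poly_Mapping.single 0 (of_rat (ip r (weyl_vector r) (weyl_vector r))) * weyl_denom r"
proof (rule poly_mapping_eqI)
  fix v
  have "ip r v v = ip r (weyl_vector r) (weyl_vector r)" if "coef (weyl_denom r :: weight \<Rightarrow>\<^sub>0 complex) v \<noteq> 0"
  proof -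
    have "\<exists>\<sigma>. \<sigma> permutes {1..r} \<and> weyl_act \<sigma> (weyl_vector r) = v"
    proof (rule ccontr)
      assume "\<nexists>\<sigma>. \<sigma> permutes {1..r} \<and> weyl_act \<sigma> (weyl_vector r) = v"
      then have "coef (weyl_denom r :: weight \<Rightarrow>\<^sub>0 complex) v = 0"
        unfolding weyl_denom_eq_alt_sum[OF assms] coef_alt_sum by (intro sum.neutral) auto
      then show False using that by simp
    qed
    then show ?thesis using ip_weyl_act by blast
  qed
  then show "coef (laplacian r (weyl_denom r)) v =
      coef (Poly_Mapping.single 0 (of_rat (ip r (weyl_vector r) (weyl_vector r))) * weyl_denom r) v"
    by (auto simp: coef_laplacian coef_single_0_times)
qed

text \<open>The mixed term of the product rule contains the logarithmic derivative of the
  denominator, with one summand for each positive root. The difference equation for \<open>t\<close>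
  states that multiplying \<open>t a b\<close> by the corresponding factor gives a derivative of F,
  so each of these fractions can be resolved. The mixed term becomes the denominator times the
  derivative along \<delta> plus the sum of the \<open>t a b\<close>, and the second hypothesis
  turns the total into an eigenvalue equation.\<close>

lemma laplacian_denom_times:
  assumes r: "1 \<le> r"
    and t: "\<And>a b v. (a, b) \<in> root_pairs r \<Longrightarrow>
          coef (t a b) v - coef (t a b) (v + (eps a - eps b)) =
            of_rat (ip r (v + (eps a - eps b)) (eps a - eps b)) * coef F (v + (eps a - eps b))"
    and c: "\<And>v. (c - of_rat (ip r v (v + wscale 2 (weyl_vector r)))) * coef F v =
              2 * (\<Sum>(a, b)\<in>root_pairs r. coef (t a b) v)"
  shows "laplacian r (weyl_denom r * F) =
    Poly_Mapping.single 0 (c + of_rat (ip r (weyl_vector r) (weyl_vector r))) * (weyl_denom r * F)"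
proof -
  let ?D = "weyl_denom r :: weight \<Rightarrow>\<^sub>0 complex"
  let ?d = "\<lambda>x. denom_factor (fst x) (snd x) :: weight \<Rightarrow>\<^sub>0 complex"
  let ?h = "\<lambda>x. half_root (fst x) (snd x)"
  let ?T = "\<lambda>x. t (fst x) (snd x)"
  let ?R = "\<lambda>x. \<Prod>y\<in>root_pairs r - {x}. ?d y"
  have ac1: "A * (B * C) * E = A * C * (B * E)" and ac2: "A * (B * C) = A * C * B"
    for A B C E :: "weight \<Rightarrow>\<^sub>0 complex"
    by (simp_all only: mult.assoc mult.left_commute mult.commute)
  have D: "?D = (\<Prod>x\<in>root_pairs r. ?d x)" by (simp add: weyl_denom_def case_prod_unfold)
  \<comment> \<open>The difference equation is read at v - \<alpha>/2, which makes its two arguments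
    v - \<alpha>/2 and v + \<alpha>/2, exactly those produced by the factor for \<alpha>.\<close>
  have Tx: "?T x * ?d x = 2 * (xpow (- ?h x) * directional r (?h x) F)" if x: "x \<in> root_pairs r" for x
  proof (rule poly_mapping_eqI)
    fix v
    obtain a b where ab: "x = (a, b)" by force
    have e: "eps a - eps b = wscale 2 (half_root a b)"
      by (simp add: half_root_def wscale_def fun_eq_iff)
    have v: "v - half_root a b + (eps a - eps b) = v + half_root a b"
      by (simp add: half_root_def wscale_def fun_eq_iff field_simps)
    have "coef (?T x * ?d x) v = coef (denom_factor a b * t a b) v"
      unfolding ab fst_conv snd_conv by (simp only: mult.commute)
    also have "\<dots> = of_rat (ip r (v + half_root a b) (eps a - eps b)) * coef F (v + half_root a b)"
      unfolding coef_denom_factor_times using t[OF x[unfolded ab], of "v - half_root a b"] unfolding v .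
    also have "\<dots> = of_rat (2 * ip r (half_root a b) (v + half_root a b)) * coef F (v + half_root a b)"
      unfolding e by (simp only: ip_wscale_right ip_commute)
    also have "\<dots> = coef (2 * (xpow (- ?h x) * directional r (?h x) F)) v"
      unfolding ab fst_conv snd_conv coef_two_times coef_single_times coef_directional
      by (simp only: diff_minus_eq_add of_rat_mult of_rat_numeral_eq mult_1 mult.assoc)
    finally show "coef (?T x * ?d x) v = coef (2 * (xpow (- ?h x) * directional r (?h x) F)) v" .
  qed
  have dir: "directional r w F = (\<Sum>i=1..r. Poly_Mapping.single 0 (of_rat (w i)) * pderivation i F)" for w
    by (rule poly_mapping_eqI)
      (simp add: coef_directional lookup_sum coef_single_0_times coef_pderivation ip_def of_rat_sum
        of_rat_mult sum_distrib_right mult.assoc)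
  have RD: "?R x * ?d x = ?D" if "x \<in> root_pairs r" for x
    unfolding D using prod.remove[OF finite_root_pairs that, of ?d] by (simp only: mult.commute)
  have "(\<Sum>i=1..r. pderivation i ?D * pderivation i F) =
      (\<Sum>i=1..r. \<Sum>x\<in>root_pairs r. ?R x * (xpow (?h x) + xpow (- ?h x)) *
        (Poly_Mapping.single 0 (of_rat (?h x i)) * pderivation i F))"
    unfolding D pderivation_prod[OF finite_root_pairs] pderivation_denom_factor sum_distrib_right
    by (intro sum.cong refl ac1)
  also have "\<dots> = (\<Sum>x\<in>root_pairs r. ?R x * (xpow (?h x) + xpow (- ?h x)) * directional r (?h x) F)"
    unfolding dir sum_distrib_left by (rule sum.swap)
  also have "\<dots> = (\<Sum>x\<in>root_pairs r. ?D * directional r (?h x) F + ?D * ?T x)"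
  proof (intro sum.cong refl)
    fix x assume x: "x \<in> root_pairs r"
    \<comment> \<open>The sum of the two exponentials is the factor itself plus a remainder. The
      factor restores the full denominator, and the remainder is absorbed by
      \<open>Tx\<close>.\<close>
    have "xpow (?h x) + xpow (- ?h x) = ?d x + 2 * xpow (- ?h x)"
      by (simp add: denom_factor_def)
    then have "?R x * (xpow (?h x) + xpow (- ?h x)) * directional r (?h x) F =
        (?R x * ?d x) * directional r (?h x) F + ?R x * (2 * (xpow (- ?h x) * directional r (?h x) F))"
      by (simp only: distrib_left distrib_right mult.assoc)
    also have "\<dots> = ?D * directional r (?h x) F + (?R x * ?d x) * ?T x"
      unfolding Tx[OF x, symmetric] ac2[of "?R x"] RD[OF x] ..
    finally show "?R x * (xpow (?h x) + xpow (- ?h x)) * directional r (?h x) F =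
        ?D * directional r (?h x) F + ?D * ?T x" unfolding RD[OF x] .
  qed
  also have "\<dots> = ?D * ((\<Sum>x\<in>root_pairs r. directional r (?h x) F) + (\<Sum>x\<in>root_pairs r. ?T x))"
    by (simp add: sum.distrib sum_distrib_left distrib_left)
  also have "(\<Sum>x\<in>root_pairs r. directional r (?h x) F) = directional r (weyl_vector r) F"
  proof (rule poly_mapping_eqI)
    fix v
    have "ip r (\<Sum>x\<in>root_pairs r. ?h x) v = (\<Sum>x\<in>root_pairs r. ip r (?h x) v)"
      unfolding ip_def sum_fun_apply sum_distrib_right by (rule sum.swap)
    moreover have "(\<Sum>x\<in>root_pairs r. ?h x) = weyl_vector r"
      using sum_half_roots[of r] by (simp only: case_prod_unfold)
    ultimately show "coef (\<Sum>x\<in>root_pairs r. directional r (?h x) F) v = coef (directional r (weyl_vector r) F) v"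
      by (simp add: lookup_sum coef_directional sum_distrib_right of_rat_sum)
  qed
  finally have grad: "(\<Sum>i=1..r. pderivation i ?D * pderivation i F) =
      ?D * (directional r (weyl_vector r) F + (\<Sum>x\<in>root_pairs r. ?T x))" .
  \<comment> \<open>Here the terms 2(v,\<delta>) of the Casimir eigenvalue are matched by the
    derivative along \<delta>.\<close>
  have eig: "laplacian r F + 2 * (directional r (weyl_vector r) F + (\<Sum>x\<in>root_pairs r. ?T x)) =
      Poly_Mapping.single 0 c * F"
  proof (rule poly_mapping_eqI)
    fix v
    have "2 * (\<Sum>x\<in>root_pairs r. coef (?T x) v) = (c - of_rat (ip r v (v + wscale 2 (weyl_vector r)))) * coef F v"
      using c[of v] by (simp add: case_prod_unfold)
    then show "coef (laplacian r F + 2 * (directional r (weyl_vector r) F + (\<Sum>x\<in>root_pairs r. ?T x))) v =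
        coef (Poly_Mapping.single 0 c * F) v"
      unfolding coef_single_0_times
      by (simp add: coef_two_times lookup_add lookup_sum coef_laplacian coef_directional
          ip_linear ip_commute[of r "weyl_vector r"] of_rat_add of_rat_mult algebra_simps)
  qed
  have "laplacian r (?D * F) = laplacian r ?D * F + ?D * (laplacian r F + 2 * (directional r (weyl_vector r) F + (\<Sum>x\<in>root_pairs r. ?T x)))"
    unfolding laplacian_times grad by (simp only: distrib_left mult.left_commute[of 2] add.assoc)
  also have "\<dots> = Poly_Mapping.single 0 (c + of_rat (ip r (weyl_vector r) (weyl_vector r))) * (?D * F)"
    unfolding eig laplacian_weyl_denom[OF r]
    by (simp only: single_add distrib_right mult.assoc mult.left_commute[of "weyl_denom r"] add.commute)
  finally show ?thesis .
qed

theorem freudenthal_character_formula: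
  assumes r: "1 \<le> r" and \<Lambda>: "\<Lambda> \<in> dominant_weights r" and f: "freudenthal r \<Lambda> f"
  shows "weyl_denom r * f = alt_sum r (\<Lambda> + weyl_vector r)"
proof -
  let ?\<delta> = "weyl_vector r"
  from f have dom: "dominated r \<Lambda> f" "coef f \<Lambda> = 1" and inv: "invariant r f" and lat: "lattice_supp r f"
    by (auto simp: freudenthal_def)
  from f obtain t :: "nat \<Rightarrow> nat \<Rightarrow> weight \<Rightarrow>\<^sub>0 complex" where
    t0: "\<forall>(a, b)\<in>root_pairs r. \<forall>v. coef (t a b) v - coef (t a b) (v + (eps a - eps b)) =
            of_rat (ip r (v + (eps a - eps b)) (eps a - eps b)) * of_int (coef f (v + (eps a - eps b)))"
    and c: "\<forall>v. of_rat (ip r \<Lambda> (\<Lambda> + wscale 2 ?\<delta>) - ip r v (v + wscale 2 ?\<delta>)) *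
              of_int (coef f v) = 2 * (\<Sum>(a, b)\<in>root_pairs r. coef (t a b) v)"
    unfolding freudenthal_def by (elim conjE exE) (rule that)
  have t: "coef (t a b) v - coef (t a b) (v + (eps a - eps b)) =
      of_rat (ip r (v + (eps a - eps b)) (eps a - eps b)) * of_int (coef f (v + (eps a - eps b)))"
    if "(a, b) \<in> root_pairs r" for a b v
    using bspec[OF t0 that] unfolding case_prod_conv by (rule spec)
  have lap: "laplacian r (weyl_denom r * complexify f) =
      Poly_Mapping.single 0 (of_rat (ip r \<Lambda> (\<Lambda> + wscale 2 ?\<delta>)) + of_rat (ip r ?\<delta> ?\<delta>)) * (weyl_denom r * complexify f)"
  proof (rule laplacian_denom_times[OF r])
    show "coef (t a b) v - coef (t a b) (v + (eps a - eps b)) =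
        of_rat (ip r (v + (eps a - eps b)) (eps a - eps b)) * coef (complexify f) (v + (eps a - eps b))"
      if "(a, b) \<in> root_pairs r" for a b v
      unfolding coef_complexify by (rule t[OF that])
    show "(of_rat (ip r \<Lambda> (\<Lambda> + wscale 2 ?\<delta>)) - of_rat (ip r v (v + wscale 2 ?\<delta>))) * coef (complexify f) v =
        2 * (\<Sum>(a, b)\<in>root_pairs r. coef (t a b) v)" for v
      unfolding coef_complexify of_rat_diff[symmetric] using c by (rule spec)
  qed
  have norm: "ip r v v = ip r (\<Lambda> + ?\<delta>) (\<Lambda> + ?\<delta>)" if v: "v \<in> supp (weyl_denom r * f)" for v
  proof -
    have "coef (weyl_denom r * complexify f) v = of_int (coef (weyl_denom r * f) v)"
      by (simp only: coef_complexify[symmetric] complexify_times complexify_weyl_denom[OF r])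
    then have ne: "coef (weyl_denom r * complexify f) v \<noteq> 0" using v by (simp add: in_keys_iff)
    have "of_rat (ip r v v) * coef (weyl_denom r * complexify f) v =
        (of_rat (ip r \<Lambda> (\<Lambda> + wscale 2 ?\<delta>)) + of_rat (ip r ?\<delta> ?\<delta>)) * coef (weyl_denom r * complexify f) v"
      using arg_cong[OF lap, of "\<lambda>g. coef g v"] by (simp only: coef_laplacian coef_single_0_times)
    then have "(of_rat (ip r v v) :: complex) = of_rat (ip r \<Lambda> (\<Lambda> + wscale 2 ?\<delta>) + ip r ?\<delta> ?\<delta>)"
      using ne by (simp add: of_rat_add)
    then have "ip r v v = ip r \<Lambda> (\<Lambda> + wscale 2 ?\<delta>) + ip r ?\<delta> ?\<delta>" by (simp only: of_rat_eq_iff)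
    then show ?thesis using ip_commute[of r \<Lambda> ?\<delta>] by (simp add: ip_linear)
  qed
  have dd: "dominated r (?\<delta> + \<Lambda>) (weyl_denom r * f)" "coef (weyl_denom r * f) (?\<delta> + \<Lambda>) = 1"
    using dominated_times[OF dominated_weyl_denom(1) dom(1)] dominated_weyl_denom(2)[of r, where 'a = int] dom(2)
    by simp_all
  have ld: "lattice_supp r (weyl_denom r * f)"
    by (intro lattice_supp_times lattice_supp_weyl_denom r lat)
  have \<Lambda>\<delta>: "\<Lambda> + ?\<delta> \<in> weight_lattice r" "strictly_dominant r (\<Lambda> + ?\<delta>)"
    using \<Lambda> dominant_add_weyl_vector_iff[OF r] by auto
  have alt: "alternating r (weyl_denom r * f)"
    by (rule alternating_times_invariant[OF alternating_weyl_denom inv])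
  have "weyl_denom r * f = (\<Sum>v\<in>{\<Lambda> + ?\<delta>}. Poly_Mapping.single 0 (coef (weyl_denom r * f) v) * alt_sum r v)"
  proof (rule alternating_expansion[OF alt])
    fix v assume v: "v \<in> supp (weyl_denom r * f)" "strictly_dominant r v"
    have vl: "v \<in> weight_lattice r" using ld v(1) by (auto simp: lattice_supp_def)
    \<comment> \<open>All exponents have the same norm and lie below \<Lambda> + \<delta>, so the
      open chamber contains no other one.\<close>
    have "v = \<Lambda> + ?\<delta>"
    proof (rule ip_dominated_eq[OF _ _ _ _ _ v(2) \<Lambda>\<delta>(2) norm[OF v(1)]])
      show "supported r v" "psum r v = 0" using vl weight_lattice_iff[OF r] by blast+
      show "supported r (\<Lambda> + ?\<delta>)" "psum r (\<Lambda> + ?\<delta>) = 0" using \<Lambda>\<delta>(1) weight_lattice_iff[OF r] by blast+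
      show "psum k v \<le> psum k (\<Lambda> + ?\<delta>)" if "k \<in> {1..r}" for k
        using dd(1) v(1) that unfolding dominated_def add.commute[of ?\<delta>] by blast
    qed
    then show "v \<in> {\<Lambda> + ?\<delta>}" by simp
  qed (use \<Lambda>\<delta> in auto)
  then show ?thesis using dd(2) by (simp add: add.commute)
qed

text \<open>The positive roots add up to 2\<delta>. Since \<kappa> is an arbitrary coordinate
  function, the identity also serves for the shifted coordinates of symmetric powers.\<close>

lemma weyl_vector_pairs:
  "(\<Sum>(a, b)\<in>root_pairs r. \<kappa> a - \<kappa> b) = 2 * ip r \<kappa> (weyl_vector r)"
proof -
  have "2 * ip r \<kappa> (weyl_vector r) = 2 * (\<Sum>i=1..r. \<Sum>x\<in>root_pairs r. \<kappa> i * half_root (fst x) (snd x) i)"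
    unfolding sum_half_roots[symmetric] ip_def sum_fun_apply by (simp only: case_prod_unfold sum_distrib_left)
  also have "\<dots> = (\<Sum>x\<in>root_pairs r. 2 * ip r \<kappa> (half_root (fst x) (snd x)))"
    unfolding ip_def sum_distrib_left by (rule sum.swap)
  also have "\<dots> = (\<Sum>(a, b)\<in>root_pairs r. \<kappa> a - \<kappa> b)"
    by (intro sum.cong refl)
      (auto simp: half_root_def ip_linear ip_eps_right root_pairs_def)
  finally show ?thesis by simp
qed

lemma sum_square_split:
  fixes f :: "nat \<Rightarrow> nat \<Rightarrow> 'b::comm_monoid_add"
  shows "(\<Sum>a=1..r. \<Sum>b=1..r. f a b) = (\<Sum>a=1..r. f a a) + (\<Sum>(a, b)\<in>root_pairs r. f a b + f b a)"
proof -
  let ?D = "(\<lambda>a. (a, a)) ` {1..r}" and ?S = "(\<lambda>(a, b). (b, a)) ` root_pairs r"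
  have *: "{1..r} \<times> {1..r} = ?D \<union> (root_pairs r \<union> ?S)"
    by (auto simp: root_pairs_def image_iff)
  have "(\<Sum>a=1..r. \<Sum>b=1..r. f a b) = (\<Sum>x\<in>{1..r} \<times> {1..r}. f (fst x) (snd x))"
    by (simp add: sum.cartesian_product case_prod_unfold)
  also have "\<dots> = (\<Sum>x\<in>?D. f (fst x) (snd x)) + ((\<Sum>x\<in>root_pairs r. f (fst x) (snd x)) + (\<Sum>x\<in>?S. f (fst x) (snd x)))"
    unfolding * by (subst sum.union_disjoint, simp, simp, force simp: root_pairs_def,
        subst sum.union_disjoint, simp, simp, force simp: root_pairs_def, rule refl)
  also have "(\<Sum>x\<in>?D. f (fst x) (snd x)) = (\<Sum>a=1..r. f a a)"
    by (subst sum.reindex) (auto simp: inj_on_def)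
  also have "(\<Sum>x\<in>?S. f (fst x) (snd x)) = (\<Sum>x\<in>root_pairs r. f (snd x) (fst x))"
    by (subst sum.reindex) (auto simp: inj_on_def case_prod_unfold)
  finally show ?thesis by (simp add: sum.distrib case_prod_unfold)
qed

section \<open>Highest weight modules\<close>

subsection \<open>Traces\<close>

locale trace_space = vector_space scale
  for scale :: "'a::field \<Rightarrow> 'b::ab_group_add \<Rightarrow> 'b"
begin

definition trace_on :: "'b set \<Rightarrow> ('b \<Rightarrow> 'b) \<Rightarrow> 'a" where
  "trace_on B T = (\<Sum>b\<in>B. representation B (T b) b)"

lemma trace_on_cong: "(\<And>b. b \<in> B \<Longrightarrow> T b = T' b) \<Longrightarrow> trace_on B T = trace_on B T'"
  by (simp add: trace_on_def)

lemma trace_on_add: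
  assumes "independent B" "\<And>b. b \<in> B \<Longrightarrow> T b \<in> span B" "\<And>b. b \<in> B \<Longrightarrow> T' b \<in> span B"
  shows "trace_on B (\<lambda>b. T b + T' b) = trace_on B T + trace_on B T'"
  using assms by (simp add: trace_on_def representation_add sum.distrib)

lemma trace_on_scale:
  assumes "independent B" "\<And>b. b \<in> B \<Longrightarrow> T b \<in> span B"
  shows "trace_on B (\<lambda>b. scale c (T b)) = c * trace_on B T"
  using assms by (simp add: trace_on_def representation_scale sum_distrib_left)

lemma trace_on_sum:
  assumes "independent B" "\<And>i b. i \<in> I \<Longrightarrow> b \<in> B \<Longrightarrow> T i b \<in> span B"
  shows "trace_on B (\<lambda>b. \<Sum>i\<in>I. T i b) = (\<Sum>i\<in>I. trace_on B (T i))"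
proof -
  have "trace_on B (\<lambda>b. \<Sum>i\<in>I. T i b) = (\<Sum>b\<in>B. \<Sum>i\<in>I. representation B (T i b) b)"
    unfolding trace_on_def using assms by (intro sum.cong refl) (simp add: representation_sum)
  then show ?thesis unfolding trace_on_def by (subst sum.swap)
qed

lemma trace_on_scalar:
  assumes "independent B"
  shows "trace_on B (\<lambda>b. scale c b) = c * of_nat (card B)"
proof -
  have "trace_on B (\<lambda>b. scale c b) = c * trace_on B (\<lambda>b. b)"
    by (rule trace_on_scale[OF assms]) (rule span_base)
  also have "trace_on B (\<lambda>b. b) = (\<Sum>b\<in>B. 1)"
    unfolding trace_on_def by (intro sum.cong refl) (simp add: representation_basis[OF assms])
  finally show ?thesis by simp
qed

text \<open>Both sides are the same double sum of products of matrix entries. Two different bases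
  are needed because the maps go between neighbouring weight spaces.\<close>

lemma trace_on_swap:
  assumes B: "independent B" "finite B" and C: "independent C" "finite C"
    and T: "\<And>b. b \<in> B \<Longrightarrow> T b \<in> span C" and U: "\<And>c. c \<in> C \<Longrightarrow> U c \<in> span B"
    and linT: "module_hom scale scale T" and linU: "module_hom scale scale U"
  shows "trace_on B (\<lambda>b. U (T b)) = trace_on C (\<lambda>c. T (U c))"
proof -
  have expand: "trace_on B (\<lambda>b. U (T b)) = (\<Sum>b\<in>B. \<Sum>c\<in>C. representation C (T b) c * representation B (U c) b)"
    if B: "independent B" "finite B" and C: "independent C" "finite C"
      and T: "\<And>b. b \<in> B \<Longrightarrow> T b \<in> span C" and U: "\<And>c. c \<in> C \<Longrightarrow> U c \<in> span B"
      and linU: "module_hom scale scale U" for B C T U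
    unfolding trace_on_def
  proof (intro sum.cong refl)
    fix b assume b: "b \<in> B"
    have "T b = (\<Sum>c\<in>C. scale (representation C (T b) c) c)"
      by (rule sum_representation_eq[symmetric]) (use B C T b in auto)
    then have "U (T b) = U (\<Sum>c\<in>C. scale (representation C (T b) c) c)" by (rule arg_cong)
    also have "\<dots> = (\<Sum>c\<in>C. scale (representation C (T b) c) (U c))"
      unfolding module_hom.sum[OF linU] module_hom.scale[OF linU] ..
    finally have U_eq: "U (T b) = (\<Sum>c\<in>C. scale (representation C (T b) c) (U c))" .
    show "representation B (U (T b)) b = (\<Sum>c\<in>C. representation C (T b) c * representation B (U c) b)"
      unfolding U_eq using B U by (simp add: representation_sum representation_scale span_scale)
  qed
  have "trace_on B (\<lambda>b. U (T b)) = (\<Sum>b\<in>B. \<Sum>c\<in>C. representation C (T b) c * representation B (U c) b)"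
    by (rule expand[OF B C T U linU])
  also have "\<dots> = (\<Sum>c\<in>C. \<Sum>b\<in>B. representation B (U c) b * representation C (T b) c)"
    by (subst sum.swap) (simp only: mult.commute)
  also have "\<dots> = trace_on C (\<lambda>c. T (U c))"
    by (rule expand[OF C B U T linT, symmetric])
  finally show ?thesis .
qed

text \<open>A module constrains its action on the carrier subspace only. Extending it linearly to
  the ambient space gives homomorphisms that can be applied without membership side
  conditions.\<close>

lemma linear_extension:
  assumes V: "subspace V" and add: "\<And>v w. v \<in> V \<Longrightarrow> w \<in> V \<Longrightarrow> f (v + w) = f v + f w"
    and scale: "\<And>c v. v \<in> V \<Longrightarrow> f (scale c v) = scale c (f v)"
  shows "\<exists>T. module_hom scale scale T \<and> (\<forall>v\<in>V. T v = f v)"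
proof -
  interpret p: vector_space_pair scale scale by unfold_locales
  obtain B where B: "B \<subseteq> V" "independent B" "V \<subseteq> span B" by (rule maximal_independent_subset)
  let ?T = "p.construct B f"
  have T: "module_hom scale scale ?T"
    using p.linear_construct[OF B(2)] unfolding linear_iff_module_hom .
  have "v \<in> V \<and> ?T v = f v" if "v \<in> span B" for v
    using that
  proof (induction v rule: span_induct_alt)
    case base
    have "f 0 = 0" using scale[of 0 0] subspace_0[OF V] by simp
    then show ?case using module_hom.zero[OF T] subspace_0[OF V] by simp
  next
    case (step c x y)
    then have "x \<in> V" "y \<in> V" using B(1) by auto
    then show ?case
      using step module_hom.add[OF T] module_hom.scale[OF T] p.construct_basis[OF B(2)]
      by (simp add: add scale subspace_scale[OF V] subspace_add[OF V])
  qed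
  then show ?thesis using T B(3) by blast
qed

end

subsection \<open>Weight spaces\<close>

text \<open>The relations are those of the matrix units of gl_r. The trace-free projections of the
  matrix units satisfy them as well, so one uniform indexing covers the Cartan, raising and lowering
  operators of an sl_r-module.\<close>

locale sl_operators = trace_space scale
  for scale :: "complex \<Rightarrow> 'v::ab_group_add \<Rightarrow> 'v" (infixr "\<star>" 75) +
  fixes r :: nat and V :: "'v set" and E :: "nat \<Rightarrow> nat \<Rightarrow> 'v \<Rightarrow> 'v"
  assumes r_pos: "1 \<le> r"
    and subspace_V: "subspace V"
    and finite_V: "\<exists>B. finite B \<and> V = span B"
    and E_hom: "a \<in> {1..r} \<Longrightarrow> b \<in> {1..r} \<Longrightarrow> module_hom scale scale (E a b)"
    and E_in: "a \<in> {1..r} \<Longrightarrow> b \<in> {1..r} \<Longrightarrow> v \<in> V \<Longrightarrow> E a b v \<in> V"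
    and E_comm: "a \<in> {1..r} \<Longrightarrow> b \<in> {1..r} \<Longrightarrow> c \<in> {1..r} \<Longrightarrow> d \<in> {1..r} \<Longrightarrow> v \<in> V \<Longrightarrow>
      E c d (E a b v) - E a b (E c d v) =
        (if d = a then E c b v else 0) - (if b = c then E a d v else 0)"
begin

lemma E_add: "a \<in> {1..r} \<Longrightarrow> b \<in> {1..r} \<Longrightarrow> E a b (v + w) = E a b v + E a b w"
  by (rule module_hom.add[OF E_hom])

lemma E_diff: "a \<in> {1..r} \<Longrightarrow> b \<in> {1..r} \<Longrightarrow> E a b (v - w) = E a b v - E a b w"
  by (rule module_hom.diff[OF E_hom])

lemma E_scale: "a \<in> {1..r} \<Longrightarrow> b \<in> {1..r} \<Longrightarrow> E a b (c \<star> v) = c \<star> E a b v"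
  by (rule module_hom.scale[OF E_hom])

lemma E_zero: "a \<in> {1..r} \<Longrightarrow> b \<in> {1..r} \<Longrightarrow> E a b 0 = 0"
  by (rule module_hom.zero[OF E_hom])

lemma E_sum: "a \<in> {1..r} \<Longrightarrow> b \<in> {1..r} \<Longrightarrow> E a b (\<Sum>i\<in>I. f i) = (\<Sum>i\<in>I. E a b (f i))"
  by (rule module_hom.sum[OF E_hom])

definition wsp :: "weight \<Rightarrow> 'v set" where
  "wsp \<kappa> = {v \<in> V. \<forall>a\<in>{1..r}. E a a v = of_rat (\<kappa> a) \<star> v}"

lemma wsp_in_V: "v \<in> wsp \<kappa> \<Longrightarrow> v \<in> V"
  by (simp add: wsp_def)

lemma subspace_wsp: "subspace (wsp \<kappa>)"
proof (rule subspaceI)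
  show "0 \<in> wsp \<kappa>"
    unfolding wsp_def using subspace_0[OF subspace_V] by (simp add: E_zero)
  show "v + w \<in> wsp \<kappa>" if "v \<in> wsp \<kappa>" "w \<in> wsp \<kappa>" for v w
    using that subspace_add[OF subspace_V, of v w] unfolding wsp_def
    by (simp add: E_add scale_right_distrib)
  show "c \<star> v \<in> wsp \<kappa>" if "v \<in> wsp \<kappa>" for c v
    using that subspace_scale[OF subspace_V, of v c] unfolding wsp_def
    by (simp add: E_scale mult.commute)
qed

lemma E_wsp:
  assumes v: "v \<in> wsp \<kappa>" and c: "c \<in> {1..r}" and d: "d \<in> {1..r}"
  shows "E c d v \<in> wsp (\<kappa> + (eps c - eps d))"
  unfolding wsp_def
proof (intro CollectI conjI ballI)
  show "E c d v \<in> V" by (intro E_in c d wsp_in_V[OF v])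
  fix a assume a: "a \<in> {1..r}"
  have "E a a (E c d v) = E c d (E a a v) + ((if a = c then E a d v else 0) - (if d = a then E c a v else 0))"
    using E_comm[OF c d a a wsp_in_V[OF v]] by (simp add: algebra_simps)
  also have "E a a v = of_rat (\<kappa> a) \<star> v" using v a by (simp add: wsp_def)
  finally show "E a a (E c d v) = of_rat ((\<kappa> + (eps c - eps d)) a) \<star> E c d v"
    unfolding E_scale[OF c d] plus_fun_apply minus_apply eps_def of_rat_add of_rat_diff
      scale_left_distrib scale_left_diff_distrib
    by (cases "a = c"; cases "a = d") simp_all
qed

lemma wsp_independent:
  assumes "finite F" "\<And>\<kappa>. \<kappa> \<in> F \<Longrightarrow> supported r \<kappa>" "\<And>\<kappa>. \<kappa> \<in> F \<Longrightarrow> x \<kappa> \<in> wsp \<kappa>"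
    "(\<Sum>\<kappa>\<in>F. x \<kappa>) = 0"
  shows "\<forall>\<kappa>\<in>F. x \<kappa> = 0"
  using assms
proof (induction F arbitrary: x rule: finite_induct)
  case (insert \<mu> F)
  have xF: "x \<kappa> = 0" if \<kappa>: "\<kappa> \<in> F" for \<kappa>
  proof -
    have "\<kappa> \<noteq> \<mu>" using \<kappa> insert.hyps by auto
    then obtain a where a: "a \<in> {1..r}" "\<kappa> a \<noteq> \<mu> a"
      using supported_eqI[of r \<kappa> \<mu>] insert.prems(1) \<kappa> by blast
    \<comment> \<open>Subtracting the eigenvalue of the new weight from \<open>E a a\<close> kills
      its term and rescales the others, with nonzero factor at the weight under consideration; the
      induction hypothesis applies to the rescaled family.\<close>
    have "(\<Sum>\<kappa>\<in>insert \<mu> F. of_rat (\<kappa> a - \<mu> a) \<star> x \<kappa>) =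
        E a a (\<Sum>\<kappa>\<in>insert \<mu> F. x \<kappa>) - of_rat (\<mu> a) \<star> (\<Sum>\<kappa>\<in>insert \<mu> F. x \<kappa>)"
      unfolding E_sum[OF a(1) a(1)] scale_sum_right sum_subtractf[symmetric]
    proof (intro sum.cong refl)
      fix \<nu> assume "\<nu> \<in> insert \<mu> F"
      then have "E a a (x \<nu>) = of_rat (\<nu> a) \<star> x \<nu>"
        using insert.prems(2)[of \<nu>] a by (simp add: wsp_def)
      then show "of_rat (\<nu> a - \<mu> a) \<star> x \<nu> = E a a (x \<nu>) - of_rat (\<mu> a) \<star> x \<nu>"
        by (simp add: of_rat_diff scale_left_diff_distrib)
    qed
    also have "\<dots> = 0" using insert.prems(3) E_zero[OF a(1) a(1)] by simp
    finally have "(\<Sum>\<kappa>\<in>F. of_rat (\<kappa> a - \<mu> a) \<star> x \<kappa>) = 0"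
      using insert.hyps by simp
    then have "\<forall>\<kappa>\<in>F. of_rat (\<kappa> a - \<mu> a) \<star> x \<kappa> = 0"
      using insert.prems(1,2) subspace_scale[OF subspace_wsp]
      by (intro insert.IH) auto
    then show ?thesis using \<kappa> a(2) by (auto simp: scale_eq_0_iff)
  qed
  then have "x \<mu> = 0" using insert.prems(3) insert.hyps by simp
  then show ?case using xF by simp
qed simp

definition casimir :: "'v \<Rightarrow> 'v" where
  "casimir v = (\<Sum>a=1..r. \<Sum>b=1..r. E a b (E b a v))"

text \<open>The commutator with one summand has four terms, each with a contracted index. After
  contraction the sums are equal in pairs with opposite signs.\<close>

lemma casimir_comm:
  assumes c: "c \<in> {1..r}" and d: "d \<in> {1..r}" and v: "v \<in> V"
  shows "E c d (casimir v) = casimir (E c d v)"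
proof -
  have commutator: "E c d (E a b (E b a v)) - E a b (E b a (E c d v)) =
      ((if d = a then E c b (E b a v) else 0) - (if b = c then E a d (E b a v) else 0)) +
      ((if d = b then E a b (E c a v) else 0) - (if a = c then E a b (E b d v) else 0))"
    if a: "a \<in> {1..r}" and b: "b \<in> {1..r}" for a b
  proof -
    have "E c d (E a b (E b a v)) - E a b (E b a (E c d v)) =
        (E c d (E a b (E b a v)) - E a b (E c d (E b a v))) + E a b (E c d (E b a v) - E b a (E c d v))"
      by (simp add: E_diff[OF a b])
    also have "\<dots> = ((if d = a then E c b (E b a v) else 0) - (if b = c then E a d (E b a v) else 0)) +
      E a b ((if d = b then E c a v else 0) - (if a = c then E b d v else 0))"
      using E_comm[OF a b c d E_in[OF b a v]] E_comm[OF b a c d v] by simp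
    also have "E a b ((if d = b then E c a v else 0) - (if a = c then E b d v else 0)) =
        (if d = b then E a b (E c a v) else 0) - (if a = c then E a b (E b d v) else 0)"
      unfolding E_diff[OF a b] by (simp only: if_distrib[of "E a b"] E_zero[OF a b])
    finally show ?thesis .
  qed
  have "E c d (casimir v) - casimir (E c d v) =
      (\<Sum>a=1..r. \<Sum>b=1..r. E c d (E a b (E b a v)) - E a b (E b a (E c d v)))"
    unfolding casimir_def E_sum[OF c d] sum_subtractf ..
  also have "\<dots> = (\<Sum>a=1..r. \<Sum>b=1..r.
      ((if d = a then E c b (E b a v) else 0) - (if b = c then E a d (E b a v) else 0)) +
      ((if d = b then E a b (E c a v) else 0) - (if a = c then E a b (E b d v) else 0)))"
    by (intro sum.cong refl commutator)
  also have "\<dots> = (\<Sum>a=1..r. \<Sum>b=1..r. if d = a then E c b (E b a v) else 0)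
      - (\<Sum>a=1..r. \<Sum>b=1..r. if b = c then E a d (E b a v) else 0)
      + ((\<Sum>a=1..r. \<Sum>b=1..r. if d = b then E a b (E c a v) else 0)
      - (\<Sum>a=1..r. \<Sum>b=1..r. if a = c then E a b (E b d v) else 0))"
    by (simp only: sum.distrib sum_subtractf)
  also have "(\<Sum>a=1..r. \<Sum>b=1..r. if d = a then E c b (E b a v) else 0) = (\<Sum>b=1..r. E c b (E b d v))"
    using d by (subst sum.swap) simp
  also have "(\<Sum>a=1..r. \<Sum>b=1..r. if a = c then E a b (E b d v) else 0) = (\<Sum>b=1..r. E c b (E b d v))"
    using c by (subst sum.swap) simp
  also have "(\<Sum>a=1..r. \<Sum>b=1..r. if b = c then E a d (E b a v) else 0) = (\<Sum>a=1..r. E a d (E c a v))"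
    using c by simp
  also have "(\<Sum>a=1..r. \<Sum>b=1..r. if d = b then E a b (E c a v) else 0) = (\<Sum>a=1..r. E a d (E c a v))"
    using d by simp
  finally show ?thesis by simp
qed

text \<open>Raising operators are moved to the right. Each exchange costs the scalar \<kappa>_a -
  \<kappa>_b, and over the positive roots these scalars add up to 2(\<kappa>,\<delta>).\<close>

lemma casimir_wsp:
  assumes v: "v \<in> wsp \<kappa>"
  shows "casimir v = of_rat (ip r \<kappa> (\<kappa> + wscale 2 (weyl_vector r))) \<star> v +
    2 \<star> (\<Sum>(a, b)\<in>root_pairs r. E b a (E a b v))"
proof -
  have wt: "E a a v = of_rat (\<kappa> a) \<star> v" if "a \<in> {1..r}" for a
    using v that by (simp add: wsp_def)
  have "(\<Sum>a=1..r. E a a (E a a v)) = (\<Sum>a=1..r. of_rat (\<kappa> a * \<kappa> a) \<star> v)"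
    by (intro sum.cong refl) (simp add: wt E_scale of_rat_mult)
  then have diag: "(\<Sum>a=1..r. E a a (E a a v)) = of_rat (ip r \<kappa> \<kappa>) \<star> v"
    by (simp add: ip_def of_rat_sum scale_sum_left)
  have "(\<Sum>(a, b)\<in>root_pairs r. E a b (E b a v) + E b a (E a b v)) =
      (\<Sum>x\<in>root_pairs r. of_rat (\<kappa> (fst x) - \<kappa> (snd x)) \<star> v + 2 \<star> E (snd x) (fst x) (E (fst x) (snd x) v))"
  proof (intro sum.cong refl)
    fix x assume "x \<in> root_pairs r"
    then obtain a b where x: "x = (a, b)" "a \<in> {1..r}" "b \<in> {1..r}" "a < b" by (auto simp: root_pairs_def)
    have "E a b (E b a v) - E b a (E a b v) = of_rat (\<kappa> a - \<kappa> b) \<star> v"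
      using E_comm[OF x(3,2,2,3) wsp_in_V[OF v]] x wt
      by (simp add: of_rat_diff scale_left_diff_distrib)
    moreover have "2 \<star> E b a (E a b v) = E b a (E a b v) + E b a (E a b v)"
      using scale_left_distrib[of 1 1 "E b a (E a b v)"] by simp
    ultimately show "(case x of (a, b) \<Rightarrow> E a b (E b a v) + E b a (E a b v)) =
        of_rat (\<kappa> (fst x) - \<kappa> (snd x)) \<star> v + 2 \<star> E (snd x) (fst x) (E (fst x) (snd x) v)"
      by (simp add: x(1) algebra_simps)
  qed
  also have "\<dots> = (\<Sum>x\<in>root_pairs r. of_rat (\<kappa> (fst x) - \<kappa> (snd x)) \<star> v) +
      2 \<star> (\<Sum>(a, b)\<in>root_pairs r. E b a (E a b v))"
    by (simp add: sum.distrib scale_sum_right case_prod_unfold)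
  also have "(\<Sum>x\<in>root_pairs r. of_rat (\<kappa> (fst x) - \<kappa> (snd x)) \<star> v) = of_rat (2 * ip r \<kappa> (weyl_vector r)) \<star> v"
    unfolding weyl_vector_pairs[symmetric] by (simp add: of_rat_sum scale_sum_left case_prod_unfold)
  finally show ?thesis
    unfolding casimir_def sum_square_split diag
    by (simp add: ip_linear of_rat_add scale_left_distrib add.assoc)
qed

subsection \<open>Reflection symmetry\<close>

lemma E_power_wsp:
  assumes "a \<in> {1..r}" "b \<in> {1..r}" "v \<in> wsp \<kappa>"
  shows "(E b a ^^ n) v \<in> wsp (\<kappa> - wscale (of_nat n) (eps a - eps b))"
proof (induction n)
  case 0
  have e: "\<kappa> - wscale (of_nat 0) (eps a - eps b) = \<kappa>" by (simp add: wscale_def fun_eq_iff)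
  show ?case unfolding e using assms(3) by simp
next
  case (Suc n)
  have e: "\<kappa> - wscale (of_nat n) (eps a - eps b) + (eps b - eps a) = \<kappa> - wscale (of_nat (Suc n)) (eps a - eps b)"
    by (simp add: wscale_def fun_eq_iff algebra_simps)
  show ?case using E_wsp[OF Suc assms(2,1)] unfolding e by (simp only: funpow.simps o_apply)
qed

text \<open>This is the sl_2 string identity. Passing the i-th lowering operator contributes
  \<kappa>_a - \<kappa>_b - 2i, and these numbers for i = 0, ..., n sum to (n+1)(\<kappa>_a -
  \<kappa>_b - n).\<close>

lemma E_power_comm:
  assumes ab: "a \<in> {1..r}" "b \<in> {1..r}" "a \<noteq> b" and v: "v \<in> wsp \<kappa>"
  shows "E a b ((E b a ^^ Suc n) v) =
    (E b a ^^ Suc n) (E a b v) + (of_nat (Suc n) * (of_rat (\<kappa> a - \<kappa> b) - of_nat n)) \<star> (E b a ^^ n) v"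
proof (induction n)
  case 0
  have "E a b (E b a v) - E b a (E a b v) = of_rat (\<kappa> a - \<kappa> b) \<star> v"
    using E_comm[OF ab(2,1,1,2) wsp_in_V[OF v]] v ab
    by (simp add: wsp_def of_rat_diff scale_left_diff_distrib)
  then show ?case by (simp add: algebra_simps)
next
  case (Suc n)
  let ?w = "(E b a ^^ Suc n) v"
  have w: "?w \<in> wsp (\<kappa> - wscale (of_nat (Suc n)) (eps a - eps b))" (is "_ \<in> wsp ?\<mu>")
    by (rule E_power_wsp[OF ab(1,2) v])
  have "?\<mu> a - ?\<mu> b = \<kappa> a - \<kappa> b - 2 * of_nat (Suc n)"
    using ab(3) by (simp add: wscale_def eps_def algebra_simps)
  then have \<mu>: "of_rat (?\<mu> a - ?\<mu> b) = (of_rat (\<kappa> a - \<kappa> b) - 2 * of_nat (Suc n) :: complex)"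
    by (simp only: of_rat_diff of_rat_mult of_rat_of_nat_eq of_rat_numeral_eq)
  have wt: "E a a ?w = of_rat (?\<mu> a) \<star> ?w" "E b b ?w = of_rat (?\<mu> b) \<star> ?w"
    using w ab unfolding wsp_def by blast+
  have "E a b (E b a ?w) - E b a (E a b ?w) = E a a ?w - E b b ?w"
    using E_comm[OF ab(2,1,1,2) wsp_in_V[OF w]] by (simp only: if_True simp_thms)
  then have "E a b (E b a ?w) = E b a (E a b ?w) + of_rat (?\<mu> a - ?\<mu> b) \<star> ?w"
    unfolding wt of_rat_diff scale_left_diff_distrib by (simp only: diff_eq_eq add.commute)
  also have "E b a (E a b ?w) = (E b a ^^ Suc (Suc n)) (E a b v) +
      (of_nat (Suc n) * (of_rat (\<kappa> a - \<kappa> b) - of_nat n)) \<star> ?w"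
    unfolding Suc E_add[OF ab(2,1)] E_scale[OF ab(2,1)] by simp
  also have "\<dots> + of_rat (?\<mu> a - ?\<mu> b) \<star> ?w = (E b a ^^ Suc (Suc n)) (E a b v) +
      (of_nat (Suc n) * (of_rat (\<kappa> a - \<kappa> b) - of_nat n) + of_rat (?\<mu> a - ?\<mu> b)) \<star> ?w"
    by (simp only: scale_left_distrib add.assoc)
  also have "of_nat (Suc n) * (of_rat (\<kappa> a - \<kappa> b) - of_nat n) + of_rat (?\<mu> a - ?\<mu> b) =
      (of_nat (Suc (Suc n)) * (of_rat (\<kappa> a - \<kappa> b) - of_nat (Suc n)) :: complex)"
    unfolding \<mu> by (simp add: algebra_simps)
  finally show ?case by simp
qed

text \<open>Applying \<open>E\<^bsub>a b\<^esub>\<close> to \<open>E\<^bsub>b a\<^esub>\<^sup>n v = 0\<close> moves the problem one step up the weight string, which is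
  finite.\<close>

lemma E_power_injective:
  assumes ab: "a \<in> {1..r}" "b \<in> {1..r}" "a \<noteq> b"
    and bound: "\<And>k. N \<le> k \<Longrightarrow> wsp (\<kappa> + wscale (of_nat k) (eps a - eps b)) \<subseteq> {0}"
    and v: "v \<in> wsp \<kappa>" and n: "of_nat n \<le> \<kappa> a - \<kappa> b" and zero: "(E b a ^^ n) v = 0"
  shows "v = 0"
  using bound v n zero
proof (induction N arbitrary: \<kappa> v n)
  case 0
  have e: "\<kappa> + wscale (of_nat 0) (eps a - eps b) = \<kappa>" by (simp add: wscale_def fun_eq_iff)
  show ?case using 0(1)[of 0, unfolded e] 0(2) by auto
next
  case (Suc N)
  note up = Suc.IH and bnd = Suc.prems(1)
  show ?case
    using Suc.prems(2-4)
  proof (induction n)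
    case (Suc n)
    let ?\<mu> = "\<kappa> + (eps a - eps b)"
    have ev: "E a b v \<in> wsp ?\<mu>" by (rule E_wsp[OF Suc.prems(1) ab(1,2)])
    have lin: "(E b a ^^ n) (c \<star> w) = c \<star> (E b a ^^ n) w" for n c w
      by (induction n) (simp_all add: E_scale[OF ab(2,1)])
    have c: "(E b a ^^ Suc n) (E a b v) + (of_nat (Suc n) * (of_rat (\<kappa> a - \<kappa> b) - of_nat n)) \<star> (E b a ^^ n) v = 0"
      using E_power_comm[OF ab Suc.prems(1), of n] Suc.prems(3) E_zero[OF ab(1,2)] by simp
    \<comment> \<open>One further lowering operator turns the second summand into a multiple of the
      vector assumed to vanish. What is left is a vanishing power of the raised vector; the exponent
      has grown by 1, but the weight difference by 2, so the hypothesis on the exponent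
      survives.\<close>
    then have "E b a ((E b a ^^ Suc n) (E a b v) + (of_nat (Suc n) * (of_rat (\<kappa> a - \<kappa> b) - of_nat n)) \<star> (E b a ^^ n) v) = 0"
      using E_zero[OF ab(2,1)] by simp
    then have "(E b a ^^ Suc (Suc n)) (E a b v) + (of_nat (Suc n) * (of_rat (\<kappa> a - \<kappa> b) - of_nat n)) \<star> (E b a ^^ Suc n) v = 0"
      unfolding E_add[OF ab(2,1)] E_scale[OF ab(2,1)] by simp
    then have e0: "(E b a ^^ Suc (Suc n)) (E a b v) = 0" using Suc.prems(3) by simp
    have ev0: "E a b v = 0"
    proof (rule up[OF _ ev _ e0])
      fix k assume k: "N \<le> k"
      have e: "?\<mu> + wscale (of_nat k) (eps a - eps b) = \<kappa> + wscale (of_nat (Suc k)) (eps a - eps b)"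
        by (simp add: wscale_def fun_eq_iff algebra_simps)
      show "wsp (?\<mu> + wscale (of_nat k) (eps a - eps b)) \<subseteq> {0}"
        unfolding e by (rule bnd) (use k in simp)
    next
      show "of_nat (Suc (Suc n)) \<le> ?\<mu> a - ?\<mu> b"
        using Suc.prems(2) ab(3) by (simp add: eps_def)
    qed
    have z: "(E b a ^^ m) 0 = 0" for m by (induction m) (simp_all add: E_zero[OF ab(2,1)])
    have "(of_nat (Suc n) * (of_rat (\<kappa> a - \<kappa> b) - of_nat n)) \<star> (E b a ^^ n) v = 0"
      using c unfolding ev0 z by (simp only: add_0)
    moreover have "(of_nat (Suc n) * (of_rat (\<kappa> a - \<kappa> b) - of_nat n) :: complex) \<noteq> 0"
    proof -
      have "\<kappa> a - \<kappa> b \<noteq> of_nat n" using Suc.prems(2) by auto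
      then have "of_rat (\<kappa> a - \<kappa> b) \<noteq> (of_rat (of_nat n) :: complex)" by (simp only: of_rat_eq_iff not_False_eq_True)
      then show ?thesis by (simp del: of_nat_Suc)
    qed
    ultimately have "(E b a ^^ n) v = 0" unfolding scale_eq_0_iff by blast
    then show ?case using Suc.IH Suc.prems by simp
  qed simp
qed

end

subsection \<open>Irreducible modules\<close>

locale highest_weight = sl_operators scale r V E
  for scale :: "complex \<Rightarrow> 'v::ab_group_add \<Rightarrow> 'v" (infixr "\<star>" 75)
    and r :: nat and V :: "'v set" and E :: "nat \<Rightarrow> nat \<Rightarrow> 'v \<Rightarrow> 'v" +
  fixes \<Lambda> :: weight and u :: 'v
  assumes \<Lambda>: "\<Lambda> \<in> weight_lattice r"
    and u: "u \<in> wsp \<Lambda>" "u \<noteq> 0"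
    and raise: "(a, b) \<in> root_pairs r \<Longrightarrow> E a b u = 0"
    and irreducible: "subspace W \<Longrightarrow> W \<subseteq> V \<Longrightarrow>
      (\<And>a b v. a \<in> {1..r} \<Longrightarrow> b \<in> {1..r} \<Longrightarrow> v \<in> W \<Longrightarrow> E a b v \<in> W) \<Longrightarrow> W = {0} \<or> W = V"
begin

text \<open>A relation between vectors and weights rather than a weight function, since a word may
  produce the zero vector, which has no weight of its own.\<close>

inductive lowering :: "'v \<Rightarrow> weight \<Rightarrow> bool" where
  base: "lowering u \<Lambda>"
| step: "lowering v \<kappa> \<Longrightarrow> (a, b) \<in> root_pairs r \<Longrightarrow> lowering (E b a v) (\<kappa> + (eps b - eps a))"

lemma lowering_wsp: "lowering v \<kappa> \<Longrightarrow> v \<in> wsp \<kappa>"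
proof (induction rule: lowering.induct)
  case (step v \<kappa> a b)
  then show ?case by (intro E_wsp) (auto simp: root_pairs_def)
qed (rule u(1))

lemma lowering_weight_lattice: "lowering v \<kappa> \<Longrightarrow> \<kappa> \<in> weight_lattice r"
proof (induction rule: lowering.induct)
  case (step v \<kappa> a b)
  then show ?case
    by (intro weight_lattice_add r_pos eps_diff_in_weight_lattice) (auto simp: root_pairs_def)
qed (rule \<Lambda>)

lemma psum_lowering_step:
  "(a, b) \<in> root_pairs r \<Longrightarrow> psum k (eps b - eps a) \<le> 0"
  by (auto simp: psum_diff psum_eps root_pairs_def)

lemma lowering_psum: "lowering v \<kappa> \<Longrightarrow> psum k \<kappa> \<le> psum k \<Lambda>"
proof (induction rule: lowering.induct)
  case (step v \<kappa> a b)
  then show ?case using psum_lowering_step[of a b k] unfolding psum_add by linarith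
qed simp

text \<open>Each lowering step strictly decreases the pairing with \<delta>, so only the empty word
  has the highest weight. This gives multiplicity one at the top.\<close>

lemma lowering_top:
  "lowering v \<kappa> \<Longrightarrow> (v = u \<and> \<kappa> = \<Lambda>) \<or> ip r \<kappa> (weyl_vector r) < ip r \<Lambda> (weyl_vector r)"
proof (induction rule: lowering.induct)
  case (step v \<kappa> a b)
  have "ip r (eps b - eps a) (weyl_vector r) < 0"
    using step(2) strictly_dominant_less[OF strictly_dominant_weyl_vector, of a b r]
    by (auto simp: root_pairs_def ip_diff_left ip_commute[of r "eps _"] ip_eps_right)
  then show ?case using step(3) unfolding ip_add_left by auto
qed simp

definition words :: "'v set" where
  "words = {v. \<exists>\<kappa>. lowering v \<kappa>}"

lemma words_in_V: "words \<subseteq> V"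
  using lowering_wsp wsp_in_V unfolding words_def by blast

text \<open>A lowering operator maps the span of the words into itself by construction; any other operator is
  moved past it towards the highest weight vector, at the cost of a commutator.\<close>

lemma E_words:
  assumes "lowering v \<kappa>"
  shows "c \<in> {1..r} \<Longrightarrow> d \<in> {1..r} \<Longrightarrow> E c d v \<in> span words"
  using assms
proof (induction arbitrary: c d rule: lowering.induct)
  case base
  show ?case
  proof (cases c d rule: linorder_cases)
    case less
    then have "E c d u = 0" using base raise[of c d] by (simp add: root_pairs_def)
    then show ?thesis by (simp add: span_zero)
  next
    case equal
    then have "E c d u = of_rat (\<Lambda> c) \<star> u" using u(1) base unfolding wsp_def by blast
    moreover have "u \<in> words" unfolding words_def using lowering.base by blast
    ultimately show ?thesis by (simp add: span_scale span_base)
  next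
    case greater
    then have "(d, c) \<in> root_pairs r" using base by (simp add: root_pairs_def)
    then have "E c d u \<in> words" unfolding words_def using lowering.step[OF lowering.base] by blast
    then show ?thesis by (rule span_base)
  qed
next
  case (step v \<kappa> a b)
  have ab: "a \<in> {1..r}" "b \<in> {1..r}" using step(2) by (auto simp: root_pairs_def)
  have low: "E b a w \<in> span words" if "w \<in> span words" for w
    using that
  proof (induction w rule: span_induct_alt)
    case base
    then show ?case by (simp add: E_zero[OF ab(2,1)] span_zero)
  next
    case (step c x y)
    have "E b a x \<in> words"
      using step(1) lowering.step[OF _ \<open>(a, b) \<in> root_pairs r\<close>] unfolding words_def by blast
    then show ?case
      unfolding E_add[OF ab(2,1)] E_scale[OF ab(2,1)] using step(2)
      by (intro span_add span_scale) (auto intro: span_base)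
  qed
  have v: "v \<in> V" using step(1) lowering_wsp wsp_in_V by blast
  have "E c d (E b a v) = E b a (E c d v) + ((if d = b then E c a v else 0) - (if a = c then E b d v else 0))"
    using E_comm[OF ab(2,1) step.prems v] by (simp add: algebra_simps)
  also have "\<dots> \<in> span words"
    using low[OF step.IH[OF step.prems]] step.IH step.prems ab
    by (intro span_add span_diff) (auto simp: span_zero)
  finally show ?case .
qed

lemma span_words: "span words = V"
proof -
  have "span words = {0} \<or> span words = V"
  proof (rule irreducible)
    show "span words \<subseteq> V" by (rule span_minimal[OF words_in_V subspace_V])
    fix a b v assume ab: "a \<in> {1..r}" "b \<in> {1..r}" and "v \<in> span words"
    from this(3) show "E a b v \<in> span words"
    proof (induction v rule: span_induct_alt)
      case base
      then show ?case by (simp add: E_zero[OF ab] span_zero)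
    next
      case (step c x y)
      have "E a b x \<in> span words" using E_words ab step(1) unfolding words_def by blast
      then show ?case
        unfolding E_add[OF ab] E_scale[OF ab] using step(2) by (intro span_add span_scale)
    qed
  qed (rule subspace_span)
  moreover have "u \<in> span words"
    by (rule span_base) (use lowering.base in \<open>auto simp: words_def\<close>)
  ultimately show ?thesis using u(2) by auto
qed

text \<open>A basis selected from the spanning words consists of weight vectors automatically, so
  the weight decomposition needs no diagonalisation.\<close>

lemma ex_weight_basis:
  "\<exists>B wt. finite B \<and> independent B \<and> span B = V \<and> (\<forall>v\<in>B. lowering v (wt v))"
proof -
  obtain B where B: "B \<subseteq> words" "independent B" "words \<subseteq> span B" by (rule maximal_independent_subset)
  have sB: "span B = V"
    using span_words B(1,3) by (metis span_mono span_span subset_antisym)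
  obtain C where C: "finite C" "V = span C" using finite_V by blast
  have "B \<subseteq> span C" using B(1) words_in_V C(2) by blast
  then have "finite B" using independent_span_bound[OF C(1) B(2)] by blast
  moreover have "\<forall>v\<in>B. lowering v (SOME \<kappa>. lowering v \<kappa>)"
    using B(1) unfolding words_def by (metis (mono_tags, lifting) mem_Collect_eq someI_ex subsetD)
  ultimately show ?thesis
    using B(2) sB by (intro exI[of _ B] exI[of _ "\<lambda>v. SOME \<kappa>. lowering v \<kappa>"]) simp
qed

definition weight_basis :: "'v set" where
  "weight_basis = (SOME B. \<exists>wt. finite B \<and> independent B \<and> span B = V \<and> (\<forall>v\<in>B. lowering v (wt v)))"

definition wt :: "'v \<Rightarrow> weight" where
  "wt = (SOME wt. finite weight_basis \<and> independent weight_basis \<and> span weight_basis = V \<and>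
     (\<forall>v\<in>weight_basis. lowering v (wt v)))"

lemma weight_basis:
  "finite weight_basis" "independent weight_basis" "span weight_basis = V"
  "v \<in> weight_basis \<Longrightarrow> lowering v (wt v)"
proof -
  have "\<exists>wt. finite weight_basis \<and> independent weight_basis \<and> span weight_basis = V \<and>
     (\<forall>v\<in>weight_basis. lowering v (wt v))"
    unfolding weight_basis_def by (rule someI_ex[OF ex_weight_basis])
  then have "finite weight_basis \<and> independent weight_basis \<and> span weight_basis = V \<and>
     (\<forall>v\<in>weight_basis. lowering v (wt v))"
    unfolding wt_def by (rule someI_ex)
  then show "finite weight_basis" "independent weight_basis" "span weight_basis = V"
    "v \<in> weight_basis \<Longrightarrow> lowering v (wt v)" by blast+
qed

definition basis_at :: "weight \<Rightarrow> 'v set" where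
  "basis_at \<kappa> = {v \<in> weight_basis. wt v = \<kappa>}"

definition mult :: "weight \<Rightarrow> nat" where
  "mult \<kappa> = card (basis_at \<kappa>)"

lemma basis_at_finite: "finite (basis_at \<kappa>)" and basis_at_independent: "independent (basis_at \<kappa>)"
proof -
  have "basis_at \<kappa> \<subseteq> weight_basis" by (auto simp: basis_at_def)
  then show "finite (basis_at \<kappa>)" "independent (basis_at \<kappa>)"
    by (rule finite_subset[OF _ weight_basis(1)], rule independent_mono[OF weight_basis(2)])
qed

lemma basis_at_lowering: "v \<in> basis_at \<kappa> \<Longrightarrow> lowering v \<kappa>"
  using weight_basis(4) by (auto simp: basis_at_def)

lemma span_basis_at_subset: "span (basis_at \<kappa>) \<subseteq> wsp \<kappa>"
  by (rule span_minimal[OF _ subspace_wsp]) (use basis_at_lowering lowering_wsp in blast)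

lemma lowering_supported: "lowering v \<kappa> \<Longrightarrow> supported r \<kappa>"
  using lowering_weight_lattice weight_lattice_iff[OF r_pos] by blast

lemma wsp_eq_span:
  assumes "supported r \<kappa>"
  shows "wsp \<kappa> = span (basis_at \<kappa>)"
proof
  show "wsp \<kappa> \<subseteq> span (basis_at \<kappa>)"
  proof
    fix v assume v: "v \<in> wsp \<kappa>"
    define c where "c = representation weight_basis v"
    define x where "x \<mu> = (\<Sum>b\<in>basis_at \<mu>. c b \<star> b)" for \<mu>
    define F where "F = insert \<kappa> (wt ` weight_basis)"
    have finF: "finite F" unfolding F_def using weight_basis(1) by simp
    have x_span: "x \<mu> \<in> span (basis_at \<mu>)" for \<mu>
      unfolding x_def by (intro span_sum span_scale span_base)
    have "v = (\<Sum>b\<in>weight_basis. c b \<star> b)"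
      unfolding c_def using weight_basis(1-3) wsp_in_V[OF v]
      by (intro sum_representation_eq[symmetric]) auto
    also have "\<dots> = (\<Sum>\<mu>\<in>F. x \<mu>)"
      unfolding x_def basis_at_def
      by (rule sum.group[symmetric]) (use finF weight_basis(1) in \<open>auto simp: F_def\<close>)
    finally have v_eq: "v = (\<Sum>\<mu>\<in>F. x \<mu>)" .
    \<comment> \<open>Placing -v into the component of weight \<kappa> turns the expansion of v into
      a vanishing sum of weight vectors. For this purpose \<open>F\<close> contains \<kappa> even if
      no basis vector has that weight.\<close>
    define y where "y \<mu> = (if \<mu> = \<kappa> then x \<kappa> - v else x \<mu>)" for \<mu>
    have "(\<Sum>\<mu>\<in>F. y \<mu>) = y \<kappa> + (\<Sum>\<mu>\<in>F-{\<kappa>}. y \<mu>)"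
      by (rule sum.remove[OF finF]) (simp add: F_def)
    also have "(\<Sum>\<mu>\<in>F-{\<kappa>}. y \<mu>) = (\<Sum>\<mu>\<in>F-{\<kappa>}. x \<mu>)"
      by (intro sum.cong refl) (simp add: y_def)
    also have "y \<kappa> + (\<Sum>\<mu>\<in>F-{\<kappa>}. x \<mu>) = (\<Sum>\<mu>\<in>F. x \<mu>) - v"
      using sum.remove[OF finF, of \<kappa> x] by (simp add: F_def y_def)
    also have "\<dots> = 0" using v_eq by simp
    finally have "(\<Sum>\<mu>\<in>F. y \<mu>) = 0" .
    then have "\<forall>\<mu>\<in>F. y \<mu> = 0"
    proof (rule wsp_independent[OF finF, rotated 2])
      show "supported r \<mu>" if "\<mu> \<in> F" for \<mu>
        using that assms lowering_supported weight_basis(4) unfolding F_def by blast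
      show "y \<mu> \<in> wsp \<mu>" if "\<mu> \<in> F" for \<mu>
        using span_basis_at_subset x_span v subspace_diff[OF subspace_wsp, of "x \<kappa>" \<kappa> v]
        unfolding y_def by auto
    qed
    then have "v = x \<kappa>" by (simp add: F_def y_def)
    then show "v \<in> span (basis_at \<kappa>)" using x_span by simp
  qed
qed (rule span_basis_at_subset)

lemma dim_wsp: "supported r \<kappa> \<Longrightarrow> dim (wsp \<kappa>) = mult \<kappa>"
  unfolding mult_def by (simp add: wsp_eq_span dim_eq_card_independent[OF basis_at_independent])

lemma mult_nonzero: "mult \<kappa> \<noteq> 0 \<Longrightarrow> \<exists>v. lowering v \<kappa>"
  unfolding mult_def using basis_at_lowering by (metis card.empty ex_in_conv)

lemma finite_weights: "finite {\<kappa>. mult \<kappa> \<noteq> 0}"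
proof (rule finite_subset)
  show "{\<kappa>. mult \<kappa> \<noteq> 0} \<subseteq> wt ` weight_basis"
  proof
    fix \<kappa> assume "\<kappa> \<in> {\<kappa>. mult \<kappa> \<noteq> 0}"
    then have "basis_at \<kappa> \<noteq> {}" by (auto simp: mult_def)
    then show "\<kappa> \<in> wt ` weight_basis" by (auto simp: basis_at_def)
  qed
qed (use weight_basis(1) in simp)

lemma mult_top: "mult \<Lambda> = 1"
proof -
  have "basis_at \<Lambda> \<subseteq> {u}" using basis_at_lowering lowering_top by blast
  moreover have "basis_at \<Lambda> \<noteq> {}"
  proof
    assume "basis_at \<Lambda> = {}"
    moreover have "supported r \<Lambda>" using \<Lambda> weight_lattice_iff[OF r_pos] by blast
    ultimately show False using u wsp_eq_span[of \<Lambda>] by simp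
  qed
  ultimately have "basis_at \<Lambda> = {u}" by blast
  then show ?thesis by (simp add: mult_def)
qed

text \<open>The reflected weight is reached after n = \<kappa>_a - \<kappa>_b applications of
  \<open>E b a\<close>, and up to that power lowering is injective on the weight space.\<close>

lemma mult_le_reflection:
  assumes ab: "a \<in> {1..r}" "b \<in> {1..r}" "a \<noteq> b" and \<kappa>: "\<kappa> \<in> weight_lattice r" and ge: "\<kappa> b \<le> \<kappa> a"
  shows "mult \<kappa> \<le> mult (\<kappa> - wscale (\<kappa> a - \<kappa> b) (eps a - eps b))"
proof -
  have "\<kappa> a - \<kappa> b \<in> \<int>" using \<kappa> ab weight_lattice_iff[OF r_pos] by blast
  then obtain z where z: "\<kappa> a - \<kappa> b = of_int z" by (auto elim: Ints_cases)
  have n: "\<kappa> a - \<kappa> b = of_nat (nat z)" using z ge by simp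
  define n where "n = nat z"
  let ?\<mu> = "\<kappa> - wscale (\<kappa> a - \<kappa> b) (eps a - eps b)"
  let ?f = "E b a ^^ n"
  \<comment> \<open>There are finitely many weights, so the string above \<kappa> ends; its length
    is the bound on which the injectivity argument inducts.\<close>
  have "finite {k :: nat. mult (\<kappa> + wscale (of_nat k) (eps a - eps b)) \<noteq> 0}"
  proof (rule finite_vimage_IntI[OF finite_weights, of "\<lambda>k. \<kappa> + wscale (of_nat k) (eps a - eps b)" UNIV, simplified vimage_def Int_UNIV_right mem_Collect_eq])
    show "inj (\<lambda>k::nat. \<kappa> + wscale (of_nat k) (eps a - eps b))"
    proof (rule injI)
      fix k l :: nat assume "\<kappa> + wscale (of_nat k) (eps a - eps b) = \<kappa> + wscale (of_nat l) (eps a - eps b)"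
      then have "(\<kappa> + wscale (of_nat k) (eps a - eps b)) a = (\<kappa> + wscale (of_nat l) (eps a - eps b)) a" by simp
      then show "k = l" using ab(3) by (simp add: wscale_def eps_def)
    qed
  qed
  then obtain N where N: "\<And>k. mult (\<kappa> + wscale (of_nat k) (eps a - eps b)) \<noteq> 0 \<Longrightarrow> k < N"
    unfolding finite_nat_set_iff_bounded by blast
  have sup: "supported r \<kappa>" using \<kappa> weight_lattice_iff[OF r_pos] by blast
  have sup': "supported r (\<kappa> + wscale c (eps a - eps b))" "supported r (\<kappa> - wscale c (eps a - eps b))" for c
    using sup ab by (auto intro!: supported_add supported_diff supported_wscale supported_eps)
  have zero: "wsp (\<kappa> + wscale (of_nat k) (eps a - eps b)) \<subseteq> {0}" if "N \<le> k" for k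
  proof -
    have "mult (\<kappa> + wscale (of_nat k) (eps a - eps b)) = 0" using N[of k] that by linarith
    then have "basis_at (\<kappa> + wscale (of_nat k) (eps a - eps b)) = {}"
      using basis_at_finite by (simp add: mult_def)
    then show ?thesis unfolding wsp_eq_span[OF sup'(1)] by simp
  qed
  interpret p: vector_space_pair scale scale by unfold_locales
  have hom: "module_hom scale scale (E b a ^^ m)" for m
  proof (induction m)
    case 0
    show ?case unfolding module_hom_iff using module_axioms by simp
  next
    case (Suc m)
    then show ?case
      unfolding module_hom_iff by (simp add: E_add[OF ab(2,1)] E_scale[OF ab(2,1)])
  qed
  have inj: "inj_on ?f (span (basis_at \<kappa>))"
  proof (rule inj_onI)
    fix v w assume vw: "v \<in> span (basis_at \<kappa>)" "w \<in> span (basis_at \<kappa>)" "?f v = ?f w"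
    have vw_wsp: "v - w \<in> wsp \<kappa>" using vw(1,2) span_basis_at_subset by (intro subspace_diff[OF subspace_wsp]) blast+
    have "v - w = 0"
    proof (rule E_power_injective[OF ab zero vw_wsp])
      show "of_nat n \<le> \<kappa> a - \<kappa> b" unfolding n n_def ..
      show "?f (v - w) = 0" unfolding module_hom.diff[OF hom] vw(3) by (rule diff_self)
    qed
    then show "v = w" by simp
  qed
  have into: "?f ` basis_at \<kappa> \<subseteq> span (basis_at ?\<mu>)"
  proof (rule image_subsetI)
    fix v assume "v \<in> basis_at \<kappa>"
    then have "v \<in> wsp \<kappa>" using basis_at_lowering lowering_wsp by blast
    then have "?f v \<in> wsp ?\<mu>" unfolding n n_def by (rule E_power_wsp[OF ab(1,2)])
    then show "?f v \<in> span (basis_at ?\<mu>)" unfolding wsp_eq_span[OF sup'(2)] .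
  qed
  have "independent (?f ` basis_at \<kappa>)"
    by (rule module_hom.independent_injective_image[OF hom basis_at_independent inj])
  then have "card (?f ` basis_at \<kappa>) \<le> card (basis_at ?\<mu>)"
    using independent_span_bound[OF basis_at_finite _ into] by blast
  moreover have "card (?f ` basis_at \<kappa>) = card (basis_at \<kappa>)"
    by (rule card_image) (use inj span_superset in \<open>auto intro: inj_on_subset\<close>)
  ultimately show ?thesis by (simp add: mult_def)
qed

text \<open>Reflecting twice returns to \<kappa>, so the inequality, applied with a and b exchanged
  at the reflected weight, gives the converse.\<close>

lemma mult_reflection:
  assumes ab: "a \<in> {1..r}" "b \<in> {1..r}" "a \<noteq> b" and \<kappa>: "\<kappa> \<in> weight_lattice r"
  shows "mult (\<kappa> - wscale (\<kappa> a - \<kappa> b) (eps a - eps b)) = mult \<kappa>"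
proof -
  have main: "mult (\<kappa> - wscale (\<kappa> a - \<kappa> b) (eps a - eps b)) = mult \<kappa>"
    if ab: "a \<in> {1..r}" "b \<in> {1..r}" "a \<noteq> b" and ge: "\<kappa> b \<le> \<kappa> a" for a b
  proof (rule antisym)
    let ?\<mu> = "\<kappa> - wscale (\<kappa> a - \<kappa> b) (eps a - eps b)"
    have "wscale (\<kappa> a - \<kappa> b) (eps a - eps b) \<in> weight_lattice r"
      using \<kappa> ab weight_lattice_iff[OF r_pos]
      by (intro weight_lattice_wscale r_pos eps_diff_in_weight_lattice) blast+
    then have \<mu>: "?\<mu> \<in> weight_lattice r" by (intro weight_lattice_diff r_pos \<kappa>)
    have val: "?\<mu> a = \<kappa> b" "?\<mu> b = \<kappa> a" using ab(3) by (simp_all add: wscale_def eps_def)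
    have back_eq: "?\<mu> - wscale (?\<mu> b - ?\<mu> a) (eps b - eps a) = \<kappa>"
      unfolding val by (simp add: wscale_def fun_eq_iff algebra_simps)
    have "mult ?\<mu> \<le> mult (?\<mu> - wscale (?\<mu> b - ?\<mu> a) (eps b - eps a))"
    proof (rule mult_le_reflection[OF ab(2,1) _ \<mu>])
      show "b \<noteq> a" using ab(3) by simp
      show "?\<mu> a \<le> ?\<mu> b" unfolding val by (rule ge)
    qed
    then show "mult ?\<mu> \<le> mult \<kappa>" unfolding back_eq .
    show "mult \<kappa> \<le> mult ?\<mu>" by (rule mult_le_reflection[OF ab \<kappa> ge])
  qed
  have swap: "wscale (\<kappa> b - \<kappa> a) (eps b - eps a) = wscale (\<kappa> a - \<kappa> b) (eps a - eps b)"
    by (simp add: wscale_def fun_eq_iff algebra_simps)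
  show ?thesis
  proof (cases "\<kappa> b \<le> \<kappa> a")
    case True
    then show ?thesis by (rule main[OF ab])
  next
    case False
    then have "b \<noteq> a" "\<kappa> a \<le> \<kappa> b" using ab(3) by auto
    then show ?thesis by (rule main[OF ab(2,1), unfolded swap])
  qed
qed

subsection \<open>Freudenthal's recursion\<close>

text \<open>The eigenvalue is already known on the highest weight vector. Its eigenspace is a
  nonzero invariant subspace, hence everything.\<close>

lemma casimir_scalar:
  assumes "v \<in> V"
  shows "casimir v = of_rat (ip r \<Lambda> (\<Lambda> + wscale 2 (weyl_vector r))) \<star> v"
proof -
  let ?c = "of_rat (ip r \<Lambda> (\<Lambda> + wscale 2 (weyl_vector r))) :: complex"
  let ?W = "{v \<in> V. casimir v = ?c \<star> v}"
  have lin: "casimir (v + w) = casimir v + casimir w" "casimir (k \<star> v) = k \<star> casimir v" "casimir 0 = 0" for v w k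
    unfolding casimir_def by (simp_all add: E_add E_scale E_zero sum.distrib scale_sum_right)
  have "?W = {0} \<or> ?W = V"
  proof (rule irreducible)
    show "subspace ?W"
    proof (rule subspaceI)
      show "0 \<in> ?W" using subspace_0[OF subspace_V] by (simp add: lin)
      show "v + w \<in> ?W" if "v \<in> ?W" "w \<in> ?W" for v w
        using that subspace_add[OF subspace_V, of v w] by (simp add: lin scale_right_distrib)
      show "k \<star> v \<in> ?W" if "v \<in> ?W" for k v
        using that subspace_scale[OF subspace_V, of v k] by (simp add: lin mult.commute)
    qed
    fix a b v assume ab: "a \<in> {1..r}" "b \<in> {1..r}" and v: "v \<in> ?W"
    then have "casimir (E a b v) = E a b (?c \<star> v)" using casimir_comm[of a b v] by simp
    then show "E a b v \<in> ?W" using E_in[OF ab] v unfolding E_scale[OF ab] by simp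
  qed blast
  moreover have "u \<in> ?W"
  proof -
    have "(\<Sum>(a, b)\<in>root_pairs r. E b a (E a b u)) = 0"
      by (intro sum.neutral) (auto simp: raise E_zero root_pairs_def)
    then show ?thesis using casimir_wsp[OF u(1)] wsp_in_V[OF u(1)] by simp
  qed
  ultimately show ?thesis using u(2) assms by blast
qed

definition ladder_trace :: "nat \<Rightarrow> nat \<Rightarrow> weight \<Rightarrow> complex" where
  "ladder_trace a b \<kappa> = trace_on (basis_at \<kappa>) (\<lambda>v. E b a (E a b v))"

lemma E_basis_at:
  assumes "a \<in> {1..r}" "b \<in> {1..r}" "v \<in> basis_at \<kappa>"
  shows "E a b v \<in> span (basis_at (\<kappa> + (eps a - eps b)))"
proof -
  have "E a b v \<in> wsp (\<kappa> + (eps a - eps b))"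
    using assms basis_at_lowering lowering_wsp by (intro E_wsp) blast+
  moreover have "supported r (\<kappa> + (eps a - eps b))"
    using assms lowering_supported[OF basis_at_lowering]
    by (intro supported_add supported_diff supported_eps) auto
  ultimately show ?thesis using wsp_eq_span by blast
qed

lemma E_E_basis_at:
  assumes "a \<in> {1..r}" "b \<in> {1..r}" "v \<in> basis_at \<kappa>"
  shows "E b a (E a b v) \<in> span (basis_at \<kappa>)"
proof -
  have "E b a (E a b v) \<in> wsp (\<kappa> + (eps a - eps b) + (eps b - eps a))"
    using assms basis_at_lowering lowering_wsp by (intro E_wsp) blast+
  also have "\<kappa> + (eps a - eps b) + (eps b - eps a) = \<kappa>" by (simp add: fun_eq_iff)
  finally show ?thesis using wsp_eq_span lowering_supported[OF basis_at_lowering[OF assms(3)]] by blast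
qed

text \<open>Cyclicity moves the trace from weight \<kappa> to \<kappa> + \<alpha> and reverses the
  order of the two operators. Restoring the order adds a scalar commutator, whose trace is that
  scalar times the multiplicity.\<close>

lemma ladder_trace_step:
  assumes ab: "(a, b) \<in> root_pairs r"
  shows "ladder_trace a b \<kappa> - ladder_trace a b (\<kappa> + (eps a - eps b)) =
    of_rat (ip r (\<kappa> + (eps a - eps b)) (eps a - eps b)) * of_nat (mult (\<kappa> + (eps a - eps b)))"
proof -
  have a: "a \<in> {1..r}" and b: "b \<in> {1..r}" using ab by (auto simp: root_pairs_def)
  define \<mu> where "\<mu> = \<kappa> + (eps a - eps b)"
  have \<kappa>: "\<kappa> = \<mu> + (eps b - eps a)" by (simp add: \<mu>_def fun_eq_iff)
  have "ladder_trace a b \<kappa> = trace_on (basis_at \<mu>) (\<lambda>w. E a b (E b a w))"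
    unfolding ladder_trace_def
  proof (rule trace_on_swap[OF basis_at_independent basis_at_finite basis_at_independent basis_at_finite _ _ E_hom[OF a b] E_hom[OF b a]])
    show "E a b v \<in> span (basis_at \<mu>)" if "v \<in> basis_at \<kappa>" for v
      unfolding \<mu>_def by (rule E_basis_at[OF a b that])
    show "E b a v \<in> span (basis_at \<kappa>)" if "v \<in> basis_at \<mu>" for v
      unfolding \<kappa> by (rule E_basis_at[OF b a that])
  qed
  also have "\<dots> = trace_on (basis_at \<mu>) (\<lambda>w. E b a (E a b w) + of_rat (\<mu> a - \<mu> b) \<star> w)"
  proof (rule trace_on_cong)
    fix w assume "w \<in> basis_at \<mu>"
    then have w: "w \<in> wsp \<mu>" using basis_at_lowering lowering_wsp by blast
    have wt: "E a a w = of_rat (\<mu> a) \<star> w" "E b b w = of_rat (\<mu> b) \<star> w"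
      using w a b unfolding wsp_def by blast+
    have "E a b (E b a w) - E b a (E a b w) = E a a w - E b b w"
      using E_comm[OF b a a b wsp_in_V[OF w]] by (simp only: if_True simp_thms)
    then show "E a b (E b a w) = E b a (E a b w) + of_rat (\<mu> a - \<mu> b) \<star> w"
      unfolding wt of_rat_diff scale_left_diff_distrib by (simp only: diff_eq_eq add.commute)
  qed
  also have "\<dots> = trace_on (basis_at \<mu>) (\<lambda>w. E b a (E a b w)) + of_rat (\<mu> a - \<mu> b) * of_nat (mult \<mu>)"
    by (subst trace_on_add[OF basis_at_independent])
      (auto simp: trace_on_scalar[OF basis_at_independent] mult_def E_E_basis_at[OF a b] span_base span_scale)
  also have "\<mu> a - \<mu> b = ip r \<mu> (eps a - eps b)" by (simp only: ip_diff_right ip_eps_right[OF a] ip_eps_right[OF b])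
  finally have "ladder_trace a b \<kappa> = ladder_trace a b \<mu> + of_rat (ip r \<mu> (eps a - eps b)) * of_nat (mult \<mu>)"
    unfolding ladder_trace_def .
  then show ?thesis unfolding \<mu>_def by (simp only: diff_eq_eq add.commute)
qed

lemma casimir_trace:
  "of_rat (ip r \<Lambda> (\<Lambda> + wscale 2 (weyl_vector r)) - ip r \<kappa> (\<kappa> + wscale 2 (weyl_vector r))) * of_nat (mult \<kappa>) =
    2 * (\<Sum>(a, b)\<in>root_pairs r. ladder_trace a b \<kappa>)"
proof -
  let ?c = "\<lambda>\<kappa>. of_rat (ip r \<kappa> (\<kappa> + wscale 2 (weyl_vector r))) :: complex"
  let ?S = "\<lambda>v. \<Sum>x\<in>root_pairs r. E (snd x) (fst x) (E (fst x) (snd x) v)"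
  note ind = basis_at_independent[of \<kappa>]
  have S: "E (snd x) (fst x) (E (fst x) (snd x) v) \<in> span (basis_at \<kappa>)"
    if "x \<in> root_pairs r" "v \<in> basis_at \<kappa>" for x v
    by (rule E_E_basis_at) (use that in \<open>auto simp: root_pairs_def\<close>)
  have sum_S: "?S v \<in> span (basis_at \<kappa>)" if "v \<in> basis_at \<kappa>" for v
    by (intro span_sum S that)
  have "?c \<Lambda> * of_nat (mult \<kappa>) = trace_on (basis_at \<kappa>) (\<lambda>v. ?c \<Lambda> \<star> v)"
    unfolding mult_def by (rule trace_on_scalar[OF ind, symmetric])
  also have "\<dots> = trace_on (basis_at \<kappa>) (\<lambda>v. ?c \<kappa> \<star> v + 2 \<star> ?S v)"
  proof (rule trace_on_cong)
    fix v assume "v \<in> basis_at \<kappa>"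
    then have v: "v \<in> wsp \<kappa>" using basis_at_lowering lowering_wsp by blast
    show "?c \<Lambda> \<star> v = ?c \<kappa> \<star> v + 2 \<star> ?S v"
      using casimir_wsp[OF v] casimir_scalar[OF wsp_in_V[OF v]] by (simp only: case_prod_unfold)
  qed
  also have "\<dots> = ?c \<kappa> * of_nat (mult \<kappa>) + 2 * trace_on (basis_at \<kappa>) ?S"
    using sum_S
    by (simp add: trace_on_add[OF ind] trace_on_scale[OF ind] trace_on_scalar[OF ind] mult_def span_base span_scale)
  also have "trace_on (basis_at \<kappa>) ?S = (\<Sum>(a, b)\<in>root_pairs r. ladder_trace a b \<kappa>)"
    unfolding ladder_trace_def case_prod_unfold by (rule trace_on_sum[OF ind S])
  finally show ?thesis unfolding of_rat_diff left_diff_distrib by (simp only: diff_eq_eq add.commute)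
qed

theorem freudenthal_multiplicities:
  assumes f: "\<And>\<kappa>. coef f \<kappa> = int (mult \<kappa>)"
  shows "freudenthal r \<Lambda> f"
  unfolding freudenthal_def
proof (intro conjI)
  have low: "\<exists>v. lowering v \<kappa>" if "\<kappa> \<in> supp f" for \<kappa>
    using that mult_nonzero[of \<kappa>] by (simp add: in_keys_iff f)
  show lat: "lattice_supp r f" unfolding lattice_supp_def using low lowering_weight_lattice by blast
  show "dominated r \<Lambda> f"
    unfolding dominated_def using low lowering_supported lowering_psum lowering.base by meson
  show "coef f \<Lambda> = 1" by (simp add: f mult_top)
  show "invariant r f"
  proof (rule invariant_if_adjacent, rule poly_mapping_eqI)
    fix k \<kappa> assume k: "k \<in> {1..<r}"
    let ?s = "Transposition.transpose k (k + 1)"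
    have e: "weyl_act ?s \<kappa> = \<kappa> - wscale (\<kappa> k - \<kappa> (k + 1)) (eps k - eps (k + 1))" for \<kappa>
      by (auto simp: weyl_act_transpose fun_eq_iff Transposition.transpose_def wscale_def eps_def)
    have s: "?s permutes {1..r}" by (rule transpose_permutes[OF k])
    have "mult (weyl_act ?s \<kappa>) = mult \<kappa>"
    proof (cases "\<kappa> \<in> weight_lattice r")
      case True
      then show ?thesis unfolding e using k by (intro mult_reflection) auto
    next
      case False
      \<comment> \<open>Off the lattice both multiplicities vanish, because every word has its
        weight in the lattice.\<close>
      then have "weyl_act ?s \<kappa> \<notin> weight_lattice r"
        using weight_lattice_weyl_act[OF r_pos s, of "weyl_act ?s \<kappa>"] weyl_act_inv_cancel(1)[of ?s \<kappa>] by auto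
      then show ?thesis using False mult_nonzero lowering_weight_lattice by metis
    qed
    then show "coef (wact ?s f) \<kappa> = coef f \<kappa>"
      by (simp add: coef_wact bij_transpose f)
  qed
  define t where "t a b = Abs_poly_mapping (ladder_trace a b)" for a b
  have t: "coef (t a b) \<kappa> = ladder_trace a b \<kappa>" for a b \<kappa>
  proof -
    \<comment> \<open>A trace over an empty basis is zero, which supplies the finite support that
      \<open>Abs_poly_mapping\<close> requires.\<close>
    have "{\<kappa>. ladder_trace a b \<kappa> \<noteq> 0} \<subseteq> {\<kappa>. mult \<kappa> \<noteq> 0}"
      using basis_at_finite by (auto simp: ladder_trace_def trace_on_def mult_def)
    then have "finite {\<kappa>. ladder_trace a b \<kappa> \<noteq> 0}" by (rule finite_subset[OF _ finite_weights])
    then show ?thesis unfolding t_def by (simp add: lookup_Abs_poly_mapping)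
  qed
  show "\<exists>t :: nat \<Rightarrow> nat \<Rightarrow> weight \<Rightarrow>\<^sub>0 complex.
       (\<forall>(a, b)\<in>root_pairs r. \<forall>v.
          coef (t a b) v - coef (t a b) (v + (eps a - eps b)) =
            of_rat (ip r (v + (eps a - eps b)) (eps a - eps b)) * of_int (coef f (v + (eps a - eps b)))) \<and>
       (\<forall>v. of_rat (ip r \<Lambda> (\<Lambda> + wscale 2 (weyl_vector r)) - ip r v (v + wscale 2 (weyl_vector r))) *
              of_int (coef f v) = 2 * (\<Sum>(a, b)\<in>root_pairs r. coef (t a b) v))"
  proof (intro exI[of _ t] conjI allI ballI)
    fix x assume x: "x \<in> root_pairs r"
    obtain a b where ab: "x = (a, b)" by force
    show "case x of (a, b) \<Rightarrow> \<forall>v. coef (t a b) v - coef (t a b) (v + (eps a - eps b)) =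
            of_rat (ip r (v + (eps a - eps b)) (eps a - eps b)) * of_int (coef f (v + (eps a - eps b)))"
      unfolding ab case_prod_conv t f of_int_of_nat_eq using ladder_trace_step x ab by blast
  next
    fix v
    show "of_rat (ip r \<Lambda> (\<Lambda> + wscale 2 (weyl_vector r)) - ip r v (v + wscale 2 (weyl_vector r))) *
              of_int (coef f v) = 2 * (\<Sum>(a, b)\<in>root_pairs r. coef (t a b) v)"
      unfolding t f of_int_of_nat_eq by (rule casimir_trace)
  qed
qed

end

section \<open>Characters of the modules\<close>

text \<open>The projection of the matrix unit to the traceless matrices, with indices starting at 1.\<close>

definition sl_unit :: "nat \<Rightarrow> nat \<Rightarrow> nat \<Rightarrow> complex mat" where
  "sl_unit r a b = mat r r (\<lambda>(i, j). (if i = a - 1 then 1 else 0) * (if j = b - 1 then 1 else 0)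
     - (if a = b then 1 / of_nat r else 0) * (if i = j then 1 else 0))"

lemma sl_unit_carrier [simp]: "sl_unit r a b \<in> carrier_mat r r"
  by (simp add: sl_unit_def)

lemma sl_unit_index:
  "i < r \<Longrightarrow> j < r \<Longrightarrow> sl_unit r a b $$ (i, j) =
    (if i = a - 1 then 1 else 0) * (if j = b - 1 then 1 else 0)
     - (if a = b then 1 / of_nat r else 0) * (if i = j then 1 else 0)"
  by (simp add: sl_unit_def)

lemma sl_unit_in_sl:
  assumes "1 \<le> r" "a \<in> {1..r}" "b \<in> {1..r}"
  shows "sl_unit r a b \<in> sl r"
proof -
  have "(\<Sum>i<r. sl_unit r a b $$ (i, i)) =
      (\<Sum>i<r. (if i = a - 1 then (if a = b then 1 else 0) else 0) - (if a = b then 1 / of_nat r else 0))"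
    using assms by (intro sum.cong refl) (auto simp: sl_unit_index)
  also have "\<dots> = (if a = b then 1 else 0) - of_nat r * (if a = b then 1 / of_nat r else 0)"
    using assms by (auto simp: sum_subtractf)
  also have "\<dots> = 0" using assms by simp
  finally show ?thesis by (simp add: sl_def)
qed

lemma sum_delta_product:
  fixes f :: "nat \<Rightarrow> complex"
  assumes "d < r"
  shows "(\<Sum>k<r. f k * (if k = d then 1 else 0)) = f d" "(\<Sum>k<r. (if k = d then 1 else 0) * f k) = f d"
    "(\<Sum>k<r. (if d = k then 1 else 0) * f k) = f d"
proof -
  have "(\<Sum>k<r. f k * (if k = d then 1 else 0)) = (\<Sum>k<r. if k = d then f k else 0)"
    by (intro sum.cong) auto
  then show "(\<Sum>k<r. f k * (if k = d then 1 else 0)) = f d" using assms by simp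
  have "(\<Sum>k<r. (if k = d then 1 else 0) * f k) = (\<Sum>k<r. if k = d then f k else 0)"
    by (intro sum.cong) auto
  then show "(\<Sum>k<r. (if k = d then 1 else 0) * f k) = f d" using assms by simp
  have "(\<Sum>k<r. (if d = k then 1 else 0) * f k) = (\<Sum>k<r. if k = d then f k else 0)"
    by (intro sum.cong) auto
  then show "(\<Sum>k<r. (if d = k then 1 else 0) * f k) = f d" using assms by simp
qed

text \<open>Scalar corrections commute with everything and disappear on the left. On the right they
  are present only when both d = a and b = c, and then they cancel.\<close>

lemma sl_unit_commutator:
  assumes "a \<in> {1..r}" "b \<in> {1..r}" "c \<in> {1..r}" "d \<in> {1..r}"
  shows "sl_unit r c d * sl_unit r a b - sl_unit r a b * sl_unit r c d =
    of_bool (d = a) \<cdot>\<^sub>m sl_unit r c b + (- of_bool (b = c)) \<cdot>\<^sub>m sl_unit r a d"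
proof (rule eq_matI)
  fix i j assume "i < dim_row (of_bool (d = a) \<cdot>\<^sub>m sl_unit r c b + (- of_bool (b = c)) \<cdot>\<^sub>m sl_unit r a d)"
    "j < dim_col (of_bool (d = a) \<cdot>\<^sub>m sl_unit r c b + (- of_bool (b = c)) \<cdot>\<^sub>m sl_unit r a d)"
  then have i: "i < r" and j: "j < r" by (simp_all add: sl_unit_def)
  define u :: "nat \<Rightarrow> nat \<Rightarrow> complex" where "u = (\<lambda>a i. if i = a - 1 then 1 else 0)"
  define s :: "nat \<Rightarrow> nat \<Rightarrow> complex" where "s = (\<lambda>a b. if a = b then 1 / of_nat r else 0)"
  define \<kappa> :: "nat \<Rightarrow> nat \<Rightarrow> complex" where "\<kappa> = (\<lambda>i j. if i = j then 1 else 0)"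
  have idx: "sl_unit r a b $$ (i, j) = u a i * u b j - s a b * \<kappa> i j" if "i < r" "j < r" for a b i j
    using that unfolding u_def s_def \<kappa>_def by (rule sl_unit_index)
  have prod: "(sl_unit r c d * sl_unit r a b) $$ (i, j) =
      \<kappa> d a * (u c i * u b j) - s a b * (u c i * u d j) - s c d * (u a i * u b j) + s c d * s a b * \<kappa> i j"
    if a: "a \<in> {1..r}" and b: "b \<in> {1..r}" and c: "c \<in> {1..r}" and d: "d \<in> {1..r}" for a b c d
  proof -
    have ad: "a - 1 < r" "d - 1 < r" using a d by auto
    have "(sl_unit r c d * sl_unit r a b) $$ (i, j) = (\<Sum>l<r. sl_unit r c d $$ (i, l) * sl_unit r a b $$ (l, j))"
      using i j by (simp add: times_mat_def scalar_prod_def sl_unit_def lessThan_atLeast0)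
    also have "\<dots> = (\<Sum>l<r. (u c i * u b j) * (u d l * u a l) - s a b * u c i * (u d l * \<kappa> l j)
        - s c d * u b j * (\<kappa> i l * u a l) + s c d * s a b * (\<kappa> i l * \<kappa> l j))"
      using i j by (intro sum.cong refl) (simp add: idx algebra_simps)
    also have "\<dots> = (u c i * u b j) * (\<Sum>l<r. u d l * u a l) - s a b * u c i * (\<Sum>l<r. u d l * \<kappa> l j)
        - s c d * u b j * (\<Sum>l<r. \<kappa> i l * u a l) + s c d * s a b * (\<Sum>l<r. \<kappa> i l * \<kappa> l j)"
      by (simp only: sum.distrib sum_subtractf sum_distrib_left)
    also have "(\<Sum>l<r. u d l * u a l) = u a (d - 1)"
      unfolding u_def by (rule sum_delta_product[OF ad(2)])
    also have "(\<Sum>l<r. u d l * \<kappa> l j) = \<kappa> (d - 1) j"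
      unfolding u_def by (rule sum_delta_product[OF ad(2)])
    also have "(\<Sum>l<r. \<kappa> i l * u a l) = u a i"
      unfolding \<kappa>_def by (rule sum_delta_product[OF i])
    also have "(\<Sum>l<r. \<kappa> i l * \<kappa> l j) = \<kappa> i j"
      unfolding \<kappa>_def by (rule sum_delta_product[OF i])
    also have "u a (d - 1) = \<kappa> d a" using a d by (auto simp: u_def \<kappa>_def)
    also have "\<kappa> (d - 1) j = u d j" by (auto simp: u_def \<kappa>_def)
    finally show ?thesis by (simp add: algebra_simps)
  qed
  have "(of_bool (d = a) \<cdot>\<^sub>m sl_unit r c b + (- of_bool (b = c)) \<cdot>\<^sub>m sl_unit r a d) $$ (i, j) =
      of_bool (d = a) * sl_unit r c b $$ (i, j) + (- of_bool (b = c)) * sl_unit r a d $$ (i, j)"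
    using i j by (simp add: sl_unit_def)
  then have rhs: "(of_bool (d = a) \<cdot>\<^sub>m sl_unit r c b + (- of_bool (b = c)) \<cdot>\<^sub>m sl_unit r a d) $$ (i, j) =
      of_bool (d = a) * (u c i * u b j - s c b * \<kappa> i j) - of_bool (b = c) * (u a i * u d j - s a d * \<kappa> i j)"
    unfolding idx[OF i j] by simp
  have lhs: "(sl_unit r c d * sl_unit r a b - sl_unit r a b * sl_unit r c d) $$ (i, j) =
      (sl_unit r c d * sl_unit r a b) $$ (i, j) - (sl_unit r a b * sl_unit r c d) $$ (i, j)"
    using i j by (simp add: sl_unit_def)
  have "\<kappa> d a = of_bool (d = a)" "\<kappa> b c = of_bool (b = c)"
    "of_bool (d = a) * s c b = of_bool (b = c) * s a d"
    by (auto simp: \<kappa>_def s_def)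
  then show "(sl_unit r c d * sl_unit r a b - sl_unit r a b * sl_unit r c d) $$ (i, j) =
      (of_bool (d = a) \<cdot>\<^sub>m sl_unit r c b + (- of_bool (b = c)) \<cdot>\<^sub>m sl_unit r a d) $$ (i, j)"
    unfolding lhs rhs prod[OF assms] prod[OF assms(3,4,1,2)]
    by (simp add: right_diff_distrib mult.assoc[symmetric])
qed (simp_all add: sl_unit_def)

text \<open>The combination is formed entrywise, which fixes the dimension r also for the empty
  index set.\<close>

definition sl_comb :: "nat \<Rightarrow> (nat \<times> nat) set \<Rightarrow> (nat \<times> nat \<Rightarrow> complex) \<Rightarrow> complex mat" where
  "sl_comb r P c = mat r r (\<lambda>(i, j). \<Sum>x\<in>P. c x * sl_unit r (fst x) (snd x) $$ (i, j))"

text \<open>The entries of X itself serve as coefficients: the corrections in the diagonal units add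
  up to the trace of X divided by r, which is zero.\<close>

lemma sl_comb_full:
  assumes r: "1 \<le> r" and X: "X \<in> sl r"
  shows "sl_comb r ({1..r} \<times> {1..r}) (\<lambda>x. X $$ (fst x - 1, snd x - 1)) = X"
proof (rule eq_matI)
  have Xc: "X \<in> carrier_mat r r" and tr: "(\<Sum>i<r. X $$ (i, i)) = 0" using X by (auto simp: sl_def)
  show "dim_row (sl_comb r ({1..r} \<times> {1..r}) (\<lambda>x. X $$ (fst x - 1, snd x - 1))) = dim_row X"
    "dim_col (sl_comb r ({1..r} \<times> {1..r}) (\<lambda>x. X $$ (fst x - 1, snd x - 1))) = dim_col X"
    using Xc by (auto simp: sl_comb_def)
  fix i j assume "i < dim_row X" "j < dim_col X"
  then have i: "i < r" and j: "j < r" using Xc by auto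
  define g where "g a b = X $$ (a, b) * sl_unit r (a + 1) (b + 1) $$ (i, j)" for a b
  have shift: "(\<Sum>a=1..r. f (a - 1)) = (\<Sum>a<r. f a)" for f :: "nat \<Rightarrow> complex"
    by (rule sum.reindex_bij_witness[of _ Suc "\<lambda>a. a - 1"]) auto
  have "sl_comb r ({1..r} \<times> {1..r}) (\<lambda>x. X $$ (fst x - 1, snd x - 1)) $$ (i, j) =
      (\<Sum>a=1..r. \<Sum>b=1..r. X $$ (a - 1, b - 1) * sl_unit r a b $$ (i, j))"
    using i j by (simp add: sl_comb_def sum.cartesian_product case_prod_unfold)
  also have "\<dots> = (\<Sum>a=1..r. \<Sum>b=1..r. g (a - 1) (b - 1))"
    by (intro sum.cong refl) (simp add: g_def)
  also have "\<dots> = (\<Sum>a=1..r. \<Sum>b<r. g (a - 1) b)"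
    by (intro sum.cong refl shift)
  also have "\<dots> = (\<Sum>a<r. \<Sum>b<r. X $$ (a, b) * sl_unit r (a + 1) (b + 1) $$ (i, j))"
    unfolding g_def by (rule shift)
  also have "\<dots> = (\<Sum>a<r. \<Sum>b<r. (X $$ (a, b) * (if i = a then 1 else 0)) * (if j = b then 1 else 0)) -
     (\<Sum>a<r. \<Sum>b<r. (if b = a then X $$ (a, a) / of_nat r * (if i = j then 1 else 0) else 0))"
    unfolding sum_subtractf[symmetric] using i j
    by (intro sum.cong refl) (simp add: sl_unit_index right_diff_distrib)
  also have "(\<Sum>a<r. \<Sum>b<r. (X $$ (a, b) * (if i = a then 1 else 0)) * (if j = b then 1 else 0)) =
      (\<Sum>a<r. \<Sum>b<r. if b = j then (if a = i then X $$ (i, j) else 0) else 0)"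
    by (intro sum.cong refl) auto
  also have "\<dots> = X $$ (i, j)" using i j by simp
  also have "(\<Sum>a<r. \<Sum>b<r. (if b = a then X $$ (a, a) / of_nat r * (if i = j then 1 else 0) else 0)) =
      (\<Sum>a<r. X $$ (a, a)) / of_nat r * (if i = j then 1 else 0)"
    by (simp add: sum_divide_distrib sum_distrib_right)
  finally show "sl_comb r ({1..r} \<times> {1..r}) (\<lambda>x. X $$ (fst x - 1, snd x - 1)) $$ (i, j) = X $$ (i, j)"
    by (simp add: tr)
qed

lemma sl_comb_insert:
  assumes "finite P" "x \<notin> P"
  shows "sl_comb r (insert x P) c = c x \<cdot>\<^sub>m sl_unit r (fst x) (snd x) + sl_comb r P c"
  by (rule eq_matI) (use assms in \<open>auto simp: sl_comb_def sl_unit_def\<close>)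

lemma sl_add: "X \<in> sl r \<Longrightarrow> Y \<in> sl r \<Longrightarrow> X + Y \<in> sl r"
proof -
  assume X: "X \<in> sl r" and Y: "Y \<in> sl r"
  then have "(\<Sum>i<r. (X + Y) $$ (i, i)) = (\<Sum>i<r. X $$ (i, i) + Y $$ (i, i))"
    by (intro sum.cong refl) (auto simp: sl_def)
  then show ?thesis using X Y by (auto simp: sl_def sum.distrib)
qed

lemma sl_smult: "X \<in> sl r \<Longrightarrow> c \<cdot>\<^sub>m X \<in> sl r"
proof -
  assume X: "X \<in> sl r"
  then have "(\<Sum>i<r. (c \<cdot>\<^sub>m X) $$ (i, i)) = (\<Sum>i<r. c * X $$ (i, i))"
    by (intro sum.cong refl) (auto simp: sl_def)
  then show ?thesis using X by (auto simp: sl_def simp flip: sum_distrib_left)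
qed

section \<open>From a module to operators indexed by matrix units\<close>

context
  fixes r :: nat and M :: "'v::ab_group_add sl_rep"
  assumes r: "1 \<le> r" and M: "sl_module r M"
begin

interpretation vs: vector_space "scale M"
  using M by (simp add: sl_module_def)

lemma subspace_vspace: "vs.subspace (vspace M)"
  and finite_vspace: "\<exists>B. finite B \<and> vspace M = vs.span B"
  and action_in: "X \<in> sl r \<Longrightarrow> v \<in> vspace M \<Longrightarrow> action M X v \<in> vspace M"
  and action_add_right: "X \<in> sl r \<Longrightarrow> v \<in> vspace M \<Longrightarrow> w \<in> vspace M \<Longrightarrow>
    action M X (v + w) = action M X v + action M X w"
  and action_scale_right: "X \<in> sl r \<Longrightarrow> v \<in> vspace M \<Longrightarrow> action M X (scale M c v) = scale M c (action M X v)"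
  and action_add_left: "X \<in> sl r \<Longrightarrow> Y \<in> sl r \<Longrightarrow> v \<in> vspace M \<Longrightarrow>
    action M (X + Y) v = action M X v + action M Y v"
  and action_scale_left: "X \<in> sl r \<Longrightarrow> v \<in> vspace M \<Longrightarrow> action M (c \<cdot>\<^sub>m X) v = scale M c (action M X v)"
  and action_bracket: "X \<in> sl r \<Longrightarrow> Y \<in> sl r \<Longrightarrow> v \<in> vspace M \<Longrightarrow>
    action M (X * Y - Y * X) v = action M X (action M Y v) - action M Y (action M X v)"
  using M by (simp_all add: sl_module_def)

lemma action_sl_comb:
  assumes v: "v \<in> vspace M" and P: "finite P" "P \<subseteq> {1..r} \<times> {1..r}"
  shows "sl_comb r P c \<in> sl r \<and>
    action M (sl_comb r P c) v = (\<Sum>x\<in>P. scale M (c x) (action M (sl_unit r (fst x) (snd x)) v))"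
  using P
proof (induction P rule: finite_induct)
  case empty
  have u: "sl_unit r 1 1 \<in> sl r" using r by (intro sl_unit_in_sl) auto
  \<comment> \<open>The module axioms mention sums and multiples only, so the zero matrix is
    presented as a multiple of a matrix known to be in \<open>sl r\<close>.\<close>
  have "sl_comb r {} c = 0 \<cdot>\<^sub>m sl_unit r 1 1"
    by (rule eq_matI) (auto simp: sl_comb_def sl_unit_def)
  then show ?case using sl_smult[OF u] action_scale_left[OF u v, of 0] by simp
next
  case (insert x P)
  have u: "sl_unit r (fst x) (snd x) \<in> sl r" using insert.prems r by (intro sl_unit_in_sl) auto
  have IH: "sl_comb r P c \<in> sl r"
    "action M (sl_comb r P c) v = (\<Sum>x\<in>P. scale M (c x) (action M (sl_unit r (fst x) (snd x)) v))"
    using insert.IH insert.prems by blast+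
  show ?case
    unfolding sl_comb_insert[OF insert.hyps] sum.insert[OF insert.hyps]
    using sl_add[OF sl_smult[OF u] IH(1)] action_add_left[OF sl_smult[OF u] IH(1) v]
      action_scale_left[OF u v] IH(2) by simp
qed

lemma action_expand:
  assumes X: "X \<in> sl r" and v: "v \<in> vspace M"
  shows "action M X v = (\<Sum>a=1..r. \<Sum>b=1..r. scale M (X $$ (a - 1, b - 1)) (action M (sl_unit r a b) v))"
  using action_sl_comb[OF v, of "{1..r} \<times> {1..r}" "\<lambda>x. X $$ (fst x - 1, snd x - 1)"]
  unfolding sl_comb_full[OF r X] by (simp add: sum.cartesian_product case_prod_unfold)

definition unit_op :: "nat \<Rightarrow> nat \<Rightarrow> 'v \<Rightarrow> 'v" where
  "unit_op a b = (SOME T. module_hom (scale M) (scale M) T \<and>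
     (\<forall>v\<in>vspace M. T v = action M (sl_unit r a b) v))"

lemma unit_op:
  assumes "a \<in> {1..r}" "b \<in> {1..r}"
  shows "module_hom (scale M) (scale M) (unit_op a b)"
    "v \<in> vspace M \<Longrightarrow> unit_op a b v = action M (sl_unit r a b) v"
proof -
  interpret trace_space "scale M" by unfold_locales
  have u: "sl_unit r a b \<in> sl r" by (rule sl_unit_in_sl[OF r assms])
  have "\<exists>T. module_hom (scale M) (scale M) T \<and> (\<forall>v\<in>vspace M. T v = action M (sl_unit r a b) v)"
    by (rule linear_extension[OF subspace_vspace action_add_right[OF u] action_scale_right[OF u]])
  from someI_ex[OF this] show "module_hom (scale M) (scale M) (unit_op a b)"
    "v \<in> vspace M \<Longrightarrow> unit_op a b v = action M (sl_unit r a b) v"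
    unfolding unit_op_def by blast+
qed

lemma unit_op_sl_operators: "sl_operators (scale M) r (vspace M) unit_op"
proof (intro sl_operators.intro sl_operators_axioms.intro trace_space.intro)
  show "vector_space (scale M)" by unfold_locales
  show "1 \<le> r" by (rule r)
  show "vs.subspace (vspace M)" by (rule subspace_vspace)
  show "\<exists>B. finite B \<and> vspace M = vs.span B" by (rule finite_vspace)
  show "module_hom (scale M) (scale M) (unit_op a b)" if "a \<in> {1..r}" "b \<in> {1..r}" for a b
    by (rule unit_op(1)[OF that])
  show in_V: "unit_op a b v \<in> vspace M" if "a \<in> {1..r}" "b \<in> {1..r}" "v \<in> vspace M" for a b v
    using unit_op(2)[OF that] action_in[OF sl_unit_in_sl[OF r that(1,2)] that(3)] by simp
  fix a b c d v assume a: "a \<in> {1..r}" and b: "b \<in> {1..r}" and c: "c \<in> {1..r}" and d: "d \<in> {1..r}"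
    and v: "v \<in> vspace M"
  note u = sl_unit_in_sl[OF r]
  have "unit_op c d (unit_op a b v) - unit_op a b (unit_op c d v) =
      action M (sl_unit r c d * sl_unit r a b - sl_unit r a b * sl_unit r c d) v"
    unfolding action_bracket[OF u[OF c d] u[OF a b] v]
    using unit_op(2)[OF a b] unit_op(2)[OF c d] v action_in[OF u[OF a b] v] action_in[OF u[OF c d] v] by simp
  also have "\<dots> = scale M (of_bool (d = a)) (unit_op c b v) + scale M (- of_bool (b = c)) (unit_op a d v)"
    unfolding sl_unit_commutator[OF a b c d] action_add_left[OF sl_smult[OF u[OF c b]] sl_smult[OF u[OF a d]] v]
      action_scale_left[OF u[OF c b] v] action_scale_left[OF u[OF a d] v] unit_op(2)[OF c b v] unit_op(2)[OF a d v] ..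
  also have "\<dots> = (if d = a then unit_op c b v else 0) - (if b = c then unit_op a d v else 0)"
    by (cases "d = a"; cases "b = c") simp_all
  finally show "unit_op c d (unit_op a b v) - unit_op a b (unit_op c d v) =
      (if d = a then unit_op c b v else 0) - (if b = c then unit_op a d v else 0)" .
qed

interpretation ops: sl_operators "scale M" r "vspace M" unit_op
  by (rule unit_op_sl_operators)

text \<open>In one direction the diagonal unit is tested; its correction -1/r contributes the
  coordinate sum of \<nu>, which is zero. In the other, a diagonal matrix is expanded in the units
  and only the diagonal ones survive.\<close>

lemma weight_space_eq_wsp:
  assumes \<nu>: "\<nu> \<in> weight_lattice r"
  shows "weight_space r M \<nu> = ops.wsp \<nu>"
proof
  have s0: "(\<Sum>i=1..r. \<nu> i) = 0" using \<nu> weight_lattice_iff[OF r] by (simp add: psum_def)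
  show "weight_space r M \<nu> \<subseteq> ops.wsp \<nu>"
  proof
    fix v assume v: "v \<in> weight_space r M \<nu>"
    then have vV: "v \<in> vspace M" by (simp add: weight_space_def)
    have "unit_op a a v = scale M (of_rat (\<nu> a)) v" if a: "a \<in> {1..r}" for a
    proof -
      have "diagonal_mat (sl_unit r a a)"
        using a by (auto simp: diagonal_mat_def sl_unit_def)
      then have "action M (sl_unit r a a) v = scale M (\<Sum>i=1..r. of_rat (\<nu> i) * sl_unit r a a $$ (i - 1, i - 1)) v"
        using v sl_unit_in_sl[OF r a a] by (auto simp: weight_space_def)
      also have "(\<Sum>i=1..r. of_rat (\<nu> i) * sl_unit r a a $$ (i - 1, i - 1)) =
          (\<Sum>i=1..r. (if i = a then of_rat (\<nu> a) else 0) - of_rat (\<nu> i) / of_nat r :: complex)"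
        using a by (intro sum.cong refl) (auto simp: sl_unit_index field_simps)
      also have "\<dots> = of_rat (\<nu> a) - of_rat (\<Sum>i=1..r. \<nu> i) / of_nat r"
        using a by (simp add: sum_subtractf sum_divide_distrib of_rat_sum)
      finally show ?thesis using s0 unit_op(2)[OF a a vV] by simp
    qed
    then show "v \<in> ops.wsp \<nu>" using vV by (simp add: ops.wsp_def)
  qed
  show "ops.wsp \<nu> \<subseteq> weight_space r M \<nu>"
  proof
    fix v assume v: "v \<in> ops.wsp \<nu>"
    then have vV: "v \<in> vspace M" by (rule ops.wsp_in_V)
    have "action M H v = scale M (\<Sum>i=1..r. of_rat (\<nu> i) * H $$ (i - 1, i - 1)) v"
      if H: "H \<in> sl r" "diagonal_mat H" for H
    proof -
      have "action M H v = (\<Sum>a=1..r. \<Sum>b=1..r. scale M (H $$ (a - 1, b - 1)) (action M (sl_unit r a b) v))"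
        by (rule action_expand[OF H(1) vV])
      also have "\<dots> = (\<Sum>a=1..r. \<Sum>b=1..r. if b = a then scale M (of_rat (\<nu> a) * H $$ (a - 1, a - 1)) v else 0)"
      proof (intro sum.cong refl)
        fix a b assume a: "a \<in> {1..r}" and b: "b \<in> {1..r}"
        show "scale M (H $$ (a - 1, b - 1)) (action M (sl_unit r a b) v) =
            (if b = a then scale M (of_rat (\<nu> a) * H $$ (a - 1, a - 1)) v else 0)"
        proof (cases "b = a")
          case True
          have "action M (sl_unit r a a) v = scale M (of_rat (\<nu> a)) v"
            using v a unit_op(2)[OF a a vV] by (simp add: ops.wsp_def)
          then show ?thesis using True by (simp add: mult.commute)
        next
          case False
          then have "H $$ (a - 1, b - 1) = 0"
            using H a b unfolding diagonal_mat_def sl_def by auto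
          then show ?thesis using False by simp
        qed
      qed
      also have "\<dots> = (\<Sum>a=1..r. scale M (of_rat (\<nu> a) * H $$ (a - 1, a - 1)) v)" by simp
      finally show ?thesis by (simp add: vs.scale_sum_left)
    qed
    then show "v \<in> weight_space r M \<nu>" using vV by (simp add: weight_space_def)
  qed
qed

lemma highest_weight_of_is_L:
  assumes L: "is_L r \<Lambda> M" and \<Lambda>: "\<Lambda> \<in> weight_lattice r"
  shows "\<exists>u. highest_weight (scale M) r (vspace M) unit_op \<Lambda> u"
proof -
  from L obtain u where u: "u \<in> weight_space r M \<Lambda>" "u \<noteq> 0"
    and raise: "\<forall>i j. i < j \<and> j < r \<longrightarrow> action M (mat r r (\<lambda>(a, b). if a = i \<and> b = j then 1 else 0)) u = 0"
    unfolding is_L_def has_highest_weight_def by blast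
  have uV: "u \<in> vspace M" using u by (simp add: weight_space_def)
  have "highest_weight (scale M) r (vspace M) unit_op \<Lambda> u"
  proof (intro highest_weight.intro highest_weight_axioms.intro unit_op_sl_operators)
    show "\<Lambda> \<in> weight_lattice r" "u \<noteq> 0" by fact+
    show "u \<in> sl_operators.wsp (scale M) r (vspace M) unit_op \<Lambda>"
      using u(1) weight_space_eq_wsp[OF \<Lambda>] by simp
    show "unit_op a b u = 0" if ab: "(a, b) \<in> root_pairs r" for a b
    proof -
      have a: "a \<in> {1..r}" "b \<in> {1..r}" "a < b" using ab by (auto simp: root_pairs_def)
      have "sl_unit r a b = mat r r (\<lambda>(i, j). if i = a - 1 \<and> j = b - 1 then 1 else 0)"
        using a by (intro eq_matI) (auto simp: sl_unit_def)
      moreover have "a - 1 < b - 1 \<and> b - 1 < r" using a by auto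
      ultimately show ?thesis using raise unit_op(2)[OF a(1,2) uV] by metis
    qed
    fix W assume W: "vs.subspace W" "W \<subseteq> vspace M"
      and closed: "\<And>a b v. a \<in> {1..r} \<Longrightarrow> b \<in> {1..r} \<Longrightarrow> v \<in> W \<Longrightarrow> unit_op a b v \<in> W"
    have "action M X v \<in> W" if X: "X \<in> sl r" and v: "v \<in> W" for X v
    proof -
      have vV: "v \<in> vspace M" using W v by blast
      show ?thesis
        unfolding action_expand[OF X vV]
        using closed[OF _ _ v] unit_op(2)[OF _ _ vV]
        by (intro vs.subspace_sum[OF W(1)] vs.subspace_scale[OF W(1)]) simp
    qed
    then show "W = {0} \<or> W = vspace M"
      using L W unfolding is_L_def sl_irreducible_def by blast
  qed
  then show ?thesis ..
qed

lemma freudenthal_ch: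
  assumes L: "is_L r \<Lambda> M" and \<Lambda>: "\<Lambda> \<in> weight_lattice r"
  shows "freudenthal r \<Lambda> (ch r M)"
proof -
  obtain u where "highest_weight (scale M) r (vspace M) unit_op \<Lambda> u"
    using highest_weight_of_is_L[OF L \<Lambda>] by blast
  then interpret hw: highest_weight "scale M" r "vspace M" unit_op \<Lambda> u .
  have dim: "vs.dim (weight_space r M \<nu>) = hw.mult \<nu>" if "\<nu> \<in> weight_lattice r" for \<nu>
    using hw.dim_wsp[of \<nu>] weight_space_eq_wsp[OF that] that weight_lattice_iff[OF r] by simp
  have triv: "hw.mult \<nu> = 0" if "\<nu> \<in> weight_lattice r" "weight_space r M \<nu> = {0}" for \<nu>
  proof -
    have "hw.basis_at \<nu> \<subseteq> {0}"
      using hw.span_basis_at_subset vs.span_superset that weight_space_eq_wsp by blast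
    moreover have "0 \<notin> hw.basis_at \<nu>" using vs.dependent_zero hw.basis_at_independent by blast
    ultimately have "hw.basis_at \<nu> = {}" by blast
    then show ?thesis by (simp add: hw.mult_def)
  qed
  have nontriv: "hw.mult \<nu> \<noteq> 0" if \<nu>: "\<nu> \<in> weight_lattice r" and ne: "weight_space r M \<nu> \<noteq> {0}" for \<nu>
  proof
    assume "hw.mult \<nu> = 0"
    then have "hw.basis_at \<nu> = {}" using hw.basis_at_finite by (simp add: hw.mult_def)
    then have "ops.wsp \<nu> = {0}"
      using hw.wsp_eq_span[of \<nu>] \<nu> weight_lattice_iff[OF r] by simp
    then show False using ne weight_space_eq_wsp[OF \<nu>] by simp
  qed
  have fin: "finite {\<nu>. \<nu> \<in> weight_lattice r \<and> weight_space r M \<nu> \<noteq> {0}}"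
    by (rule finite_subset[OF _ hw.finite_weights]) (use nontriv in blast)
  have "coef (ch r M) \<kappa> = int (hw.mult \<kappa>)" for \<kappa>
  proof -
    have "coef (ch r M) \<kappa> = (\<Sum>\<nu> | \<nu> \<in> weight_lattice r \<and> weight_space r M \<nu> \<noteq> {0}.
        if \<nu> = \<kappa> then int (hw.mult \<kappa>) else 0)"
      unfolding ch_def lookup_sum by (intro sum.cong refl) (auto simp: lookup_single when_def dim)
    also have "\<dots> = (if \<kappa> \<in> weight_lattice r \<and> weight_space r M \<kappa> \<noteq> {0} then int (hw.mult \<kappa>) else 0)"
      using fin by simp
    also have "\<dots> = int (hw.mult \<kappa>)"
      using triv[of \<kappa>] hw.mult_nonzero[of \<kappa>] hw.lowering_weight_lattice by auto
    finally show ?thesis .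
  qed
  then show ?thesis by (rule hw.freudenthal_multiplicities)
qed

end

theorem weyl_character_formula:
  assumes "1 \<le> r" "\<Lambda> \<in> dominant_weights r" "is_L r \<Lambda> M"
  shows "weyl_denom r * ch r M = alt_sum r (\<Lambda> + weyl_vector r)"
    and "freudenthal r \<Lambda> (ch r M)"
proof -
  show f: "freudenthal r \<Lambda> (ch r M)"
    using assms dominant_weights_iff[OF assms(1)] unfolding is_L_def
    by (intro freudenthal_ch) (auto simp: is_L_def)
  show "weyl_denom r * ch r M = alt_sum r (\<Lambda> + weyl_vector r)"
    by (rule freudenthal_character_formula[OF assms(1,2) f])
qed

section \<open>Complete homogeneous symmetric functions\<close>

definition shift_coord :: "nat \<Rightarrow> nat \<Rightarrow> weight \<Rightarrow> nat \<Rightarrow> rat" where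
  "shift_coord r m v i = v i + of_nat m / of_nat r"

text \<open>The weights of the \<open>m\<close>th symmetric power: \<open>v\<close> corresponds to the monomial with exponents
  \<open>v\<^sub>i + m / r\<close>.\<close>

definition sym_weights :: "nat \<Rightarrow> nat \<Rightarrow> weight set" where
  "sym_weights r m = {v. supported r v \<and> psum r v = 0 \<and> (\<forall>i\<in>{1..r}. shift_coord r m v i \<in> \<nat>)}"

definition complete_sym :: "nat \<Rightarrow> nat \<Rightarrow> weight \<Rightarrow>\<^sub>0 int" where
  "complete_sym r m = (\<Sum>v\<in>sym_weights r m. xpow v)"

lemma sum_shift_coord:
  assumes "1 \<le> r" "psum r v = 0"
  shows "(\<Sum>i=1..r. shift_coord r m v i) = of_nat m"
  using assms by (simp add: shift_coord_def sum.distrib psum_def)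

lemma shift_coord_nonneg: "v \<in> sym_weights r m \<Longrightarrow> i \<in> {1..r} \<Longrightarrow> 0 \<le> shift_coord r m v i"
proof -
  assume "v \<in> sym_weights r m" "i \<in> {1..r}"
  then have "shift_coord r m v i \<in> \<nat>" by (simp add: sym_weights_def)
  then show ?thesis by (auto elim: Nats_cases)
qed

lemma finite_sym_weights:
  assumes r: "1 \<le> r"
  shows "finite (sym_weights r m)"
proof (rule finite_subset)
  let ?f = "\<lambda>a::nat \<Rightarrow> nat. (\<lambda>i. if i \<in> {1..r} then of_nat (a i) - of_nat m / of_nat r else 0) :: weight"
  show "sym_weights r m \<subseteq> ?f ` ({1..r} \<rightarrow>\<^sub>E {0..m})"
  proof
    fix v assume v: "v \<in> sym_weights r m"
    have "\<forall>i\<in>{1..r}. \<exists>n::nat. shift_coord r m v i = of_nat n"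
      using v unfolding sym_weights_def Nats_def by blast
    then obtain a where a: "\<And>i. i \<in> {1..r} \<Longrightarrow> shift_coord r m v i = of_nat (a i :: nat)" by metis
    have s: "(\<Sum>i=1..r. shift_coord r m v i) = of_nat m"
      using v r by (intro sum_shift_coord) (auto simp: sym_weights_def)
    have le: "a i \<le> m" if i: "i \<in> {1..r}" for i
    proof -
      have "shift_coord r m v i \<le> (\<Sum>i=1..r. shift_coord r m v i)"
        using shift_coord_nonneg[OF v] i by (intro member_le_sum) auto
      then have "of_nat (a i) \<le> (of_nat m :: rat)" using s a[OF i] by simp
      then show ?thesis by (simp only: of_nat_le_iff)
    qed
    have "v = ?f (restrict a {1..r})"
    proof
      fix i
      show "v i = ?f (restrict a {1..r}) i"
      proof (cases "i \<in> {1..r}")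
        case True
        then show ?thesis using a[OF True] by (simp add: shift_coord_def algebra_simps)
      next
        case False
        then show ?thesis using v by (auto simp: sym_weights_def supported_def)
      qed
    qed
    moreover have "restrict a {1..r} \<in> {1..r} \<rightarrow>\<^sub>E {0..m}" using le by auto
    ultimately show "v \<in> ?f ` ({1..r} \<rightarrow>\<^sub>E {0..m})" by (rule image_eqI)
  qed
  show "finite (?f ` ({1..r} \<rightarrow>\<^sub>E {0..m}))" by (intro finite_imageI finite_PiE) auto
qed

lemma coef_complete_sym:
  "1 \<le> r \<Longrightarrow> coef (complete_sym r m) v = (if v \<in> sym_weights r m then 1 else 0)"
  using finite_sym_weights[of r m]
  by (simp add: complete_sym_def lookup_sum lookup_single when_def)

lemma supp_complete_sym: "1 \<le> r \<Longrightarrow> supp (complete_sym r m) = sym_weights r m"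
  by (auto simp: in_keys_iff coef_complete_sym split: if_splits)

lemma sym_weights_lattice:
  assumes "1 \<le> r" "v \<in> sym_weights r m"
  shows "v \<in> weight_lattice r"
proof -
  have "v i - v j = shift_coord r m v i - shift_coord r m v j" for i j
    by (simp add: shift_coord_def)
  then have "v i - v j \<in> \<int>" if "i \<in> {1..r}" "j \<in> {1..r}" for i j
    using that assms(2) Nats_subset_Ints by (auto simp: sym_weights_def intro!: Ints_diff)
  then show ?thesis
    using assms by (simp add: weight_lattice_iff sym_weights_def)
qed

lemma sym_weights_weyl_act:
  assumes "\<sigma> permutes {1..r}" "v \<in> sym_weights r m"
  shows "weyl_act \<sigma> v \<in> sym_weights r m"
proof -
  have "inv \<sigma> i \<in> {1..r}" if "i \<in> {1..r}" for i
    using that assms(1) by (meson permutes_in_image permutes_inv)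
  then show ?thesis
    using assms(2) supported_weyl_act[OF assms(1), of v] psum_weyl_act[OF assms(1), of v]
    unfolding sym_weights_def mem_Collect_eq shift_coord_def by (simp add: weyl_act_def)
qed

lemma sym_weights_weyl_act_iff:
  assumes "\<sigma> permutes {1..r}"
  shows "weyl_act \<sigma> v \<in> sym_weights r m \<longleftrightarrow> v \<in> sym_weights r m"
  using sym_weights_weyl_act[OF assms] sym_weights_weyl_act[OF permutes_inv[OF assms]]
    weyl_act_inv_cancel(2)[OF permutes_bij[OF assms]] by metis

lemma highest_sym_weight:
  assumes "1 \<le> r"
  shows "wscale (of_nat m) (fund_weight r 1) i =
    (if i \<in> {1..r} then (if i = 1 then of_nat m else 0) - of_nat m / of_nat r else 0)"
  using assms by (auto simp: wscale_def fund_weight_apply algebra_simps)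

lemma highest_sym_weight_dominant:
  assumes r: "1 \<le> r"
  shows "wscale (of_nat m) (fund_weight r 1) \<in> sym_weights r m"
    "wscale (of_nat m) (fund_weight r 1) \<in> dominant_weights r"
proof -
  let ?\<Lambda> = "wscale (of_nat m) (fund_weight r 1)"
  have "supported r ?\<Lambda>" unfolding supported_def highest_sym_weight[OF r] by auto
  moreover have "psum r ?\<Lambda> = 0"
  proof -
    have "psum r ?\<Lambda> = (\<Sum>i=1..r. (if i = 1 then of_nat m else 0) - of_nat m / of_nat r)"
      unfolding psum_def by (intro sum.cong refl) (subst highest_sym_weight[OF r], auto)
    then show ?thesis using r by (simp add: sum_subtractf)
  qed
  moreover have "shift_coord r m ?\<Lambda> i \<in> \<nat>" if "i \<in> {1..r}" for i
    unfolding shift_coord_def highest_sym_weight[OF r] using that by auto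
  ultimately show S: "?\<Lambda> \<in> sym_weights r m" by (simp add: sym_weights_def)
  have "?\<Lambda> (k + 1) \<le> ?\<Lambda> k" if "k \<in> {1..<r}" for k
    unfolding highest_sym_weight[OF r] using that by auto
  then show "?\<Lambda> \<in> dominant_weights r"
    using sym_weights_lattice[OF r S] by (simp add: dominant_weights_iff[OF r])
qed

lemma dominated_complete_sym:
  assumes r: "1 \<le> r"
  shows "dominated r (wscale (of_nat m) (fund_weight r 1)) (complete_sym r m)"
  unfolding dominated_def supp_complete_sym[OF r]
proof (intro conjI ballI)
  let ?\<Lambda> = "wscale (of_nat m) (fund_weight r 1)"
  show "supported r ?\<Lambda>" using highest_sym_weight_dominant(1)[OF r] by (simp add: sym_weights_def)
  fix v assume v: "v \<in> sym_weights r m"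
  then show "supported r v" by (simp add: sym_weights_def)
  fix k assume k: "k \<in> {1..r}"
  have "psum k v = (\<Sum>i=1..k. shift_coord r m v i) - of_nat k * (of_nat m / of_nat r)"
    by (simp add: psum_def shift_coord_def sum.distrib)
  also have "(\<Sum>i=1..k. shift_coord r m v i) \<le> (\<Sum>i=1..r. shift_coord r m v i)"
    using k shift_coord_nonneg[OF v] by (intro sum_mono2) auto
  also have "(\<Sum>i=1..r. shift_coord r m v i) = of_nat m"
    using v r by (intro sum_shift_coord) (auto simp: sym_weights_def)
  also have "of_nat m - of_nat k * (of_nat m / of_nat r) = psum k ?\<Lambda>"
  proof -
    have "psum k ?\<Lambda> = (\<Sum>i=1..k. (if i = 1 then of_nat m else 0) - of_nat m / of_nat r)"
      unfolding psum_def using k by (intro sum.cong refl) (subst highest_sym_weight[OF r], auto)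
    then show ?thesis using k by (simp add: sum_subtractf)
  qed
  finally show "psum k v \<le> psum k ?\<Lambda>" by simp
qed

text \<open>Writing 2 x_b = (x_a + x_b) - (x_a - x_b) separates a symmetric sum over pairs from a
  pairing with 2\<delta>.\<close>

lemma sum_root_pairs_right:
  fixes x :: "nat \<Rightarrow> rat"
  assumes "1 \<le> r"
  shows "2 * (\<Sum>(a, b)\<in>root_pairs r. x b) = (of_nat r - 1) * (\<Sum>i=1..r. x i) - 2 * ip r x (weyl_vector r)"
proof -
  have "(\<Sum>a=1..r. \<Sum>b=1..r. x a) = (\<Sum>i=1..r. x i) + (\<Sum>(a, b)\<in>root_pairs r. x a + x b)"
    by (rule sum_square_split)
  then have "(\<Sum>(a, b)\<in>root_pairs r. x a + x b) = (of_nat r - 1) * (\<Sum>i=1..r. x i)"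
    by (simp add: sum_distrib_left[symmetric] left_diff_distrib)
  moreover have "(\<Sum>(a, b)\<in>root_pairs r. x a + x b) - (\<Sum>(a, b)\<in>root_pairs r. x a - x b) =
      2 * (\<Sum>(a, b)\<in>root_pairs r. x b)"
    unfolding sum_subtractf[symmetric] sum_distrib_left by (intro sum.cong refl) auto
  ultimately show ?thesis unfolding weyl_vector_pairs by simp
qed

lemma sum_root_pairs_product:
  fixes x :: "nat \<Rightarrow> rat"
  shows "2 * (\<Sum>(a, b)\<in>root_pairs r. x a * x b) = (\<Sum>i=1..r. x i)\<^sup>2 - (\<Sum>i=1..r. x i * x i)"
proof -
  have "(\<Sum>i=1..r. x i)\<^sup>2 = (\<Sum>a=1..r. \<Sum>b=1..r. x a * x b)"
    by (simp add: power2_eq_square sum_product)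
  also have "\<dots> = (\<Sum>i=1..r. x i * x i) + (\<Sum>(a, b)\<in>root_pairs r. x a * x b + x b * x a)"
    by (rule sum_square_split)
  also have "(\<Sum>(a, b)\<in>root_pairs r. x a * x b + x b * x a) = 2 * (\<Sum>(a, b)\<in>root_pairs r. x a * x b)"
    unfolding sum_distrib_left by (intro sum.cong refl) auto
  finally show ?thesis by simp
qed

lemma shift_coord_ip:
  assumes r: "1 \<le> r" and v: "psum r v = 0"
  shows "(\<Sum>i=1..r. shift_coord r m v i * shift_coord r m v i) = ip r v v + of_nat m * of_nat m / of_nat r"
    "ip r (shift_coord r m v) (weyl_vector r) = ip r v (weyl_vector r)"
proof -
  have s: "(\<Sum>i=1..r. v i) = 0" using v by (simp add: psum_def)
  have "(\<Sum>i=1..r. shift_coord r m v i * shift_coord r m v i) =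
      (\<Sum>i=1..r. v i * v i + 2 * (of_nat m / of_nat r) * v i + (of_nat m / of_nat r) * (of_nat m / of_nat r))"
    by (intro sum.cong refl) (simp add: shift_coord_def algebra_simps)
  also have "\<dots> = ip r v v + 2 * (of_nat m / of_nat r) * (\<Sum>i=1..r. v i) + of_nat r * ((of_nat m / of_nat r) * (of_nat m / of_nat r))"
    by (simp add: ip_def sum.distrib sum_distrib_left)
  also have "\<dots> = ip r v v + of_nat m * of_nat m / of_nat r" unfolding s using r by simp
  finally show "(\<Sum>i=1..r. shift_coord r m v i * shift_coord r m v i) = ip r v v + of_nat m * of_nat m / of_nat r" .
  have "(\<Sum>i=1..r. weyl_vector r i) = 0" using psum_weyl_vector[of r r] by (simp add: psum_def)
  moreover have "ip r (shift_coord r m v) (weyl_vector r) =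
      ip r v (weyl_vector r) + of_nat m / of_nat r * (\<Sum>i=1..r. weyl_vector r i)"
    unfolding ip_def sum_distrib_left sum.distrib[symmetric]
    by (intro sum.cong refl) (simp add: shift_coord_def algebra_simps)
  ultimately show "ip r (shift_coord r m v) (weyl_vector r) = ip r v (weyl_vector r)" by simp
qed

text \<open>The right side comes from polynomials, where \<open>E a b\<close> is multiplication by
  the a-th variable after differentiation by the b-th: \<open>E b a\<close> after
  \<open>E a b\<close> scales a monomial with exponents x by x_b (x_a + 1). The sum over pairs is a
  constant minus the Casimir eigenvalue at v, and the highest weight determines the
  constant.\<close>

lemma sym_weights_casimir:
  assumes r: "1 \<le> r" and v: "v \<in> sym_weights r m"
  shows "ip r (wscale (of_nat m) (fund_weight r 1)) (wscale (of_nat m) (fund_weight r 1) + wscale 2 (weyl_vector r))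
      - ip r v (v + wscale 2 (weyl_vector r)) =
    2 * (\<Sum>(a, b)\<in>root_pairs r. shift_coord r m v b * (shift_coord r m v a + 1))"
proof -
  have eq: "2 * (\<Sum>(a, b)\<in>root_pairs r. shift_coord r m v b * (shift_coord r m v a + 1)) =
      of_nat m * of_nat m - of_nat m * of_nat m / of_nat r + (of_nat r - 1) * of_nat m
      - ip r v (v + wscale 2 (weyl_vector r))" if "v \<in> sym_weights r m" for v
  proof -
    let ?x = "shift_coord r m v"
    have p: "psum r v = 0" using that by (simp add: sym_weights_def)
    have "2 * (\<Sum>(a, b)\<in>root_pairs r. ?x b * (?x a + 1)) =
        2 * (\<Sum>(a, b)\<in>root_pairs r. ?x a * ?x b) + 2 * (\<Sum>(a, b)\<in>root_pairs r. ?x b)"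
      unfolding distrib_left[symmetric] sum.distrib[symmetric]
      by (intro arg_cong[where f = "(*) 2"] sum.cong refl) (auto simp: algebra_simps)
    also have "\<dots> = (of_nat m)\<^sup>2 - (ip r v v + of_nat m * of_nat m / of_nat r)
        + ((of_nat r - 1) * of_nat m - 2 * ip r v (weyl_vector r))"
      unfolding sum_root_pairs_product sum_root_pairs_right[OF r] sum_shift_coord[OF r p] shift_coord_ip[OF r p] ..
    finally show ?thesis by (simp add: ip_linear power2_eq_square)
  qed
  let ?\<Lambda> = "wscale (of_nat m) (fund_weight r 1)"
  \<comment> \<open>The highest weight corresponds to a power of the first variable, and in every
    pair b is at least 2, so the exponent x_b is zero.\<close>
  have "(\<Sum>(a, b)\<in>root_pairs r. shift_coord r m ?\<Lambda> b * (shift_coord r m ?\<Lambda> a + 1)) = 0"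
  proof (intro sum.neutral ballI)
    fix x assume "x \<in> root_pairs r"
    then obtain a b where x: "x = (a, b)" "b \<in> {1..r}" "b \<noteq> 1" by (auto simp: root_pairs_def)
    then have "shift_coord r m ?\<Lambda> b = 0" unfolding shift_coord_def highest_sym_weight[OF r] by simp
    then show "(case x of (a, b) \<Rightarrow> shift_coord r m ?\<Lambda> b * (shift_coord r m ?\<Lambda> a + 1)) = 0" by (simp add: x)
  qed
  then have "of_nat m * of_nat m - of_nat m * of_nat m / of_nat r + (of_nat r - 1) * of_nat m =
      ip r ?\<Lambda> (?\<Lambda> + wscale 2 (weyl_vector r))"
    using eq[OF highest_sym_weight_dominant(1)[OF r]] by simp
  then show ?thesis using eq[OF v] by simp
qed

text \<open>Inside the simplex of exponents this is an identity of polynomials in x and y. At its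
  two ends y = 0 or x = -1, and y (x + 1) vanishes in both cases, so truncating to the simplex
  preserves the difference equation.\<close>

lemma sym_weights_string:
  fixes v :: weight and m :: nat
  assumes ab: "(a, b) \<in> root_pairs r"
  defines "x \<equiv> shift_coord r m v a" and "y \<equiv> shift_coord r m v b"
  shows "(if v \<in> sym_weights r m then y * (x + 1) else 0) -
      (if v + (eps a - eps b) \<in> sym_weights r m then (y - 1) * (x + 2) else 0) =
      (if v + (eps a - eps b) \<in> sym_weights r m then x - y + 2 else 0)"
proof -
  have a: "a \<in> {1..r}" "b \<in> {1..r}" "a \<noteq> b" using ab by (auto simp: root_pairs_def)
  define w where "w = v + (eps a - eps b)"
  have v_eq: "v = w - (eps a - eps b)" by (simp add: w_def)
  have sup: "supported r w \<longleftrightarrow> supported r v"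
    using supported_add[of r v "eps a - eps b"] supported_diff[of r w "eps a - eps b"]
      supported_diff[OF supported_eps[OF a(1)] supported_eps[OF a(2)]] unfolding w_def by auto
  have "psum r (eps a - eps b) = 0" using a by (auto simp: psum_diff psum_eps)
  then have ps: "psum r w = psum r v" by (simp only: w_def psum_add add_0_right)
  have coords: "shift_coord r m w a = x + 1" "shift_coord r m w b = y - 1"
    "\<And>i. i \<noteq> a \<Longrightarrow> i \<noteq> b \<Longrightarrow> shift_coord r m w i = shift_coord r m v i"
    using a by (simp_all add: shift_coord_def w_def x_def y_def eps_def)
  define rest where "rest \<longleftrightarrow> supported r v \<and> psum r v = 0 \<and> (\<forall>i\<in>{1..r}-{a,b}. shift_coord r m v i \<in> \<nat>)"
  have split: "(\<forall>i\<in>{1..r}. P i) \<longleftrightarrow> P a \<and> P b \<and> (\<forall>i\<in>{1..r}-{a,b}. P i)" for P :: "nat \<Rightarrow> bool"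
    using a by blast
  have S: "v \<in> sym_weights r m \<longleftrightarrow> rest \<and> x \<in> \<nat> \<and> y \<in> \<nat>"
    "w \<in> sym_weights r m \<longleftrightarrow> rest \<and> x + 1 \<in> \<nat> \<and> y - 1 \<in> \<nat>"
    unfolding sym_weights_def mem_Collect_eq split rest_def sup ps coords(1,2)
    using coords(3) by (auto simp: x_def y_def)
  have step: "z \<in> \<nat> \<Longrightarrow> z + 1 \<in> \<nat>" for z :: rat by simp
  have down: "z \<in> \<nat> \<Longrightarrow> z \<noteq> 0 \<Longrightarrow> z - 1 \<in> \<nat>" for z :: rat
  proof (elim Nats_cases)
    fix n assume "z \<noteq> 0" "z = of_nat n"
    then have "z - 1 = of_nat (n - 1)" by (cases n) auto
    then show "z - 1 \<in> \<nat>" by (metis of_nat_in_Nats)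
  qed
  have "(if v \<in> sym_weights r m then y * (x + 1) else 0) -
      (if w \<in> sym_weights r m then (y - 1) * (x + 2) else 0) =
      (if w \<in> sym_weights r m then x - y + 2 else 0)"
  proof (cases "v \<in> sym_weights r m"; cases "w \<in> sym_weights r m")
    assume "v \<in> sym_weights r m" "w \<in> sym_weights r m"
    then show ?thesis by (simp add: algebra_simps)
  next
    assume v: "v \<in> sym_weights r m" and w: "w \<notin> sym_weights r m"
    then have "y = 0" using S step[of x] down[of y] by blast
    then show ?thesis using v w by simp
  next
    assume v: "v \<notin> sym_weights r m" and w: "w \<in> sym_weights r m"
    then have "x \<notin> \<nat>" using S step[of "y - 1"] by auto
    then have "x + 1 = 0" using S w down[of "x + 1"] by auto
    then have "x = -1" by linarith
    then show ?thesis using v w by simp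
  next
    assume "v \<notin> sym_weights r m" "w \<notin> sym_weights r m"
    then show ?thesis by simp
  qed
  then show ?thesis unfolding w_def .
qed

lemma freudenthal_complete_sym:
  assumes r: "1 \<le> r"
  shows "freudenthal r (wscale (of_nat m) (fund_weight r 1)) (complete_sym r m)"
  unfolding freudenthal_def
proof (intro conjI)
  let ?\<Lambda> = "wscale (of_nat m) (fund_weight r 1)"
  show "dominated r ?\<Lambda> (complete_sym r m)" by (rule dominated_complete_sym[OF r])
  show "coef (complete_sym r m) ?\<Lambda> = 1"
    unfolding coef_complete_sym[OF r] using highest_sym_weight_dominant(1)[OF r] by (simp only: if_True)
  show "lattice_supp r (complete_sym r m)"
    unfolding lattice_supp_def supp_complete_sym[OF r] using sym_weights_lattice[OF r] by blast
  show "invariant r (complete_sym r m)"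
    unfolding invariant_def
  proof (intro allI impI poly_mapping_eqI)
    fix \<sigma> v assume \<sigma>: "\<sigma> permutes {1..r}"
    show "coef (wact \<sigma> (complete_sym r m)) v = coef (complete_sym r m) v"
      by (simp add: coef_wact[OF permutes_bij[OF \<sigma>]] coef_complete_sym[OF r]
          sym_weights_weyl_act_iff[OF permutes_inv[OF \<sigma>]])
  qed
  \<comment> \<open>The eigenvalue of \<open>E b a\<close> after \<open>E a b\<close> on the
    monomial with weight v, in the realisation of the symmetric power by polynomials.\<close>
  define g where "g a b v = (if v \<in> sym_weights r m then shift_coord r m v b * (shift_coord r m v a + 1) else 0)" for a b v
  define t where "t a b = (Abs_poly_mapping (\<lambda>v. of_rat (g a b v)) :: weight \<Rightarrow>\<^sub>0 complex)" for a b
  have t: "coef (t a b) v = of_rat (g a b v)" for a b v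
  proof -
    have "{v. (of_rat (g a b v) :: complex) \<noteq> 0} \<subseteq> sym_weights r m" by (auto simp: g_def)
    then have "finite {v. (of_rat (g a b v) :: complex) \<noteq> 0}"
      by (rule finite_subset[OF _ finite_sym_weights[OF r]])
    then show ?thesis unfolding t_def by (simp add: lookup_Abs_poly_mapping)
  qed
  show "\<exists>t :: nat \<Rightarrow> nat \<Rightarrow> weight \<Rightarrow>\<^sub>0 complex.
       (\<forall>(a, b)\<in>root_pairs r. \<forall>v.
          coef (t a b) v - coef (t a b) (v + (eps a - eps b)) =
            of_rat (ip r (v + (eps a - eps b)) (eps a - eps b)) * of_int (coef (complete_sym r m) (v + (eps a - eps b)))) \<and>
       (\<forall>v. of_rat (ip r ?\<Lambda> (?\<Lambda> + wscale 2 (weyl_vector r)) - ip r v (v + wscale 2 (weyl_vector r))) *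
              of_int (coef (complete_sym r m) v) = 2 * (\<Sum>(a, b)\<in>root_pairs r. coef (t a b) v))"
  proof (intro exI[of _ t] conjI allI ballI)
    fix x assume x: "x \<in> root_pairs r"
    obtain a b where ab: "x = (a, b)" by force
    have step: "coef (t a b) v - coef (t a b) (v + (eps a - eps b)) =
        of_rat (ip r (v + (eps a - eps b)) (eps a - eps b)) * of_int (coef (complete_sym r m) (v + (eps a - eps b)))" for v
    proof -
      have a: "a \<in> {1..r}" "b \<in> {1..r}" "a \<noteq> b" using x ab by (auto simp: root_pairs_def)
      have sc: "shift_coord r m (v + (eps a - eps b)) a = shift_coord r m v a + 1"
        "shift_coord r m (v + (eps a - eps b)) b = shift_coord r m v b - 1"
        using a by (simp_all add: shift_coord_def eps_def)
      have "ip r (v + (eps a - eps b)) (eps a - eps b) = (v + (eps a - eps b)) a - (v + (eps a - eps b)) b"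
        by (simp only: ip_diff_right ip_eps_right[OF a(1)] ip_eps_right[OF a(2)])
      also have "\<dots> = shift_coord r m v a - shift_coord r m v b + 2"
        using a by (simp add: shift_coord_def eps_def)
      finally have ipe: "ip r (v + (eps a - eps b)) (eps a - eps b) = shift_coord r m v a - shift_coord r m v b + 2" .
      have "g a b v - g a b (v + (eps a - eps b)) =
          (if v + (eps a - eps b) \<in> sym_weights r m then shift_coord r m v a - shift_coord r m v b + 2 else 0)"
        using sym_weights_string[of a b r v m] x unfolding ab g_def sc
        by (simp only: add.assoc one_add_one)
      then have "of_rat (g a b v - g a b (v + (eps a - eps b))) = (of_rat (ip r (v + (eps a - eps b)) (eps a - eps b)) *
          of_int (coef (complete_sym r m) (v + (eps a - eps b))) :: complex)"
        unfolding ipe coef_complete_sym[OF r] by (simp split: if_split)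
      then show ?thesis unfolding t of_rat_diff .
    qed
    show "case x of (a, b) \<Rightarrow> \<forall>v. coef (t a b) v - coef (t a b) (v + (eps a - eps b)) =
        of_rat (ip r (v + (eps a - eps b)) (eps a - eps b)) * of_int (coef (complete_sym r m) (v + (eps a - eps b)))"
      unfolding ab case_prod_conv using step by blast
  next
    fix v
    show "of_rat (ip r ?\<Lambda> (?\<Lambda> + wscale 2 (weyl_vector r)) - ip r v (v + wscale 2 (weyl_vector r))) *
              of_int (coef (complete_sym r m) v) = 2 * (\<Sum>(a, b)\<in>root_pairs r. coef (t a b) v)"
    proof (cases "v \<in> sym_weights r m")
      case True
      then show ?thesis
        unfolding sym_weights_casimir[OF r True] t g_def coef_complete_sym[OF r]
        by (simp add: of_rat_mult of_rat_sum case_prod_unfold)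
    next
      case False
      then show ?thesis unfolding t g_def coef_complete_sym[OF r] by (simp add: case_prod_unfold)
    qed
  qed
qed

theorem ch_symmetric_power:
  assumes r: "1 \<le> r" and L: "is_L r (wscale (of_nat m) (fund_weight r 1)) M"
  shows "ch r M = complete_sym r m"
proof -
  note \<Lambda> = highest_sym_weight_dominant(2)[OF r, of m]
  have "weyl_denom r * ch r M = weyl_denom r * complete_sym r m"
    unfolding weyl_character_formula(1)[OF r \<Lambda> L]
      freudenthal_character_formula[OF r \<Lambda> freudenthal_complete_sym[OF r]] ..
  then show ?thesis by (rule weyl_denom_cancel)
qed

section \<open>Adams operations\<close>

lemma wact_adams:
  assumes b: "bij \<sigma>"
  shows "wact \<sigma> (adams p f) = adams p (wact \<sigma> f)"
proof -
  have "wact \<sigma> (adams p f) = (\<Sum>\<nu>\<in>supp f. Poly_Mapping.single (wscale (of_nat p) (weyl_act \<sigma> \<nu>)) (coef f \<nu>))"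
    unfolding adams_def wact_sum[OF b] by (intro sum.cong refl) (simp add: wact_single[OF b] weyl_act_wscale)
  also have "\<dots> = (\<Sum>\<nu>\<in>supp f. Poly_Mapping.single (wscale (of_nat p) (weyl_act \<sigma> \<nu>)) (coef (wact \<sigma> f) (weyl_act \<sigma> \<nu>)))"
    unfolding coef_wact[OF b] weyl_act_inv_cancel(2)[OF b] ..
  also have "\<dots> = adams p (wact \<sigma> f)"
    unfolding adams_def supp_wact[OF b]
    by (rule sum.reindex[unfolded o_def, symmetric]) (rule inj_on_subset[OF inj_weyl_act[OF b] subset_UNIV])
  finally show ?thesis .
qed

lemma invariant_adams: "invariant r f \<Longrightarrow> invariant r (adams p f)"
  by (simp add: invariant_def wact_adams permutes_bij)

lemma lattice_supp_adams:
  assumes "1 \<le> r" "lattice_supp r f"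
  shows "lattice_supp r (adams p f)"
proof -
  have "supp (adams p f) \<subseteq> (\<Union>\<nu>\<in>supp f. supp (Poly_Mapping.single (wscale (of_nat p) \<nu>) (coef f \<nu>)))"
    unfolding adams_def by (rule keys_sum)
  also have "\<dots> \<subseteq> (\<lambda>\<nu>. wscale (of_nat p) \<nu>) ` supp f" by auto
  finally show ?thesis
    using assms weight_lattice_wscale[of r _ "of_nat p"] unfolding lattice_supp_def by fastforce
qed

text \<open>After multiplication by the Weyl denominator, the decomposition into characters is the expansion
  of an alternating element.\<close>

lemma character_decomposition:
  fixes L :: "weight \<Rightarrow> 'v::ab_group_add sl_rep"
  assumes r: "1 \<le> r" and L: "\<And>\<nu>. \<nu> \<in> dominant_weights r \<Longrightarrow> is_L r \<nu> (L \<nu>)"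
    and f: "invariant r f" "lattice_supp r f"
  shows "\<exists>!m. supp m \<subseteq> dominant_weights r \<and>
    f = (\<Sum>\<mu>\<in>supp m. Poly_Mapping.single 0 (coef m \<mu>) * ch r (L \<mu>))"
proof -
  let ?\<delta> = "weyl_vector r"
  let ?g = "weyl_denom r * f"
  have expand: "weyl_denom r * (\<Sum>\<mu>\<in>supp m. Poly_Mapping.single 0 (coef m \<mu>) * ch r (L \<mu>)) =
      (\<Sum>\<mu>\<in>supp m. Poly_Mapping.single 0 (coef m \<mu>) * alt_sum r (\<mu> + ?\<delta>))"
    if "supp m \<subseteq> dominant_weights r" for m
    unfolding sum_distrib_left
  proof (intro sum.cong refl)
    fix \<mu> assume "\<mu> \<in> supp m"
    then have "\<mu> \<in> dominant_weights r" using that by blast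
    then show "weyl_denom r * (Poly_Mapping.single 0 (coef m \<mu>) * ch r (L \<mu>)) =
        Poly_Mapping.single 0 (coef m \<mu>) * alt_sum r (\<mu> + ?\<delta>)"
      using weyl_character_formula(1)[OF r _ L] by (simp only: mult.left_commute[of "weyl_denom r"])
  qed
  have sd: "strictly_dominant r (\<mu> + ?\<delta>)" if "\<mu> \<in> dominant_weights r" for \<mu>
    using that dominant_add_weyl_vector_iff[OF r] by blast
  define A where "A = {v \<in> supp ?g. strictly_dominant r v}"
  have finA: "finite A" unfolding A_def by simp
  have lat: "lattice_supp r ?g" by (intro lattice_supp_times[OF r] lattice_supp_weyl_denom r f)
  have A_dom: "v - ?\<delta> \<in> dominant_weights r" if "v \<in> A" for v
    using that lat unfolding A_def lattice_supp_def dominant_add_weyl_vector_iff[OF r] by auto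
  define m where "m = (\<Sum>v\<in>A. Poly_Mapping.single (v - ?\<delta>) (coef ?g v))"
  have coef_m: "coef m \<mu> = (if \<mu> + ?\<delta> \<in> A then coef ?g (\<mu> + ?\<delta>) else 0)" for \<mu>
  proof -
    have "coef m \<mu> = (\<Sum>v\<in>A. if v = \<mu> + ?\<delta> then coef ?g (\<mu> + ?\<delta>) else 0)"
      unfolding m_def lookup_sum
    proof (intro sum.cong refl)
      fix v
      have "v - ?\<delta> = \<mu> \<longleftrightarrow> v = \<mu> + ?\<delta>" by (simp only: diff_eq_eq)
      then show "coef (Poly_Mapping.single (v - ?\<delta>) (coef ?g v)) \<mu> = (if v = \<mu> + ?\<delta> then coef ?g (\<mu> + ?\<delta>) else 0)"
        by (simp only: lookup_single when_def) auto
    qed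
    then show ?thesis using finA by simp
  qed
  have supp_m: "supp m = (\<lambda>v. v - ?\<delta>) ` A"
  proof (rule Set.set_eqI)
    fix \<mu>
    have "\<mu> \<in> supp m \<longleftrightarrow> \<mu> + ?\<delta> \<in> A" unfolding in_keys_iff coef_m by (auto simp: A_def in_keys_iff)
    also have "\<dots> \<longleftrightarrow> \<mu> \<in> (\<lambda>v. v - ?\<delta>) ` A"
      by (metis (no_types, lifting) add_diff_cancel diff_add_cancel imageE image_eqI)
    finally show "\<mu> \<in> supp m \<longleftrightarrow> \<mu> \<in> (\<lambda>v. v - ?\<delta>) ` A" .
  qed
  have m_dom: "supp m \<subseteq> dominant_weights r" unfolding supp_m using A_dom by blast
  have "?g = (\<Sum>v\<in>A. Poly_Mapping.single 0 (coef ?g v) * alt_sum r v)"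
    by (rule alternating_expansion[OF alternating_times_invariant[OF alternating_weyl_denom f(1)] finA])
      (simp_all add: A_def)
  also have "\<dots> = (\<Sum>v\<in>A. Poly_Mapping.single 0 (coef m (v - ?\<delta>)) * alt_sum r (v - ?\<delta> + ?\<delta>))"
    unfolding coef_m diff_add_cancel by (intro sum.cong refl) simp
  also have "\<dots> = (\<Sum>\<mu>\<in>supp m. Poly_Mapping.single 0 (coef m \<mu>) * alt_sum r (\<mu> + ?\<delta>))"
    unfolding supp_m by (rule sum.reindex[unfolded o_def, symmetric]) (rule inj_onI, simp only: diff_eq_eq diff_add_cancel)
  finally have "weyl_denom r * f = weyl_denom r * (\<Sum>\<mu>\<in>supp m. Poly_Mapping.single 0 (coef m \<mu>) * ch r (L \<mu>))"
    unfolding expand[OF m_dom] .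
  then have m_f: "f = (\<Sum>\<mu>\<in>supp m. Poly_Mapping.single 0 (coef m \<mu>) * ch r (L \<mu>))"
    by (rule weyl_denom_cancel)
  \<comment> \<open>At the strictly dominant exponent \<mu> + \<delta> all but one of the
    alternating sums have coefficient zero, so every decomposition exhibits the same number
    there.\<close>
  have coef_unique: "coef m' \<mu> = (if \<mu> \<in> dominant_weights r then coef ?g (\<mu> + ?\<delta>) else 0)"
    if dom: "supp m' \<subseteq> dominant_weights r"
      and eq: "f = (\<Sum>\<mu>\<in>supp m'. Poly_Mapping.single 0 (coef m' \<mu>) * ch r (L \<mu>))" for m' \<mu>
  proof (cases "\<mu> \<in> dominant_weights r")
    case True
    have "?g = (\<Sum>\<mu>\<in>supp m'. Poly_Mapping.single 0 (coef m' \<mu>) * alt_sum r (\<mu> + ?\<delta>))"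
      by (subst eq) (rule expand[OF dom])
    then have "coef ?g (\<mu> + ?\<delta>) = (\<Sum>\<nu>\<in>supp m'. coef m' \<nu> * coef (alt_sum r (\<nu> + ?\<delta>)) (\<mu> + ?\<delta>))"
      by (simp only: lookup_sum coef_single_0_times)
    also have "\<dots> = (\<Sum>\<nu>\<in>supp m'. if \<nu> = \<mu> then coef m' \<mu> else 0)"
    proof (intro sum.cong refl)
      fix \<nu> assume "\<nu> \<in> supp m'"
      then have "strictly_dominant r (\<nu> + ?\<delta>)" using dom sd by blast
      moreover have "\<nu> + ?\<delta> = \<mu> + ?\<delta> \<longleftrightarrow> \<nu> = \<mu>" by (simp only: add_right_cancel)
      ultimately show "coef m' \<nu> * coef (alt_sum r (\<nu> + ?\<delta>)) (\<mu> + ?\<delta>) = (if \<nu> = \<mu> then coef m' \<mu> else 0)"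
        using coef_alt_sum_strictly_dominant[OF _ sd[OF True], of "\<nu> + ?\<delta>", where 'a = int] by auto
    qed
    also have "\<dots> = coef m' \<mu>" by (simp add: in_keys_iff)
    finally show ?thesis using True by simp
  next
    case False
    then show ?thesis using dom by (auto simp: in_keys_iff)
  qed
  show ?thesis
  proof (rule ex1I[of _ m])
    show "supp m \<subseteq> dominant_weights r \<and> f = (\<Sum>\<mu>\<in>supp m. Poly_Mapping.single 0 (coef m \<mu>) * ch r (L \<mu>))"
      using m_dom m_f by blast
    fix m' assume m': "supp m' \<subseteq> dominant_weights r \<and> f = (\<Sum>\<mu>\<in>supp m'. Poly_Mapping.single 0 (coef m' \<mu>) * ch r (L \<mu>))"
    show "m' = m"
      by (rule poly_mapping_eqI)
        (simp only: coef_unique[OF conjunct1[OF m'] conjunct2[OF m']] coef_unique[OF m_dom m_f])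
  qed
qed

text \<open>Unique existence makes the definite description meaningful; later steps use the
  decomposition in the form multiplied by the denominator.\<close>

lemma adams_coeffs:
  fixes L :: "weight \<Rightarrow> 'v::ab_group_add sl_rep" and p :: nat
  assumes r: "1 \<le> r" and L: "\<And>\<nu>. \<nu> \<in> dominant_weights r \<Longrightarrow> is_L r \<nu> (L \<nu>)"
    and \<nu>: "\<nu> \<in> dominant_weights r"
  defines "m \<equiv> adams_coeffs L r p \<nu>"
  shows "supp m \<subseteq> dominant_weights r"
    "weyl_denom r * adams p (ch r (L \<nu>)) =
      (\<Sum>\<mu>\<in>supp m. Poly_Mapping.single 0 (coef m \<mu>) * alt_sum r (\<mu> + weyl_vector r))"
proof -
  have f: "invariant r (adams p (ch r (L \<nu>)))" "lattice_supp r (adams p (ch r (L \<nu>)))"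
    using weyl_character_formula(2)[OF r \<nu> L[OF \<nu>]]
    by (auto simp: freudenthal_def intro: invariant_adams lattice_supp_adams[OF r])
  have m: "supp m \<subseteq> dominant_weights r \<and>
    adams p (ch r (L \<nu>)) = (\<Sum>\<mu>\<in>supp m. Poly_Mapping.single 0 (coef m \<mu>) * ch r (L \<mu>))"
    unfolding m_def adams_coeffs_def by (rule theI'[OF character_decomposition[OF r L f]])
  then show dom: "supp m \<subseteq> dominant_weights r" by blast
  have "weyl_denom r * adams p (ch r (L \<nu>)) =
      weyl_denom r * (\<Sum>\<mu>\<in>supp m. Poly_Mapping.single 0 (coef m \<mu>) * ch r (L \<mu>))"
    using m by simp
  also have "\<dots> = (\<Sum>\<mu>\<in>supp m. Poly_Mapping.single 0 (coef m \<mu>) * alt_sum r (\<mu> + weyl_vector r))"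
    unfolding sum_distrib_left
  proof (intro sum.cong refl)
    fix \<mu> assume "\<mu> \<in> supp m"
    then have "\<mu> \<in> dominant_weights r" using dom by blast
    then show "weyl_denom r * (Poly_Mapping.single 0 (coef m \<mu>) * ch r (L \<mu>)) =
        Poly_Mapping.single 0 (coef m \<mu>) * alt_sum r (\<mu> + weyl_vector r)"
      using weyl_character_formula(1)[OF r _ L] by (simp only: mult.left_commute[of "weyl_denom r"])
  qed
  finally show "weyl_denom r * adams p (ch r (L \<nu>)) =
      (\<Sum>\<mu>\<in>supp m. Poly_Mapping.single 0 (coef m \<mu>) * alt_sum r (\<mu> + weyl_vector r))" .
qed

section \<open>Evaluation of the invariant\<close>

text \<open>Rounding commutes with adding an integer, so one integral summand is enough. The twist
  exponents can therefore be carried along as the second summand.\<close>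

lemma qpow_add: "of_nat N * x \<in> \<int> \<Longrightarrow> qpow N (x + y) = qpow N x * qpow N y"
proof -
  assume "of_nat N * x \<in> \<int>"
  then obtain z where z: "of_nat N * x = of_int z" by (auto elim: Ints_cases)
  have "\<lfloor>of_nat N * (x + y)\<rfloor> = z + \<lfloor>of_nat N * y\<rfloor>"
    unfolding distrib_left z by (metis add.commute floor_add_int)
  then show ?thesis
    unfolding qpow_def z floor_of_int by (simp add: fls_X_intpow_times_fls_X_intpow)
qed

lemma qpow_zero [simp]: "qpow N 0 = 1"
  by (simp add: qpow_def)

text \<open>The exponent function is arbitrary, not necessarily additive: a linear one gives the
  principal specialisation, while a quadratic one builds the twist into a functional that is still
  linear in f.\<close>

definition qeval :: "nat \<Rightarrow> (weight \<Rightarrow> rat) \<Rightarrow> (weight \<Rightarrow>\<^sub>0 int) \<Rightarrow> complex fls" where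
  "qeval N e f = (\<Sum>v\<in>supp f. of_int (coef f v) * qpow N (e v))"

lemma qeval_superset:
  "finite A \<Longrightarrow> supp f \<subseteq> A \<Longrightarrow> qeval N e f = (\<Sum>v\<in>A. of_int (coef f v) * qpow N (e v))"
  unfolding qeval_def by (intro sum.mono_neutral_left) (auto simp: in_keys_iff)

lemma qeval_add: "qeval N e (f + g) = qeval N e f + qeval N e g"
proof -
  let ?A = "supp f \<union> supp g"
  have "supp (f + g) \<subseteq> ?A" by (rule keys_add)
  then show ?thesis
    using qeval_superset[of ?A "f + g" N e] qeval_superset[of ?A f N e] qeval_superset[of ?A g N e]
    by (simp add: lookup_add distrib_right sum.distrib)
qed

lemma qeval_zero [simp]: "qeval N e 0 = 0"
  by (simp add: qeval_def)

lemma qeval_sum: "qeval N e (\<Sum>i\<in>I. f i) = (\<Sum>i\<in>I. qeval N e (f i))"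
  by (induction I rule: infinite_finite_induct) (simp_all add: qeval_add)

lemma qeval_single: "qeval N e (Poly_Mapping.single v c) = of_int c * qpow N (e v)"
  by (subst qeval_superset[of "{v}"]) auto

lemma qeval_scale: "qeval N e (Poly_Mapping.single 0 c * f) = of_int c * qeval N e f"
proof -
  have "supp (Poly_Mapping.single 0 c * f) \<subseteq> supp f"
    by (auto simp: in_keys_iff coef_single_0_times)
  then show ?thesis
    using qeval_superset[of "supp f" "Poly_Mapping.single 0 c * f" N e] qeval_superset[of "supp f" f N e]
    by (simp add: coef_single_0_times sum_distrib_left mult.assoc)
qed

lemma qeval_times:
  assumes e: "\<And>v w. v \<in> supp f \<Longrightarrow> w \<in> supp g \<Longrightarrow> qpow N (e (v + w)) = qpow N (e v) * qpow N (e w)"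
  shows "qeval N e (f * g) = qeval N e f * qeval N e g"
proof -
  have "f * g = (\<Sum>v\<in>supp f. Poly_Mapping.single v (coef f v)) * (\<Sum>w\<in>supp g. Poly_Mapping.single w (coef g w))"
    using group_ring_eq_sum_single[of "supp f" f] group_ring_eq_sum_single[of "supp g" g] by simp
  also have "\<dots> = (\<Sum>v\<in>supp f. \<Sum>w\<in>supp g. Poly_Mapping.single (v + w) (coef f v * coef g w))"
    by (simp only: sum_product mult_single)
  finally have "qeval N e (f * g) = (\<Sum>v\<in>supp f. \<Sum>w\<in>supp g. of_int (coef f v * coef g w) * qpow N (e (v + w)))"
    by (simp only: qeval_sum qeval_single)
  also have "\<dots> = (\<Sum>v\<in>supp f. \<Sum>w\<in>supp g. (of_int (coef f v) * qpow N (e v)) * (of_int (coef g w) * qpow N (e w)))"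
    by (intro sum.cong refl) (simp add: e)
  also have "\<dots> = qeval N e f * qeval N e g"
    unfolding qeval_def by (simp only: sum_product)
  finally show ?thesis .
qed

section \<open>The longest Weyl group element and evaluation at -\<delta>\<close>

definition longest :: "nat \<Rightarrow> nat \<Rightarrow> nat" where
  "longest r k = (if k \<in> {1..r} then r + 1 - k else k)"

lemma longest_involution: "longest r (longest r k) = k"
  by (auto simp: longest_def)

lemma longest_permutes: "longest r permutes {1..r}"
  unfolding permutes_def
proof (intro conjI allI impI)
  show "longest r x = x" if "x \<notin> {1..r}" for x using that by (simp only: longest_def if_False)
  show "\<exists>!x. longest r x = y" for y by (metis longest_involution)
qed

lemma inv_longest: "inv (longest r) = longest r"
  by (rule inv_unique_comp) (auto simp: fun_eq_iff longest_involution)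

lemma weyl_act_longest: "weyl_act (longest r) (weyl_vector r) = - weyl_vector r"
  unfolding weyl_act_def inv_longest
  by (auto simp: fun_eq_iff weyl_vector_apply longest_def field_simps of_nat_diff)

text \<open>The symmetry under the longest element lets us evaluate at \<open>- \<delta>\<close> instead of \<open>\<delta>\<close>; with this sign
  the Weyl denominator contributes \<open>1 - q\<^bsup>(\<alpha>,\<delta>)\<^esup>\<close> directly.\<close>

lemma qdim_invariant:
  assumes f: "invariant r f"
  shows "qdim N r f = qeval N (\<lambda>v. - ip r v (weyl_vector r)) f"
proof -
  let ?w = "longest r"
  note b = permutes_bij[OF longest_permutes]
  have img: "weyl_act ?w ` supp f = supp f"
    using supp_wact[OF b[of r], of f] f longest_permutes[of r] unfolding invariant_def by metis
  have neg: "ip r (weyl_act ?w v) (weyl_vector r) = - ip r v (weyl_vector r)" for v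
  proof -
    have "ip r (weyl_act ?w v) (weyl_act ?w (weyl_vector r)) = ip r v (weyl_vector r)"
      by (rule ip_weyl_act[OF longest_permutes])
    then show ?thesis unfolding weyl_act_longest ip_minus_right by simp
  qed
  have "qdim N r f = (\<Sum>v\<in>weyl_act ?w ` supp f. of_int (coef f v) * qpow N (ip r v (weyl_vector r)))"
    unfolding img qdim_def ..
  also have "\<dots> = (\<Sum>v\<in>supp f. of_int (coef f (weyl_act ?w v)) * qpow N (ip r (weyl_act ?w v) (weyl_vector r)))"
    by (rule sum.reindex[unfolded o_def]) (rule inj_on_subset[OF inj_weyl_act[OF b] subset_UNIV])
  also have "\<dots> = qeval N (\<lambda>v. - ip r v (weyl_vector r)) f"
    unfolding qeval_def neg invariant_coef[OF f longest_permutes] ..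
  finally show ?thesis .
qed

lemma qeval_alt_sum:
  "qeval N e (alt_sum r v) = (\<Sum>\<sigma> | \<sigma> permutes {1..r}. of_int (sign \<sigma>) * qpow N (e (weyl_act \<sigma> v)))"
  unfolding alt_sum_def qeval_sum qeval_single by simp

text \<open>At v = \<sigma>(\<mu> + \<delta>) the second summand is the exponent of the fractional
  twist, because the norms of \<mu> + \<delta> and \<delta> differ by (\<mu>, \<mu> +
  2\<delta>).\<close>

definition twist :: "nat \<Rightarrow> nat \<Rightarrow> nat \<Rightarrow> weight \<Rightarrow> rat" where
  "twist r p p' v = - ip r v (weyl_vector r) + (of_nat p' / of_nat p) * (1/2 * (ip r v v - ip r (weyl_vector r) (weyl_vector r)))"

definition chi_exponent :: "nat \<Rightarrow> nat \<Rightarrow> nat \<Rightarrow> weight \<Rightarrow> (nat \<Rightarrow> nat) \<Rightarrow> rat" where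
  "chi_exponent r p p' \<alpha> \<sigma> = 1/2 * of_nat p * of_nat p' * ip r \<alpha> \<alpha> - of_nat p' * ip r \<alpha> (weyl_vector r)
     + of_nat p * ip r \<alpha> (weyl_act \<sigma> (weyl_vector r)) - ip r (weyl_vector r) (weyl_act \<sigma> (weyl_vector r) - weyl_vector r)"

definition chi_term :: "nat \<Rightarrow> nat \<Rightarrow> nat \<Rightarrow> weight \<Rightarrow> complex fls" where
  "chi_term r p p' \<alpha> = (\<Sum>\<sigma> | \<sigma> permutes {1..r}. of_int (sign \<sigma>) * qpow (q_denom r p) (chi_exponent r p p' \<alpha> \<sigma>))"

context
  fixes r p p' :: nat
  assumes r: "1 \<le> r" and p: "p > 0"
begin

lemma q_denom_ip_weyl_vector: "v \<in> weight_lattice r \<Longrightarrow> of_nat (q_denom r p) * ip r v (weyl_vector r) \<in> \<int>"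
proof -
  assume "v \<in> weight_lattice r"
  then have "of_nat (r * p) * (2 * ip r v (weyl_vector r)) \<in> \<int>"
    by (rule Ints_mult[OF Ints_of_nat ip_weyl_vector_half_Ints[OF r]])
  also have "of_nat (r * p) * (2 * ip r v (weyl_vector r)) = of_nat (q_denom r p) * ip r v (weyl_vector r)"
    by (simp add: q_denom_def)
  finally show ?thesis .
qed

lemma qeval_minus_weyl_times:
  assumes "lattice_supp r f" "lattice_supp r g"
  shows "qeval (q_denom r p) (\<lambda>v. - ip r v (weyl_vector r)) (f * g) = qeval (q_denom r p) (\<lambda>v. - ip r v (weyl_vector r)) f * qeval (q_denom r p) (\<lambda>v. - ip r v (weyl_vector r)) g"
proof (rule qeval_times)
  fix v w assume "v \<in> supp f" "w \<in> supp g"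
  then have "of_nat (q_denom r p) * - ip r v (weyl_vector r) \<in> \<int>"
    using assms q_denom_ip_weyl_vector[of v] by (auto simp: lattice_supp_def)
  then show "qpow (q_denom r p) (- ip r (v + w) (weyl_vector r)) = qpow (q_denom r p) (- ip r v (weyl_vector r)) * qpow (q_denom r p) (- ip r w (weyl_vector r))"
    unfolding ip_add_left minus_add_distrib by (rule qpow_add)
qed

text \<open>The leading monomial of the factored denominator leaves the power -(\<delta>,\<delta>)
  in front; removing it later accounts for the (\<delta>,\<delta>) in
  \<open>chi_exponent\<close>.\<close>

lemma qeval_weyl_denom:
  "qeval (q_denom r p) (\<lambda>v. - ip r v (weyl_vector r)) (weyl_denom r) =
    qpow (q_denom r p) (- ip r (weyl_vector r) (weyl_vector r)) * (\<Prod>\<alpha>\<in>positive_roots r. 1 - qpow (q_denom r p) (ip r \<alpha> (weyl_vector r)))"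
proof -
  let ?Q = "qeval (q_denom r p) (\<lambda>v. - ip r v (weyl_vector r))"
  let ?b = "\<lambda>x. 1 - xpow (eps (snd x) - eps (fst x)) :: weight \<Rightarrow>\<^sub>0 int"
  have lat: "lattice_supp r (?b x)" if "x \<in> root_pairs r" for x
  proof -
    have "supp (?b x) \<subseteq> {0, eps (snd x) - eps (fst x)}"
      by (auto simp: in_keys_iff lookup_minus lookup_one lookup_single when_def split: if_splits)
    moreover have "eps (snd x) - eps (fst x) \<in> weight_lattice r"
      using that by (intro eps_diff_in_weight_lattice) (auto simp: root_pairs_def)
    ultimately show ?thesis using zero_in_weight_lattice[OF r] by (auto simp: lattice_supp_def)
  qed
  have prod: "?Q (\<Prod>x\<in>I. ?b x) = (\<Prod>x\<in>I. ?Q (?b x))" if "finite I" "I \<subseteq> root_pairs r" for I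
    using that
  proof (induction I rule: finite_induct)
    case empty
    show ?case using qeval_single[of "q_denom r p" "\<lambda>v. - ip r v (weyl_vector r)" 0 1] by simp
  next
    case (insert x I)
    have IH: "?Q (\<Prod>x\<in>I. ?b x) = (\<Prod>x\<in>I. ?Q (?b x))"
      by (rule insert.IH) (use insert.prems in blast)
    have "?Q (?b x * (\<Prod>x\<in>I. ?b x)) = ?Q (?b x) * ?Q (\<Prod>x\<in>I. ?b x)"
      using insert.prems by (intro qeval_minus_weyl_times lattice_supp_prod[OF r] lat) auto
    then show ?case unfolding prod.insert[OF insert.hyps] IH .
  qed
  have factor: "?Q (?b x) = 1 - qpow (q_denom r p) (ip r (eps (fst x) - eps (snd x)) (weyl_vector r))" for x
  proof -
    have b: "?b x = Poly_Mapping.single 0 1 + Poly_Mapping.single (eps (snd x) - eps (fst x)) (- 1)"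
      by (simp add: single_uminus)
    have "?Q (?b x) = 1 - qpow (q_denom r p) (- ip r (eps (snd x) - eps (fst x)) (weyl_vector r))"
      unfolding b qeval_add qeval_single by simp
    also have "- ip r (eps (snd x) - eps (fst x)) (weyl_vector r) = ip r (eps (fst x) - eps (snd x)) (weyl_vector r)"
      by (simp only: ip_diff_left minus_diff_eq)
    finally show ?thesis .
  qed
  have roots: "positive_roots r = (\<lambda>x. eps (fst x) - eps (snd x)) ` root_pairs r"
    by (force simp: positive_roots_def root_pairs_def)
  have inj: "inj_on (\<lambda>x. eps (fst x) - eps (snd x)) (root_pairs r)"
  proof (rule inj_onI)
    fix x y assume x: "x \<in> root_pairs r" and y: "y \<in> root_pairs r"
      and eq: "eps (fst x) - eps (snd x) = eps (fst y) - eps (snd y)"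
    have v: "(eps (fst x) - eps (snd x)) k = (eps (fst y) - eps (snd y)) k" for k using eq by simp
    show "x = y"
      using v[of "fst x"] v[of "snd x"] v[of "fst y"] v[of "snd y"] x y
      by (auto simp: root_pairs_def eps_def split: if_splits)
  qed
  have "weyl_denom r = xpow (weyl_vector r) * (\<Prod>x\<in>root_pairs r. ?b x)"
    unfolding weyl_denom_factored by (simp only: case_prod_unfold)
  then have "?Q (weyl_denom r) = ?Q (xpow (weyl_vector r)) * ?Q (\<Prod>x\<in>root_pairs r. ?b x)"
    using lat by (simp only:) (intro qeval_minus_weyl_times lattice_supp_prod[OF r] lattice_supp_single weyl_vector_in_weight_lattice r)
  also have "?Q (\<Prod>x\<in>root_pairs r. ?b x) = (\<Prod>\<alpha>\<in>positive_roots r. 1 - qpow (q_denom r p) (ip r \<alpha> (weyl_vector r)))"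
    unfolding prod[OF finite_root_pairs order_refl] factor roots
    by (rule prod.reindex[OF inj, unfolded o_def, symmetric])
  finally show ?thesis by (simp add: qeval_single)
qed

lemma torus_knot_inv_times_denom:
  fixes L :: "weight \<Rightarrow> 'v::ab_group_add sl_rep"
  assumes L: "\<And>\<nu>. \<nu> \<in> dominant_weights r \<Longrightarrow> is_L r \<nu> (L \<nu>)" and \<nu>: "\<nu> \<in> dominant_weights r"
  shows "torus_knot_inv L r p p' \<nu> * qeval (q_denom r p) (\<lambda>v. - ip r v (weyl_vector r)) (weyl_denom r) =
    qeval (q_denom r p) (twist r p p') (weyl_denom r * adams p (ch r (L \<nu>)))"
proof -
  let ?m = "adams_coeffs L r p \<nu>"
  let ?Q = "qeval (q_denom r p) (\<lambda>v. - ip r v (weyl_vector r))"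
  let ?\<theta> = "\<lambda>\<mu>. qpow (q_denom r p) ((of_nat p' / of_nat p) * (1/2 * ip r \<mu> (\<mu> + wscale 2 (weyl_vector r))))"
  have m: "supp ?m \<subseteq> dominant_weights r" "weyl_denom r * adams p (ch r (L \<nu>)) =
      (\<Sum>\<mu>\<in>supp ?m. Poly_Mapping.single 0 (coef ?m \<mu>) * alt_sum r (\<mu> + weyl_vector r))"
    by (rule adams_coeffs[OF r L \<nu>], assumption)+
  thm m
  have step: "?Q (weyl_denom r) * (qdim (q_denom r p) r (ch r (L \<mu>)) * ?\<theta> \<mu>) = qeval (q_denom r p) (twist r p p') (alt_sum r (\<mu> + weyl_vector r))"
    if \<mu>: "\<mu> \<in> dominant_weights r" for \<mu>
  proof -
    have F: "invariant r (ch r (L \<mu>))" "lattice_supp r (ch r (L \<mu>))"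
      using weyl_character_formula(2)[OF r \<mu> L[OF \<mu>]] by (auto simp: freudenthal_def)
    have "?Q (weyl_denom r) * qdim (q_denom r p) r (ch r (L \<mu>)) = ?Q (weyl_denom r * ch r (L \<mu>))"
      unfolding qdim_invariant[OF F(1)]
      by (intro qeval_minus_weyl_times[symmetric] lattice_supp_weyl_denom r F)
    also have "\<dots> = ?Q (alt_sum r (\<mu> + weyl_vector r))"
      unfolding weyl_character_formula(1)[OF r \<mu> L[OF \<mu>]] ..
    finally have "?Q (weyl_denom r) * (qdim (q_denom r p) r (ch r (L \<mu>)) * ?\<theta> \<mu>) = ?Q (alt_sum r (\<mu> + weyl_vector r)) * ?\<theta> \<mu>"
      by (simp only: mult.assoc[symmetric])
    also have "\<dots> = (\<Sum>\<sigma> | \<sigma> permutes {1..r}. of_int (sign \<sigma>) * qpow (q_denom r p) (twist r p p' (weyl_act \<sigma> (\<mu> + weyl_vector r))))"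
      unfolding qeval_alt_sum sum_distrib_right
    proof (intro sum.cong refl)
      fix \<sigma> assume "\<sigma> \<in> {\<sigma>. \<sigma> permutes {1..r}}"
      then have \<sigma>: "\<sigma> permutes {1..r}" by simp
      let ?v = "weyl_act \<sigma> (\<mu> + weyl_vector r)"
      have "\<mu> + weyl_vector r \<in> weight_lattice r" using \<mu> dominant_add_weyl_vector_iff[OF r] by blast
      then have "?v \<in> weight_lattice r" by (rule weight_lattice_weyl_act[OF r \<sigma>])
      then have int: "of_nat (q_denom r p) * - ip r ?v (weyl_vector r) \<in> \<int>" using q_denom_ip_weyl_vector[of ?v] by simp
      have "ip r ?v ?v - ip r (weyl_vector r) (weyl_vector r) = ip r \<mu> (\<mu> + wscale 2 (weyl_vector r))"
        unfolding ip_weyl_act[OF \<sigma>] using ip_commute[of r \<mu> "weyl_vector r"] by (simp add: ip_linear)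
      then have "twist r p p' ?v = - ip r ?v (weyl_vector r) + (of_nat p' / of_nat p) * (1/2 * ip r \<mu> (\<mu> + wscale 2 (weyl_vector r)))"
        by (simp only: twist_def)
      then show "of_int (sign \<sigma>) * qpow (q_denom r p) (- ip r ?v (weyl_vector r)) * ?\<theta> \<mu> = of_int (sign \<sigma>) * qpow (q_denom r p) (twist r p p' ?v)"
        by (simp only: qpow_add[OF int] mult.assoc)
    qed
    also have "\<dots> = qeval (q_denom r p) (twist r p p') (alt_sum r (\<mu> + weyl_vector r))" unfolding qeval_alt_sum ..
    finally show ?thesis .
  qed
  have "torus_knot_inv L r p p' \<nu> * ?Q (weyl_denom r) =
      (\<Sum>\<mu>\<in>supp ?m. of_int (coef ?m \<mu>) * (?Q (weyl_denom r) * (qdim (q_denom r p) r (ch r (L \<mu>)) * ?\<theta> \<mu>)))"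
    unfolding torus_knot_inv_def Let_def sum_distrib_right
    by (intro sum.cong refl) (simp only: mult.assoc mult.left_commute mult.commute)
  also have "\<dots> = (\<Sum>\<mu>\<in>supp ?m. of_int (coef ?m \<mu>) * qeval (q_denom r p) (twist r p p') (alt_sum r (\<mu> + weyl_vector r)))"
    by (intro sum.cong refl arg_cong2[where f = "(*)"] step) (use m(1) in blast)
  also have "\<dots> = qeval (q_denom r p) (twist r p p') (weyl_denom r * adams p (ch r (L \<nu>)))"
    unfolding m(2) qeval_sum qeval_scale ..
  finally show ?thesis .
qed

text \<open>Put w for the longest element, \<beta> = w \<sigma>^-1 \<alpha> and \<tau> = w
  \<sigma>^-1 w. Since w sends \<delta> to -\<delta>, one has (\<beta>,\<delta>) =
  -(\<alpha>,\<sigma>\<delta>), (\<beta>,\<tau>\<delta>) = -(\<alpha>,\<delta>) and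
  (\<delta>,\<tau>\<delta>) = (\<sigma>\<delta>,\<delta>). The quadratic part of the twist supplies
  the p' term and the linear part the p term, so this substitution exchanges their roles as the
  limit formula demands.\<close>

lemma twist_reindexed:
  assumes \<sigma>: "\<sigma> permutes {1..r}"
  shows "ip r (weyl_vector r) (weyl_vector r) + twist r p p' (weyl_act \<sigma> (weyl_vector r) + wscale (of_nat p) \<alpha>) =
    chi_exponent r p p' (weyl_act (longest r \<circ> inv \<sigma>) \<alpha>) (longest r \<circ> inv \<sigma> \<circ> longest r)"
proof -
  let ?w = "longest r" and ?\<beta> = "weyl_act (longest r \<circ> inv \<sigma>) \<alpha>"
  let ?\<tau>\<delta> = "weyl_act (?w \<circ> inv \<sigma> \<circ> ?w) (weyl_vector r)"
  have w: "?w permutes {1..r}" by (rule longest_permutes)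
  have i: "inv \<sigma> permutes {1..r}" by (rule permutes_inv[OF \<sigma>])
  have wi: "?w \<circ> inv \<sigma> permutes {1..r}" by (rule permutes_compose[OF i w])
  have \<tau>\<delta>: "?\<tau>\<delta> = weyl_act (?w \<circ> inv \<sigma>) (- weyl_vector r)"
    unfolding weyl_act_comp[OF permutes_bij[OF wi] permutes_bij[OF w]] weyl_act_longest ..
  have back_eq: "weyl_act (?w \<circ> inv \<sigma>) (weyl_act \<sigma> (- weyl_vector r)) = (weyl_vector r)"
  proof -
    have "weyl_act (?w \<circ> inv \<sigma>) (weyl_act \<sigma> (- weyl_vector r)) = weyl_act ?w (weyl_act (inv \<sigma>) (weyl_act \<sigma> (- weyl_vector r)))"
      by (rule weyl_act_comp[OF permutes_bij[OF w] permutes_bij[OF i]])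
    also have "\<dots> = weyl_act ?w (- weyl_vector r)"
      unfolding weyl_act_inv_cancel(2)[OF permutes_bij[OF \<sigma>]] ..
    also have "\<dots> = - weyl_act ?w (weyl_vector r)" by (simp add: weyl_act_def fun_eq_iff)
    finally show ?thesis unfolding weyl_act_longest by simp
  qed
  have neg: "weyl_act \<sigma> (- weyl_vector r) = - weyl_act \<sigma> (weyl_vector r)" by (simp add: weyl_act_def fun_eq_iff)
  have \<beta>\<beta>: "ip r ?\<beta> ?\<beta> = ip r \<alpha> \<alpha>" by (rule ip_weyl_act[OF wi])
  have "ip r ?\<beta> (weyl_vector r) = ip r \<alpha> (weyl_act \<sigma> (- weyl_vector r))"
    using ip_weyl_act[OF wi, of \<alpha> "weyl_act \<sigma> (- weyl_vector r)"] unfolding back_eq .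
  then have \<beta>\<delta>: "ip r ?\<beta> (weyl_vector r) = - ip r \<alpha> (weyl_act \<sigma> (weyl_vector r))" unfolding neg ip_minus_right .
  have \<beta>\<tau>: "ip r ?\<beta> ?\<tau>\<delta> = - ip r \<alpha> (weyl_vector r)"
    unfolding \<tau>\<delta> ip_weyl_act[OF wi] ip_minus_right ..
  have \<delta>\<tau>: "ip r (weyl_vector r) ?\<tau>\<delta> = ip r (weyl_act \<sigma> (weyl_vector r)) (weyl_vector r)"
    using ip_weyl_act[OF wi, of "weyl_act \<sigma> (- weyl_vector r)" "- weyl_vector r"]
    unfolding back_eq \<tau>\<delta> by (simp add: neg ip_minus_left ip_minus_right)
  have \<sigma>\<sigma>: "ip r (weyl_act \<sigma> (weyl_vector r)) (weyl_act \<sigma> (weyl_vector r)) = ip r (weyl_vector r) (weyl_vector r)" by (rule ip_weyl_act[OF \<sigma>])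
  have expand: "ip r (weyl_act \<sigma> (weyl_vector r) + wscale (of_nat p) \<alpha>) (weyl_act \<sigma> (weyl_vector r) + wscale (of_nat p) \<alpha>) - ip r (weyl_vector r) (weyl_vector r)
      = 2 * of_nat p * ip r \<alpha> (weyl_act \<sigma> (weyl_vector r)) + of_nat p * of_nat p * ip r \<alpha> \<alpha>"
    using \<sigma>\<sigma> ip_commute[of r "weyl_act \<sigma> (weyl_vector r)" \<alpha>] by (simp add: ip_linear algebra_simps)
  have "(of_nat p' / of_nat p) * (1/2 * (2 * of_nat p * ip r \<alpha> (weyl_act \<sigma> (weyl_vector r)) + of_nat p * of_nat p * ip r \<alpha> \<alpha>))
      = of_nat p' * ip r \<alpha> (weyl_act \<sigma> (weyl_vector r)) + 1/2 * of_nat p * of_nat p' * ip r \<alpha> \<alpha>"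
    using p by (simp add: field_simps)
  then show ?thesis
    unfolding twist_def chi_exponent_def expand \<beta>\<beta> \<beta>\<delta> \<beta>\<tau> ip_diff_right[of r "weyl_vector r"] \<delta>\<tau>
    by (simp add: ip_add_left ip_wscale_left)
qed

text \<open>Before any limit, the invariant is already the limiting sum restricted to the weights of
  one symmetric power. The reindexing is legitimate because these weights are stable under the Weyl
  group and \<sigma> \<mapsto> w \<sigma>^-1 w, with w the longest element, is an involution that
  preserves signs.\<close>

lemma torus_knot_inv_symmetric:
  fixes L :: "weight \<Rightarrow> 'v::ab_group_add sl_rep"
  assumes L: "\<And>\<nu>. \<nu> \<in> dominant_weights r \<Longrightarrow> is_L r \<nu> (L \<nu>)"
  shows "torus_knot_inv L r p p' (wscale (of_nat m) (fund_weight r 1)) *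
      (\<Prod>\<alpha>\<in>positive_roots r. 1 - qpow (q_denom r p) (ip r \<alpha> (weyl_vector r))) = (\<Sum>\<beta>\<in>sym_weights r m. chi_term r p p' \<beta>)"
proof -
  let ?\<Lambda> = "wscale (of_nat m) (fund_weight r 1)"
  let ?J = "torus_knot_inv L r p p' ?\<Lambda>"
  let ?P = "\<Prod>\<alpha>\<in>positive_roots r. 1 - qpow (q_denom r p) (ip r \<alpha> (weyl_vector r))"
  let ?S = "sym_weights r m"
  let ?perms = "{\<sigma>. \<sigma> permutes {1..r}}"
  let ?c = "\<lambda>\<sigma>. longest r \<circ> inv \<sigma> \<circ> longest r"
  note \<Lambda> = highest_sym_weight_dominant(2)[OF r, of m]
  have norm: "of_nat (q_denom r p) * ip r (weyl_vector r) (weyl_vector r) \<in> \<int>"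
    by (rule q_denom_ip_weyl_vector[OF weyl_vector_in_weight_lattice[OF r]])
  have one: "qpow (q_denom r p) (ip r (weyl_vector r) (weyl_vector r)) * qpow (q_denom r p) (- ip r (weyl_vector r) (weyl_vector r)) = 1"
    using qpow_add[OF norm, of "- ip r (weyl_vector r) (weyl_vector r)"] by simp
  have perm: "permutation \<sigma>" if "\<sigma> permutes {1..r}" for \<sigma>
    using that permutes_imp_permutation by blast
  have sign_c: "sign (?c \<sigma>) = sign \<sigma>" if \<sigma>: "\<sigma> permutes {1..r}" for \<sigma>
  proof -
    have "sign (?c \<sigma>) = sign (longest r) * sign (inv \<sigma>) * sign (longest r)"
      using perm[OF longest_permutes] perm[OF permutes_inv[OF \<sigma>]]
      by (simp only: sign_compose permutation_compose)
    also have "sign (inv \<sigma>) = sign \<sigma>" by (rule sign_inverse[OF perm[OF \<sigma>]])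
    finally show ?thesis using sign_idempotent[of "longest r"] by (simp only: mult.commute mult.left_commute mult_1_right)
  qed
  have c_perm: "?c \<sigma> \<in> ?perms" if "\<sigma> \<in> ?perms" for \<sigma>
    using that permutes_compose[OF longest_permutes permutes_compose[OF permutes_inv longest_permutes]]
    by (simp add: comp_assoc)
  have c_inv: "?c (?c \<sigma>) = \<sigma>" if "\<sigma> \<in> ?perms" for \<sigma>
  proof -
    have bij: "bij \<sigma>" "bij (longest r)" "bij (inv \<sigma>)"
      using that permutes_bij longest_permutes permutes_inv by blast+
    have "inv (?c \<sigma>) = longest r \<circ> (\<sigma> \<circ> longest r)"
      using bij by (simp only: o_inv_distrib bij_comp inv_longest inv_inv_eq)
    then show ?thesis by (simp add: fun_eq_iff longest_involution)
  qed
  have "?J * (qpow (q_denom r p) (- ip r (weyl_vector r) (weyl_vector r)) * ?P) = qeval (q_denom r p) (twist r p p') (weyl_denom r * adams p (complete_sym r m))"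
  proof -
    have "?J * qeval (q_denom r p) (\<lambda>v. - ip r v (weyl_vector r)) (weyl_denom r) = qeval (q_denom r p) (twist r p p') (weyl_denom r * adams p (ch r (L ?\<Lambda>)))"
      by (rule torus_knot_inv_times_denom[OF _ \<Lambda>]) (rule L)
    then show ?thesis unfolding qeval_weyl_denom ch_symmetric_power[OF r L[OF \<Lambda>]] .
  qed
  also have "weyl_denom r * adams p (complete_sym r m) =
      (\<Sum>\<sigma>\<in>?perms. \<Sum>\<alpha>\<in>?S. Poly_Mapping.single (weyl_act \<sigma> (weyl_vector r) + wscale (of_nat p) \<alpha>) (sign \<sigma>))"
  proof -
    have "adams p (complete_sym r m) = (\<Sum>\<alpha>\<in>?S. xpow (wscale (of_nat p) \<alpha>))"
      unfolding adams_def supp_complete_sym[OF r] by (intro sum.cong refl) (simp add: coef_complete_sym[OF r])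
    then show ?thesis
      unfolding weyl_denom_eq_alt_sum[OF r] alt_sum_def by (simp add: sum_product mult_single)
  qed
  also have "qeval (q_denom r p) (twist r p p') \<dots> = (\<Sum>\<sigma>\<in>?perms. \<Sum>\<alpha>\<in>?S. of_int (sign \<sigma>) * qpow (q_denom r p) (twist r p p' (weyl_act \<sigma> (weyl_vector r) + wscale (of_nat p) \<alpha>)))"
    unfolding qeval_sum qeval_single ..
  finally have "qpow (q_denom r p) (ip r (weyl_vector r) (weyl_vector r)) * (?J * (qpow (q_denom r p) (- ip r (weyl_vector r) (weyl_vector r)) * ?P)) =
      (\<Sum>\<sigma>\<in>?perms. \<Sum>\<alpha>\<in>?S. qpow (q_denom r p) (ip r (weyl_vector r) (weyl_vector r)) * (of_int (sign \<sigma>) * qpow (q_denom r p) (twist r p p' (weyl_act \<sigma> (weyl_vector r) + wscale (of_nat p) \<alpha>))))"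
    by (simp only: sum_distrib_left)
  also have "qpow (q_denom r p) (ip r (weyl_vector r) (weyl_vector r)) * (?J * (qpow (q_denom r p) (- ip r (weyl_vector r) (weyl_vector r)) * ?P)) = (qpow (q_denom r p) (ip r (weyl_vector r) (weyl_vector r)) * qpow (q_denom r p) (- ip r (weyl_vector r) (weyl_vector r))) * (?J * ?P)"
    by (simp only: mult.assoc mult.left_commute)
  finally have "?J * ?P = (\<Sum>\<sigma>\<in>?perms. \<Sum>\<alpha>\<in>?S. qpow (q_denom r p) (ip r (weyl_vector r) (weyl_vector r)) * (of_int (sign \<sigma>) * qpow (q_denom r p) (twist r p p' (weyl_act \<sigma> (weyl_vector r) + wscale (of_nat p) \<alpha>))))"
    unfolding one by (simp only: mult_1)
  also have "\<dots> = (\<Sum>\<sigma>\<in>?perms. \<Sum>\<beta>\<in>?S. of_int (sign (?c \<sigma>)) * qpow (q_denom r p) (chi_exponent r p p' \<beta> (?c \<sigma>)))"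
  proof (rule sum.cong[OF refl])
    fix \<sigma> assume "\<sigma> \<in> ?perms"
    then have \<sigma>: "\<sigma> permutes {1..r}" by simp
    have wi: "longest r \<circ> inv \<sigma> permutes {1..r}" by (rule permutes_compose[OF permutes_inv[OF \<sigma>] longest_permutes])
    have bij: "bij_betw (weyl_act (longest r \<circ> inv \<sigma>)) ?S ?S"
      by (rule bij_betwI[where g = "weyl_act (inv (longest r \<circ> inv \<sigma>))"])
        (auto simp: weyl_act_inv_cancel[OF permutes_bij[OF wi]] intro!: sym_weights_weyl_act wi permutes_inv)
    have "(\<Sum>\<alpha>\<in>?S. qpow (q_denom r p) (ip r (weyl_vector r) (weyl_vector r)) * (of_int (sign \<sigma>) * qpow (q_denom r p) (twist r p p' (weyl_act \<sigma> (weyl_vector r) + wscale (of_nat p) \<alpha>)))) =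
        (\<Sum>\<alpha>\<in>?S. of_int (sign (?c \<sigma>)) * qpow (q_denom r p) (chi_exponent r p p' (weyl_act (longest r \<circ> inv \<sigma>) \<alpha>) (?c \<sigma>)))"
      unfolding sign_c[OF \<sigma>] twist_reindexed[OF \<sigma>, symmetric] qpow_add[OF norm]
      by (intro sum.cong refl) (rule mult.left_commute)
    also have "\<dots> = (\<Sum>\<beta>\<in>?S. of_int (sign (?c \<sigma>)) * qpow (q_denom r p) (chi_exponent r p p' \<beta> (?c \<sigma>)))"
      by (rule sum.reindex_bij_betw[OF bij])
    finally show "(\<Sum>\<alpha>\<in>?S. qpow (q_denom r p) (ip r (weyl_vector r) (weyl_vector r)) * (of_int (sign \<sigma>) * qpow (q_denom r p) (twist r p p' (weyl_act \<sigma> (weyl_vector r) + wscale (of_nat p) \<alpha>)))) =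
        (\<Sum>\<beta>\<in>?S. of_int (sign (?c \<sigma>)) * qpow (q_denom r p) (chi_exponent r p p' \<beta> (?c \<sigma>)))" .
  qed
  also have "\<dots> = (\<Sum>\<tau>\<in>?perms. \<Sum>\<beta>\<in>?S. of_int (sign \<tau>) * qpow (q_denom r p) (chi_exponent r p p' \<beta> \<tau>))"
    by (rule sum.reindex_bij_betw[OF bij_betw_byWitness[where f' = ?c]]) (use c_inv c_perm in blast)+
  also have "\<dots> = (\<Sum>\<beta>\<in>?S. chi_term r p p' \<beta>)"
    unfolding chi_term_def by (rule sum.swap)
  finally show ?thesis .
qed

end

section \<open>Limits of Laurent series\<close>

text \<open>Agreement up to degree n bounds the distance by 2^-n. The filter is left general, so
  that the criterion covers both sums over finite subsets and partial products.\<close>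

lemma fls_tendstoI:
  fixes L :: "'a::group_add fls"
  assumes "\<And>K. \<forall>\<^sub>F x in F. \<forall>k\<le>K. fls_nth (X x) k = fls_nth L k"
  shows "(X \<longlongrightarrow> L) F"
proof (rule tendstoI)
  fix e :: real assume "0 < e"
  then obtain n where n: "inverse (2 ^ n) < e"
    using reals_power_lt_ex[of e 2] by (auto simp: inverse_eq_divide power_one_over)
  show "\<forall>\<^sub>F x in F. dist (X x) L < e"
    using assms[of "int n"]
  proof eventually_elim
    case (elim x)
    show ?case
    proof (cases "X x = L")
      case False
      then have "int n < fls_subdegree (X x - L)"
        using elim by (intro fls_subdegree_greaterI) auto
      then have "dist (X x) L = inverse (2 ^ nat (fls_subdegree (X x - L)))" "n \<le> nat (fls_subdegree (X x - L))"
        using False by (auto simp: dist_fls_def)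
      moreover from this have "inverse (2 ^ nat (fls_subdegree (X x - L))) \<le> (inverse (2 ^ n) :: real)"
        by (intro le_imp_inverse_le power_increasing) auto
      ultimately show ?thesis using n by linarith
    qed (use \<open>0 < e\<close> in simp)
  qed
qed

text \<open>Each coefficient is summed over the indices where it is nonzero; over all of an infinite
  \<open>A\<close> the finite sum would take its default value 0.\<close>

definition fls_set_sum :: "('i \<Rightarrow> 'a::ab_group_add fls) \<Rightarrow> 'i set \<Rightarrow> 'a fls" where
  "fls_set_sum f A = Abs_fls (\<lambda>k. \<Sum>a | a \<in> A \<and> fls_nth (f a) k \<noteq> 0. fls_nth (f a) k)"

lemma fls_nth_set_sum:
  fixes f :: "'i \<Rightarrow> 'a::ab_group_add fls"
  assumes fin: "\<And>K. finite {a \<in> A. \<exists>k\<le>K. fls_nth (f a) k \<noteq> 0}"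
    and X: "finite X" "X \<subseteq> A" "{a \<in> A. \<exists>k\<le>K. fls_nth (f a) k \<noteq> 0} \<subseteq> X" and k: "k \<le> K"
  shows "fls_nth (fls_set_sum f A) k = (\<Sum>a\<in>X. fls_nth (f a) k)"
proof -
  \<comment> \<open>Only finitely many summands reach degree 0 or below, so their least subdegree
    bounds the coefficients of the sum from below and \<open>Abs_fls\<close> is legitimate. For
    empty \<open>?F\<close> the value of \<open>M\<close> is arbitrary but harmless.\<close>
  let ?F = "{a \<in> A. \<exists>k\<le>0. fls_nth (f a) k \<noteq> 0}"
  define M where "M = Min ((\<lambda>a. fls_subdegree (f a)) ` ?F)"
  have M: "M \<le> fls_subdegree (f a)" if "a \<in> ?F" for a
    unfolding M_def by (rule Min_le[OF finite_imageI[OF fin] imageI[OF that]])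
  have "fls_nth (f a) n = 0" if "a \<in> A" "n < min M 0" for a n
  proof (rule ccontr)
    assume nz: "fls_nth (f a) n \<noteq> 0"
    moreover have "n \<le> 0" using that by linarith
    ultimately have "a \<in> ?F" using that by blast
    then have "M \<le> fls_subdegree (f a)" by (rule M)
    then show False using nz that by simp
  qed
  then have "\<forall>n<min M 0. (\<Sum>a | a \<in> A \<and> fls_nth (f a) n \<noteq> 0. fls_nth (f a) n) = 0"
    by (intro allI impI sum.neutral) auto
  then have "fls_nth (fls_set_sum f A) k = (\<Sum>a | a \<in> A \<and> fls_nth (f a) k \<noteq> 0. fls_nth (f a) k)"
    unfolding fls_set_sum_def by (intro nth_Abs_fls_ex_lower_bound) blast
  also have "\<dots> = (\<Sum>a\<in>X. fls_nth (f a) k)"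
    using X k by (intro sum.mono_neutral_left) auto
  finally show ?thesis .
qed

lemma fls_has_sum:
  fixes f :: "'i \<Rightarrow> 'a::ab_group_add fls"
  assumes fin: "\<And>K. finite {a \<in> A. \<exists>k\<le>K. fls_nth (f a) k \<noteq> 0}"
  shows "(f has_sum fls_set_sum f A) A"
  unfolding has_sum_def
proof (rule fls_tendstoI)
  fix K
  let ?T = "{a \<in> A. \<exists>k\<le>K. fls_nth (f a) k \<noteq> 0}"
  show "\<forall>\<^sub>F X in finite_subsets_at_top A. \<forall>k\<le>K. fls_nth (sum f X) k = fls_nth (fls_set_sum f A) k"
    unfolding eventually_finite_subsets_at_top
  proof (intro exI[of _ ?T] conjI allI impI)
    show "finite ?T" by (rule fin)
    fix X k assume X: "finite X \<and> ?T \<subseteq> X \<and> X \<subseteq> A" and k: "k \<le> K"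
    show "fls_nth (sum f X) k = fls_nth (fls_set_sum f A) k"
      unfolding fls_nth_sum by (rule fls_nth_set_sum[OF fin _ _ _ k, symmetric]) (use X in auto)
  qed auto
qed

lemma fls_nth_times_cong:
  fixes f g c :: "'a::comm_ring_1 fls"
  assumes "\<And>i. i \<le> k - fls_subdegree c \<Longrightarrow> fls_nth f i = fls_nth g i"
  shows "fls_nth (f * c) k = fls_nth (g * c) k"
proof (cases "(f - g) * c = 0")
  case True
  then show ?thesis by (simp add: left_diff_distrib)
next
  case False
  then have "f - g \<noteq> 0" by auto
  then have "k - fls_subdegree c < fls_subdegree (f - g)"
    using assms by (intro fls_subdegree_greaterI) auto
  then have "k < fls_subdegree ((f - g) * c)" using fls_mult_subdegree_ge[OF False] by linarith
  then have "fls_nth ((f - g) * c) k = 0" by (rule fls_eq0_below_subdegree)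
  then show ?thesis by (simp add: left_diff_distrib)
qed

lemma fls_nth_qpow: "fls_nth (qpow N e) k = (if k = \<lfloor>of_nat N * e\<rfloor> then 1 else 0)"
  by (simp add: qpow_def fls_one_nth)

lemma fls_nth_times_qpow: "fls_nth (f * qpow N e) k = fls_nth f (k - \<lfloor>of_nat N * e\<rfloor>)"
  by (simp add: qpow_def fls_shifted_times_simps(1))

text \<open>The n-th factor alters coefficients only from degree N(n + 1) on, so the k-th
  coefficient of the partial products is constant from n = k on. The constant coefficient stays 1,
  hence the limit is a nonzero value of the infinite product.\<close>

lemma q_poch_inf_nonzero:
  assumes N: "N > 0"
  shows "q_poch_inf N \<noteq> 0"
proof -
  define f where "f = (\<lambda>k. 1 - qpow N (of_nat (k + 1)))"
  define P where "P n = (\<Prod>i\<le>n. f i)" for n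
  have fl: "\<lfloor>of_nat N * of_nat (n + 1) :: rat\<rfloor> = int (N * (n + 1))" for n
    by (simp only: of_nat_mult[symmetric] floor_of_nat)
  have mult_f: "fls_nth (g * f n) k = fls_nth g k - fls_nth g (k - int (N * (n + 1)))" for g n k
    unfolding f_def right_diff_distrib fls_minus_nth fls_nth_times_qpow fl by simp
  have neg: "fls_nth (P n) k = 0" if "k < 0" for n k
    using that
  proof (induction n arbitrary: k)
    case 0
    have "P 0 = 1 * f 0" by (simp add: P_def)
    then show ?case using 0 N by (simp only: mult_f) (simp add: fls_one_nth)
  next
    case (Suc n)
    have "P (Suc n) = P n * f (Suc n)" by (simp add: P_def)
    then show ?case using Suc by (simp only: mult_f) simp
  qed
  have stable: "fls_nth (P n) k = fls_nth (P m) k" if "m \<le> n" "k \<le> int m" for m n k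
    using that(1)
  proof (induction n rule: dec_induct)
    case (step n)
    have "P (Suc n) = P n * f (Suc n)" by (simp add: P_def)
    moreover have "k - int (N * (Suc n + 1)) < 0"
    proof -
      have "m < Suc n + 1" using step by simp
      also have "\<dots> \<le> N * (Suc n + 1)" using mult_le_mono1[of 1 N "Suc n + 1"] N by simp
      finally show ?thesis using that(2) by linarith
    qed
    ultimately show ?case using step neg by (simp only: mult_f) simp
  qed simp
  define L where "L = Abs_fls (\<lambda>k. if k < 0 then 0 else fls_nth (P (nat k)) k)"
  have L: "fls_nth L k = (if k < 0 then 0 else fls_nth (P (nat k)) k)" for k
    unfolding L_def by (rule nth_Abs_fls_ex_lower_bound) (auto intro!: exI[of _ 0])
  have "P \<longlonglongrightarrow> L"
  proof (rule fls_tendstoI)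
    fix K
    show "\<forall>\<^sub>F n in sequentially. \<forall>k\<le>K. fls_nth (P n) k = fls_nth L k"
      using eventually_ge_at_top[of "nat K"]
    proof eventually_elim
      case (elim n)
      show ?case
      proof (intro allI impI)
        fix k assume "k \<le> K"
        then show "fls_nth (P n) k = fls_nth L k"
          unfolding L using elim neg stable[of "nat k" n k] by (cases "k < 0") auto
      qed
    qed
  qed
  moreover have "L \<noteq> 0"
  proof -
    have "P 0 = 1 * f 0" by (simp add: P_def)
    then have "fls_nth (P 0) 0 = fls_nth 1 0 - fls_nth 1 (0 - int (N * (0 + 1)))" by (simp only: mult_f)
    then have "fls_nth L 0 = 1" unfolding L using N by (simp add: fls_one_nth)
    then show ?thesis by auto
  qed
  moreover have "P = (\<lambda>n. \<Prod>i\<le>n. f (i + 0))" by (simp add: P_def fun_eq_iff)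
  ultimately have "raw_has_prod f 0 L" unfolding raw_has_prod_def by (simp only: simp_thms)
  then have "f has_prod L" by (simp add: has_prod_def)
  then have "prodinf f = L" using has_prod_unique[of f L] by simp
  then show ?thesis using \<open>L \<noteq> 0\<close> unfolding q_poch_inf_def f_def by simp
qed

section \<open>The limit\<close>

text \<open>The coordinates of j\<Lambda>_1 are integers minus j/r. This form of the condition
  matches \<open>sym_weights\<close>, with integers in place of natural numbers.\<close>

lemma root_coset_iff:
  assumes r: "1 \<le> r"
  shows "v \<in> {\<beta> + wscale (of_nat j) (fund_weight r 1) | \<beta>. \<beta> \<in> root_lattice r} \<longleftrightarrow>
    supported r v \<and> psum r v = 0 \<and> (\<forall>i\<in>{1..r}. v i + of_nat j / of_nat r \<in> \<int>)"
proof -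
  let ?\<Lambda> = "wscale (of_nat j) (fund_weight r 1)"
  have \<Lambda>: "supported r ?\<Lambda>" "psum r ?\<Lambda> = 0"
    using highest_sym_weight_dominant(1)[OF r, of j] by (simp_all only: sym_weights_def mem_Collect_eq)
  have shift: "v i + of_nat j / of_nat r = (v - ?\<Lambda>) i + (if i = 1 then of_nat j else 0)" if "i \<in> {1..r}" for i
    unfolding minus_apply highest_sym_weight[OF r] using that by simp
  have "v \<in> {\<beta> + ?\<Lambda> | \<beta>. \<beta> \<in> root_lattice r} \<longleftrightarrow> v - ?\<Lambda> \<in> root_lattice r"
  proof
    assume "v \<in> {\<beta> + ?\<Lambda> | \<beta>. \<beta> \<in> root_lattice r}"
    then obtain \<beta> where \<beta>: "v = \<beta> + ?\<Lambda>" "\<beta> \<in> root_lattice r" by blast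
    show "v - ?\<Lambda> \<in> root_lattice r" unfolding \<beta>(1) add_diff_cancel_right' by (rule \<beta>(2))
  next
    assume "v - ?\<Lambda> \<in> root_lattice r"
    moreover have "v = (v - ?\<Lambda>) + ?\<Lambda>" by (rule diff_add_cancel[symmetric])
    ultimately show "v \<in> {\<beta> + ?\<Lambda> | \<beta>. \<beta> \<in> root_lattice r}" by blast
  qed
  also have "\<dots> \<longleftrightarrow> supported r (v - ?\<Lambda>) \<and> psum r (v - ?\<Lambda>) = 0 \<and> (\<forall>i\<in>{1..r}. (v - ?\<Lambda>) i \<in> \<int>)"
    by (rule root_lattice_iff[OF r])
  also have "supported r (v - ?\<Lambda>) \<longleftrightarrow> supported r v"
    using supported_diff[OF _ \<Lambda>(1), of v] supported_add[OF _ \<Lambda>(1), of "v - ?\<Lambda>"]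
    unfolding diff_add_cancel by blast
  also have "psum r (v - ?\<Lambda>) = psum r v" unfolding psum_diff \<Lambda>(2) by simp
  also have "(\<forall>i\<in>{1..r}. (v - ?\<Lambda>) i \<in> \<int>) \<longleftrightarrow> (\<forall>i\<in>{1..r}. v i + of_nat j / of_nat r \<in> \<int>)"
  proof (intro ball_cong refl)
    fix i assume i: "i \<in> {1..r}"
    have j: "(if i = 1 then of_nat j else 0 :: rat) \<in> \<int>" by simp
    show "(v - ?\<Lambda>) i \<in> \<int> \<longleftrightarrow> v i + of_nat j / of_nat r \<in> \<int>"
      unfolding shift[OF i] using Ints_add[OF _ j, of "(v - ?\<Lambda>) i"]
        Ints_diff[OF _ j, of "(v - ?\<Lambda>) i + (if i = 1 then of_nat j else 0)"]
      unfolding add_diff_cancel_right' by blast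
  qed
  finally show ?thesis .
qed

lemma finite_ball_coset:
  "finite {v. supported r v \<and> (\<forall>i\<in>{1..r}. v i + s \<in> \<int>) \<and> ip r (v + w) (v + w) \<le> c}"
  (is "finite ?B")
proof -
  \<comment> \<open>The coordinates of v + w are bounded by c + 1; the remaining summands pay for
    passing from v + w to v + s.\<close>
  define M where "M = \<lceil>c + 1 + (\<Sum>i=1..r. \<bar>w i\<bar>) + \<bar>s\<bar>\<rceil>"
  let ?f = "\<lambda>a::nat \<Rightarrow> int. (\<lambda>i. if i \<in> {1..r} then of_int (a i) - s else 0) :: weight"
  have "?B \<subseteq> ?f ` ({1..r} \<rightarrow>\<^sub>E {-M..M})"
  proof
    fix v assume v: "v \<in> ?B"
    have "\<forall>i\<in>{1..r}. \<exists>z::int. v i + s = of_int z" using v by (auto elim!: Ints_cases)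
    then obtain a where a: "\<And>i. i \<in> {1..r} \<Longrightarrow> v i + s = of_int (a i)" by metis
    have bound: "a i \<in> {-M..M}" if i: "i \<in> {1..r}" for i
    proof -
      have "(v + w) i * (v + w) i \<le> ip r (v + w) (v + w)"
        unfolding ip_def using i by (intro member_le_sum) auto
      then have sq: "(v i + w i) * (v i + w i) \<le> c" using v by simp
      have "\<bar>v i + w i\<bar> \<le> c + 1"
      proof (cases "\<bar>v i + w i\<bar> \<le> 1")
        case True
        have "0 \<le> (v i + w i) * (v i + w i)" by simp
        then show ?thesis using True sq by linarith
      next
        case False
        then have "\<bar>v i + w i\<bar> * 1 \<le> \<bar>v i + w i\<bar> * \<bar>v i + w i\<bar>" by (intro mult_left_mono) auto
        then show ?thesis using sq by (simp add: abs_mult_self_eq)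
      qed
      moreover have "\<bar>w i\<bar> \<le> (\<Sum>i=1..r. \<bar>w i\<bar>)" using i by (intro member_le_sum) auto
      ultimately have "\<bar>v i + s\<bar> \<le> c + 1 + (\<Sum>i=1..r. \<bar>w i\<bar>) + \<bar>s\<bar>" by linarith
      also have "\<dots> \<le> of_int M" unfolding M_def by (rule le_of_int_ceiling)
      finally have "\<bar>of_int (a i)\<bar> \<le> (of_int M :: rat)" using a[OF i] by simp
      then have "\<bar>a i\<bar> \<le> M" by (simp only: of_int_abs[symmetric] of_int_le_iff)
      then show ?thesis by auto
    qed
    have "v = ?f (restrict a {1..r})"
    proof
      fix i
      show "v i = ?f (restrict a {1..r}) i"
      proof (cases "i \<in> {1..r}")
        case True
        then show ?thesis using a[OF True] by (simp add: algebra_simps)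
      next
        case False
        then show ?thesis using v by (auto simp: supported_def)
      qed
    qed
    moreover have "restrict a {1..r} \<in> {1..r} \<rightarrow>\<^sub>E {-M..M}" using bound by auto
    ultimately show "v \<in> ?f ` ({1..r} \<rightarrow>\<^sub>E {-M..M})" by (rule image_eqI)
  qed
  moreover have "finite (?f ` ({1..r} \<rightarrow>\<^sub>E {-M..M}))" by (intro finite_imageI finite_PiE) auto
  ultimately show ?thesis by (rule finite_subset)
qed

text \<open>Completing the square turns the bound on the exponent into a bound on a norm.\<close>

lemma finite_chi_exponent_le:
  assumes p: "p > 0" "p' > 0"
  shows "finite {v. supported r v \<and> (\<forall>i\<in>{1..r}. v i + s \<in> \<int>) \<and> chi_exponent r p p' v \<sigma> \<le> c}"
proof -
  let ?\<delta> = "weyl_vector r"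
  let ?a = "1/2 * of_nat p * of_nat p' :: rat"
  define u where "u = wscale (of_nat p) (weyl_act \<sigma> ?\<delta>) - wscale (of_nat p') ?\<delta>"
  \<comment> \<open>The vector u collects the linear part of the exponent; dividing it by pp', twice
    the leading coefficient, gives the shift that completes the square.\<close>
  define w where "w = wscale (1 / (2 * ?a)) u"
  define d where "d = ip r ?\<delta> (weyl_act \<sigma> ?\<delta> - ?\<delta>)"
  have a: "0 < ?a" using p by simp
  have e: "chi_exponent r p p' v \<sigma> = ?a * ip r (v + w) (v + w) - ?a * ip r w w - d" for v
  proof -
    have "?a * ip r (v + w) (v + w) = ?a * ip r v v + 2 * ?a * ip r v w + ?a * ip r w w"
      using ip_commute[of r w v] by (simp add: ip_linear algebra_simps)
    moreover have "2 * ?a * ip r v w = ip r v u"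
      using p by (simp add: w_def ip_wscale_right)
    moreover have "ip r v u = of_nat p * ip r v (weyl_act \<sigma> ?\<delta>) - of_nat p' * ip r v ?\<delta>"
      by (simp add: u_def ip_linear)
    ultimately show ?thesis unfolding chi_exponent_def d_def by linarith
  qed
  have "ip r (v + w) (v + w) \<le> (c + ?a * ip r w w + d) / ?a" if "chi_exponent r p p' v \<sigma> \<le> c" for v
    using that a unfolding e by (simp add: pos_le_divide_eq mult.commute)
  then show ?thesis
    by (intro finite_subset[OF _ finite_ball_coset[of r s w "(c + ?a * ip r w w + d) / ?a"]]) blast
qed

theorem theorem6p1:
  fixes r p p' j :: nat
    and L :: "weight \<Rightarrow> 'v::ab_group_add sl_rep"
  assumes "r \<ge> 2"
    and "p > 0" and "p' > 0" and "coprime p p'"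
    and "j \<le> r - 1"
    and "\<And>\<nu>. \<nu> \<in> dominant_weights r \<Longrightarrow> is_L r \<nu> (L \<nu>)"
  shows "\<forall>k. \<forall>\<^sub>F n in sequentially.
     fls_nth (torus_knot_inv L r p p' (wscale (of_nat (j + n * r)) (fund_weight r 1))) k =
     fls_nth
       (q_poch_inf (q_denom r p) ^ (r - 1) /
        (\<Prod>\<alpha>\<in>positive_roots r. 1 - qpow (q_denom r p) (ip r \<alpha> (weyl_vector r))) *
        chi_bar (q_denom r p) r p p' (wscale (of_nat j) (fund_weight r 1))) k"
proof
  fix k
  let ?N = "q_denom r p"
  let ?P = "\<Prod>\<alpha>\<in>positive_roots r. 1 - qpow ?N (ip r \<alpha> (weyl_vector r))"
  let ?T = "chi_term r p p'"
  define A where "A = {\<beta> + wscale (of_nat j) (fund_weight r 1) | \<beta>. \<beta> \<in> root_lattice r}"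
  have r: "1 \<le> r" using assms(1) by simp
  have N: "?N > 0" using assms(1,2) by (simp add: q_denom_def)
  have A_iff: "v \<in> A \<longleftrightarrow> supported r v \<and> psum r v = 0 \<and> (\<forall>i\<in>{1..r}. v i + of_nat j / of_nat r \<in> \<int>)" for v
    unfolding A_def by (rule root_coset_iff[OF r])
  \<comment> \<open>Raising the colour by r shifts every monomial exponent by 1 without leaving the
    coset, so each coset element eventually has nonnegative exponents.\<close>
  have coord: "shift_coord r (j + n * r) v i = v i + of_nat j / of_nat r + of_nat n" for n v i
    using r by (simp add: shift_coord_def field_simps)

  \<comment> \<open>Summability over the coset: for each of the finitely many permutations, only
    finitely many weights have an exponent below a given bound.\<close>
  have fin: "finite {v \<in> A. \<exists>k\<le>K. fls_nth (?T v) k \<noteq> 0}" for K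
  proof (rule finite_subset)
    let ?U = "\<Union>\<sigma>\<in>{\<sigma>. \<sigma> permutes {1..r}}. {v. supported r v \<and> (\<forall>i\<in>{1..r}. v i + of_nat j / of_nat r \<in> \<int>) \<and>
        chi_exponent r p p' v \<sigma> \<le> (of_int K + 1) / of_nat ?N}"
    show "{v \<in> A. \<exists>k\<le>K. fls_nth (?T v) k \<noteq> 0} \<subseteq> ?U"
    proof
      fix v assume "v \<in> {v \<in> A. \<exists>k\<le>K. fls_nth (?T v) k \<noteq> 0}"
      then obtain k where v: "v \<in> A" and k: "k \<le> K" "fls_nth (?T v) k \<noteq> 0" by blast
      have "fls_nth (?T v) k = (\<Sum>\<sigma> | \<sigma> permutes {1..r}. fls_nth (of_int (sign \<sigma>) * qpow ?N (chi_exponent r p p' v \<sigma>)) k)"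
        unfolding chi_term_def fls_nth_sum ..
      then obtain \<sigma> where \<sigma>: "\<sigma> permutes {1..r}" "fls_nth (of_int (sign \<sigma>) * qpow ?N (chi_exponent r p p' v \<sigma>)) k \<noteq> 0"
        using k(2) by (metis (mono_tags, lifting) mem_Collect_eq sum.neutral)
      have "k = \<lfloor>of_nat ?N * chi_exponent r p p' v \<sigma>\<rfloor>"
      proof (rule ccontr)
        assume "k \<noteq> \<lfloor>of_nat ?N * chi_exponent r p p' v \<sigma>\<rfloor>"
        then have "fls_nth (qpow ?N (chi_exponent r p p' v \<sigma>)) k = 0" by (simp add: fls_nth_qpow)
        then show False using \<sigma>(2) by (cases \<sigma> rule: sign_cases) simp_all
      qed
      \<comment> \<open>The summand 1 allows for the rounding in \<open>qpow\<close>.\<close>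
      then have "of_nat ?N * chi_exponent r p p' v \<sigma> \<le> of_int K + 1" using k(1) by linarith
      then have "chi_exponent r p p' v \<sigma> \<le> (of_int K + 1) / of_nat ?N"
        using N by (simp add: pos_le_divide_eq mult.commute)
      then show "v \<in> ?U" using v \<sigma>(1) A_iff by blast
    qed
    show "finite ?U"
      by (intro finite_UN_I finite_permutations finite_chi_exponent_le assms) simp
  qed

  have chi: "chi_bar ?N r p p' (wscale (of_nat j) (fund_weight r 1)) =
      1 / q_poch_inf ?N ^ (r - 1) * fls_set_sum ?T A"
  proof -
    have "(\<Sum>\<sigma> | \<sigma> permutes {1..r}. (-1) ^ coxeter_length r \<sigma> *
        (let \<delta> = weyl_vector r in
           qpow ?N (1/2 * of_nat p * of_nat p' * ip r \<alpha> \<alpha> - of_nat p' * ip r \<alpha> \<delta>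
                   + of_nat p * ip r \<alpha> (weyl_act \<sigma> \<delta>) - ip r \<delta> (weyl_act \<sigma> \<delta> - \<delta>)))) = ?T \<alpha>" for \<alpha>
      unfolding chi_term_def chi_exponent_def Let_def
      by (intro sum.cong refl) (simp add: coxeter_length_parity)
    then show ?thesis
      unfolding chi_bar_def A_def[symmetric] using infsumI[OF fls_has_sum[OF fin]] by (simp only:)
  qed
  have cancel: "x / y * (1 / x * z) = z * inverse y" if "x \<noteq> 0" for x y z :: "complex fls"
  proof -
    have "x / y * (1 / x * z) = (x * inverse x) * (z * inverse y)"
      unfolding divide_inverse mult_1 by (simp only: mult.assoc mult.left_commute mult.commute)
    then show ?thesis using that by simp
  qed
  have "q_poch_inf ?N ^ (r - 1) \<noteq> 0" using q_poch_inf_nonzero[OF N] by simp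
  then have rhs: "q_poch_inf ?N ^ (r - 1) / ?P * chi_bar ?N r p p' (wscale (of_nat j) (fund_weight r 1)) =
      fls_set_sum ?T A * inverse ?P"
    unfolding chi by (rule cancel)

  have P: "?P \<noteq> 0"
  proof -
    have "1 - qpow ?N (ip r \<alpha> (weyl_vector r)) \<noteq> 0" if \<alpha>: "\<alpha> \<in> positive_roots r" for \<alpha>
    proof -
      obtain a b where ab: "\<alpha> = eps a - eps b" "1 \<le> a" "a < b" "b \<le> r"
        using \<alpha> by (auto simp: positive_roots_def)
      have "ip r \<alpha> (weyl_vector r) = weyl_vector r a - weyl_vector r b"
        unfolding ab(1) ip_diff_left ip_commute[of r "eps _"] using ab by (simp add: ip_eps_right)
      also have "\<dots> = of_nat (b - a)" using ab by (simp add: weyl_vector_apply of_nat_diff field_simps)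
      finally have "\<lfloor>of_nat ?N * ip r \<alpha> (weyl_vector r)\<rfloor> = int (?N * (b - a))"
        by (simp only: of_nat_mult[symmetric] floor_of_nat)
      moreover have "?N * (b - a) \<noteq> 0" using N ab by simp
      ultimately have "fls_nth (1 - qpow ?N (ip r \<alpha> (weyl_vector r))) 0 = 1"
        by (simp only: fls_minus_nth fls_nth_qpow) simp
      then show ?thesis by auto
    qed
    moreover have "finite (positive_roots r)"
    proof (rule finite_subset)
      show "positive_roots r \<subseteq> (\<lambda>(a, b). eps a - eps b) ` root_pairs r"
        by (force simp: positive_roots_def root_pairs_def)
    qed simp
    ultimately show ?thesis by (simp add: prod_zero_iff)
  qed
  have lhs: "torus_knot_inv L r p p' (wscale (of_nat m) (fund_weight r 1)) =
      (\<Sum>\<beta>\<in>sym_weights r m. ?T \<beta>) * inverse ?P" for m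
  proof -
    have "torus_knot_inv L r p p' (wscale (of_nat m) (fund_weight r 1)) * ?P = (\<Sum>\<beta>\<in>sym_weights r m. ?T \<beta>)"
      by (rule torus_knot_inv_symmetric[OF r assms(2)]) (rule assms(6))
    then show ?thesis using P by (simp add: field_simps)
  qed

  \<comment> \<open>After multiplication by the inverse of the product, the k-th coefficient depends
    only on coefficients of the sum up to K.\<close>
  define K where "K = k - fls_subdegree (inverse ?P)"
  let ?X = "{v \<in> A. \<exists>k\<le>K. fls_nth (?T v) k \<noteq> 0}"
  have "\<forall>\<^sub>F n in sequentially. \<forall>v\<in>?X. v \<in> sym_weights r (j + n * r)"
  proof (rule eventually_ball_finite[OF fin], rule ballI)
    fix v assume "v \<in> ?X"
    then have v: "supported r v" "psum r v = 0" "\<And>i. i \<in> {1..r} \<Longrightarrow> v i + of_nat j / of_nat r \<in> \<int>"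
      using A_iff by auto
    \<comment> \<open>A bound on all absolute values |v_i + j/r| at once: from this index on, every
      shifted coordinate is a nonnegative integer.\<close>
    obtain n0 :: nat where n0: "(\<Sum>i=1..r. \<bar>v i + of_nat j / of_nat r\<bar>) \<le> of_nat n0"
      using reals_Archimedean2 less_imp_le by blast
    show "\<forall>\<^sub>F n in sequentially. v \<in> sym_weights r (j + n * r)"
      using eventually_ge_at_top[of n0]
    proof eventually_elim
      case (elim n)
      have "shift_coord r (j + n * r) v i \<in> \<nat>" if i: "i \<in> {1..r}" for i
      proof -
        have "\<bar>v i + of_nat j / of_nat r\<bar> \<le> (\<Sum>i=1..r. \<bar>v i + of_nat j / of_nat r\<bar>)"
          using i by (intro member_le_sum) auto
        moreover have "of_nat n0 \<le> (of_nat n :: rat)" using elim by simp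
        ultimately have "0 \<le> v i + of_nat j / of_nat r + of_nat n" using n0 by linarith
        moreover have "v i + of_nat j / of_nat r + of_nat n \<in> \<int>" by (rule Ints_add[OF v(3)[OF i] Ints_of_nat])
        ultimately show ?thesis unfolding coord by (simp only: Nats_altdef2 mem_Collect_eq simp_thms)
      qed
      then show ?case using v by (simp add: sym_weights_def)
    qed
  qed
  then show "\<forall>\<^sub>F n in sequentially.
     fls_nth (torus_knot_inv L r p p' (wscale (of_nat (j + n * r)) (fund_weight r 1))) k =
     fls_nth
       (q_poch_inf (q_denom r p) ^ (r - 1) /
        (\<Prod>\<alpha>\<in>positive_roots r. 1 - qpow (q_denom r p) (ip r \<alpha> (weyl_vector r))) *
        chi_bar (q_denom r p) r p p' (wscale (of_nat j) (fund_weight r 1))) k"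
  proof eventually_elim
    case (elim n)
    have sub: "sym_weights r (j + n * r) \<subseteq> A"
    proof
      fix v assume v: "v \<in> sym_weights r (j + n * r)"
      have "v i + of_nat j / of_nat r \<in> \<int>" if "i \<in> {1..r}" for i
      proof -
        have "shift_coord r (j + n * r) v i \<in> \<int>"
          using v that Nats_subset_Ints by (auto simp: sym_weights_def)
        then have "shift_coord r (j + n * r) v i - of_nat n \<in> \<int>" by (intro Ints_diff) auto
        then show ?thesis unfolding coord by simp
      qed
      then show "v \<in> A" using v A_iff by (simp add: sym_weights_def)
    qed
    have "fls_nth (\<Sum>\<beta>\<in>sym_weights r (j + n * r). ?T \<beta>) i = fls_nth (fls_set_sum ?T A) i" if "i \<le> K" for i
      unfolding fls_nth_sum
      by (rule fls_nth_set_sum[OF fin finite_sym_weights[OF r] sub _ that, symmetric]) (use elim in blast)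
    then show ?case
      unfolding rhs lhs K_def by (intro fls_nth_times_cong)
  qed
qed

end
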